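(* Let $\Omega$ be a Polish space with its Borel $\sigma$-algebra, let $\mathscr{T}=(T_t)_{t\in(0,\infty)}$ be a bounded semigroup of positive kernel operators on $B_b(\Omega)$ and let $\mathscr{S}=(S_t)_{t\in(0,\infty)}:=(T_t')_{t\in(0,\infty)}$ denote the dual semigroup on $\mathscr{M}(\Omega)$. If $T_{t_0}$ is strongly Feller for some $t_0\in(0,\infty)$, then the following assertions are equivalent: (i) For each $f\in B_b(\Omega)$, $T_tf$ converges pointwise to a function $Qf\in B_b(\Omega)$ as $t\to\infty$. (ii) For each $f\in B_b(\Omega)$, $T_tf$ converges uniformly on compact subsets of $\Omega$ to a function $Qf$ in $C_b(\Omega)$ as $t\to\infty$. (iii) For each $\nu\in\mathscr{M}(\Omega)$, $S_t\nu$ converges with respect to the total variation norm as $t\to\infty$. (iv) The space $\mathrm{fix}\,\mathscr{S}$ separates $\mathrm{fix}\,\mathscr{T}$. If the equivalent conditions (i)-(iv) are satisfied, then the limit operator $Q$ in (i) and (ii) is a kernel operator on $B_b(\Omega)$ that is ultra Feller.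
   Context: $\mathscr{M}(\Omega)$ is the space of finite signed Borel measures with the total variation norm; $B_b(\Omega)$ (resp. $C_b(\Omega)$) is the space of bounded real-valued Borel measurable (resp. continuous) functions with the supremum norm; $\langle\mu,f\rangle=\int_\Omega f\,d\mu$. A bounded kernel on $\Omega$ is a map $k:\Omega\times\mathscr{B}(\Omega)\to\mathbb{R}$, where $\mathscr{B}(\Omega)$ is the Borel $\sigma$-algebra, such that $k(\cdot,A)$ is measurable for each $A$, $k(x,\cdot)$ is a finite signed measure for each $x$, and $\sup_x|k|(x,\Omega)<\infty$ (total variation). An operator $T$ on $B_b(\Omega)$ is a kernel operator with kernel $k$ if $(Tf)(x)=\int_\Omega f(y)\,k(x,dy)$; it is positive iff $k\ge0$. Its dual $T'$ on $\mathscr{M}(\Omega)$ is $(T'\mu)(A)=\int_\Omega k(x,A)\,d\mu(x)$. A semigroup $(T_t)_{t\in(0,\infty)}$ satisfies $T_{t+s}=T_tT_s$ for $s,t>0$ (no regularity in $t$ is assumed) and is bounded if $\sup_{t>0}\|T_t\|<\infty$. $\mathrm{fix}\,\mathscr{T}$ and $\mathrm{fix}\,\mathscr{S}$ are the sets of common fixed points of all $T_t$, resp. all $S_t$, $t>0$. "$\mathrm{fix}\,\mathscr{S}$ separates $\mathrm{fix}\,\mathscr{T}$" means: for every nonzero $f\in\mathrm{fix}\,\mathscr{T}$ there is $\nu\in\mathrm{fix}\,\mathscr{S}$ with $\langle\nu,f\rangle\ne0$. A kernel operator $T$ on $B_b(\Omega)$ is strongly Feller if $TB_b(\Omega)\subseteq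 C_b(\Omega)$. The strict topology $\beta_0$ on $C_b(\Omega)$ is the locally convex topology generated by the seminorms $p_\varphi(f)=\|\varphi f\|_\infty$, where $\varphi:\Omega\to\mathbb{R}$ ranges over all bounded functions vanishing at infinity, i.e. for every $\varepsilon>0$ there is a compact $K\subseteq\Omega$ with $|\varphi(x)|\le\varepsilon$ for $x\in\Omega\setminus K$. A kernel operator on $B_b(\Omega)$ is ultra Feller if it maps bounded subsets of $B_b(\Omega)$ to relatively $\beta_0$-compact subsets of $C_b(\Omega)$. *)

theory Defs
  imports "HOL-Analysis.Analysis"
begin

text \<open>The space of bounded continuous functions is the library set \<^const>\<open>bcontfun\<close>. Functions are
  kept as plain functions; the supremum norm takes values in \<^typ>\<open>ennreal\<close>, so that it is
  meaningful (possibly infinite) for every function.\<close>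

definition bounded_borel :: "('a::topological_space \<Rightarrow> real) set" where
  "bounded_borel = {f \<in> borel_measurable borel. bounded (range f)}"

definition sup_norm :: "('a \<Rightarrow> real) \<Rightarrow> ennreal" where
  "sup_norm f = (SUP x. ennreal \<bar>f x\<bar>)"

definition op_norm ::
    "(('a::topological_space \<Rightarrow> real) \<Rightarrow> ('a \<Rightarrow> real)) \<Rightarrow> ennreal" where
  "op_norm T = (SUP f\<in>{f \<in> bounded_borel. sup_norm f \<le> 1}. sup_norm (T f))"

text \<open>A signed measure is encoded as a real-valued set function. It is required to vanish on
  non-Borel sets, so that two signed measures are equal iff they agree on the Borel sets.\<close>

definition signed_measures :: "('a::topological_space set \<Rightarrow> real) set" where
  "signed_measures = {\<mu>. \<mu> {} = 0 \<and> (\<forall>A. A \<notin> sets borel \<longrightarrow> \<mu> A = 0) \<and>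
     (\<forall>A :: nat \<Rightarrow> 'a set. range A \<subseteq> sets borel \<longrightarrow> disjoint_family A \<longrightarrow>
        (\<lambda>n. \<mu> (A n)) sums \<mu> (\<Union>n. A n))}"

definition total_variation :: "('a::topological_space set \<Rightarrow> real) \<Rightarrow> 'a set \<Rightarrow> ennreal" where
  "total_variation \<mu> A =
     (SUP P\<in>{P. finite P \<and> disjoint P \<and> P \<subseteq> sets borel \<and> \<Union>P = A}. \<Sum>B\<in>P. ennreal \<bar>\<mu> B\<bar>)"

definition tv_norm :: "('a::topological_space set \<Rightarrow> real) \<Rightarrow> ennreal" where
  "tv_norm \<mu> = total_variation \<mu> UNIV"

text \<open>The positive part in the Jordan decomposition of \<open>\<mu>\<close>; the negative part is the positive part
  of \<open>-\<mu>\<close>. As \<^const>\<open>ennreal\<close> truncates negative numbers to \<open>0\<close> and \<open>\<mu> {} = 0\<close>, the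
  supremum is that of the real numbers \<open>\<mu> B\<close>.\<close>

definition positive_part :: "('a::topological_space set \<Rightarrow> real) \<Rightarrow> 'a measure" where
  "positive_part \<mu> =
     measure_of UNIV (sets borel) (\<lambda>A. SUP B\<in>{B \<in> sets borel. B \<subseteq> A}. ennreal (\<mu> B))"

definition pairing :: "('a::topological_space set \<Rightarrow> real) \<Rightarrow> ('a \<Rightarrow> real) \<Rightarrow> real" where
  "pairing \<mu> f =
     integral\<^sup>L (positive_part \<mu>) f - integral\<^sup>L (positive_part (\<lambda>A. - \<mu> A)) f"

definition bounded_kernel :: "('a::topological_space \<Rightarrow> 'a set \<Rightarrow> real) \<Rightarrow> bool" where
  "bounded_kernel k \<longleftrightarrow>
     (\<forall>A\<in>sets borel. (\<lambda>x. k x A) \<in> borel_measurable borel) \<and>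
     (\<forall>x. k x \<in> signed_measures) \<and>
     (SUP x. total_variation (k x) UNIV) < \<infinity>"

definition positive_kernel :: "('a \<Rightarrow> 'a set \<Rightarrow> real) \<Rightarrow> bool" where
  "positive_kernel k \<longleftrightarrow> (\<forall>x A. 0 \<le> k x A)"

text \<open>Operators on the bounded Borel functions are functions on all of \<^typ>\<open>'a \<Rightarrow> real\<close>; only
  their values on \<^const>\<open>bounded_borel\<close> are relevant.\<close>

definition has_kernel ::
    "(('a::topological_space \<Rightarrow> real) \<Rightarrow> ('a \<Rightarrow> real)) \<Rightarrow> ('a \<Rightarrow> 'a set \<Rightarrow> real) \<Rightarrow> bool" where
  "has_kernel T k \<longleftrightarrow>
     bounded_kernel k \<and> (\<forall>f\<in>bounded_borel. \<forall>x. T f x = pairing (k x) f)"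

definition kernel_operator ::
    "(('a::topological_space \<Rightarrow> real) \<Rightarrow> ('a \<Rightarrow> real)) \<Rightarrow> bool" where
  "kernel_operator T \<longleftrightarrow> (\<exists>k. has_kernel T k)"

definition dual_operator ::
    "('a::topological_space \<Rightarrow> 'a set \<Rightarrow> real) \<Rightarrow> ('a set \<Rightarrow> real) \<Rightarrow> ('a set \<Rightarrow> real)" where
  "dual_operator k \<mu> = (\<lambda>A. pairing \<mu> (\<lambda>x. k x A))"

definition strongly_feller ::
    "(('a::topological_space \<Rightarrow> real) \<Rightarrow> ('a \<Rightarrow> real)) \<Rightarrow> bool" where
  "strongly_feller T \<longleftrightarrow> kernel_operator T \<and> T ` bounded_borel \<subseteq> bcontfun"

definition vanishing_at_infinity :: "('a::topological_space \<Rightarrow> real) set" where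
  "vanishing_at_infinity =
     {\<phi>. bounded (range \<phi>) \<and> (\<forall>\<epsilon>>0. \<exists>K. compact K \<and> (\<forall>x. x \<notin> K \<longrightarrow> \<bar>\<phi> x\<bar> \<le> \<epsilon>))}"

text \<open>The open balls of the seminorms \<open>f \<mapsto> \<parallel>\<phi> f\<parallel>\<close> form a subbase. Its union is
  \<^const>\<open>bcontfun\<close>, which therefore is the underlying set of the topology.\<close>

definition strict_topology :: "('a::topological_space \<Rightarrow> real) topology" where
  "strict_topology = topology_generated_by
     {{g \<in> bcontfun. sup_norm (\<lambda>x. \<phi> x * (g x - f x)) < ennreal \<epsilon>} | \<phi> f \<epsilon>.
        \<phi> \<in> vanishing_at_infinity \<and> f \<in> bcontfun \<and> 0 < \<epsilon>}"

definition relatively_compactin :: "'a topology \<Rightarrow> 'a set \<Rightarrow> bool" where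
  "relatively_compactin X S \<longleftrightarrow> S \<subseteq> topspace X \<and> compactin X (X closure_of S)"

definition ultra_feller ::
    "(('a::topological_space \<Rightarrow> real) \<Rightarrow> ('a \<Rightarrow> real)) \<Rightarrow> bool" where
  "ultra_feller T \<longleftrightarrow> kernel_operator T \<and>
     (\<forall>B. B \<subseteq> bounded_borel \<longrightarrow> (SUP f\<in>B. sup_norm f) < \<infinity> \<longrightarrow>
        relatively_compactin strict_topology (T ` B))"

definition semigroup_on :: "'b set \<Rightarrow> (real \<Rightarrow> 'b \<Rightarrow> 'b) \<Rightarrow> bool" where
  "semigroup_on X T \<longleftrightarrow> (\<forall>s>0. \<forall>t>0. \<forall>f\<in>X. T (t + s) f = T t (T s f))"

definition bounded_semigroup ::
    "(real \<Rightarrow> ('a::topological_space \<Rightarrow> real) \<Rightarrow> ('a \<Rightarrow> real)) \<Rightarrow> bool" where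
  "bounded_semigroup T \<longleftrightarrow>
     semigroup_on bounded_borel T \<and> (SUP t\<in>{0<..}. op_norm (T t)) < \<infinity>"

definition common_fix :: "'b set \<Rightarrow> (real \<Rightarrow> 'b \<Rightarrow> 'b) \<Rightarrow> 'b set" where
  "common_fix X T = {f \<in> X. \<forall>t>0. T t f = f}"

definition converges_pointwise ::
    "(real \<Rightarrow> ('a::topological_space \<Rightarrow> real) \<Rightarrow> ('a \<Rightarrow> real)) \<Rightarrow>
     (('a \<Rightarrow> real) \<Rightarrow> ('a \<Rightarrow> real)) \<Rightarrow> bool" where
  "converges_pointwise T Q \<longleftrightarrow>
     (\<forall>f\<in>bounded_borel. Q f \<in> bounded_borel \<and> (\<forall>x. ((\<lambda>t. T t f x) \<longlongrightarrow> Q f x) at_top))"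

definition converges_on_compacts ::
    "(real \<Rightarrow> ('a::topological_space \<Rightarrow> real) \<Rightarrow> ('a \<Rightarrow> real)) \<Rightarrow>
     (('a \<Rightarrow> real) \<Rightarrow> ('a \<Rightarrow> real)) \<Rightarrow> bool" where
  "converges_on_compacts T Q \<longleftrightarrow>
     (\<forall>f\<in>bounded_borel. Q f \<in> bcontfun \<and>
        (\<forall>K. compact K \<longrightarrow> uniform_limit K (\<lambda>t. T t f) (Q f) at_top))"

definition converges_in_variation ::
    "(real \<Rightarrow> ('a::topological_space set \<Rightarrow> real) \<Rightarrow> ('a set \<Rightarrow> real)) \<Rightarrow> bool" where
  "converges_in_variation S \<longleftrightarrow>
     (\<forall>\<nu>\<in>signed_measures. \<exists>\<mu>\<in>signed_measures.
        ((\<lambda>t. tv_norm (\<lambda>A. S t \<nu> A - \<mu> A)) \<longlongrightarrow> 0) at_top)"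

definition separates ::
    "('a::topological_space set \<Rightarrow> real) set \<Rightarrow> ('a \<Rightarrow> real) set \<Rightarrow> bool" where
  "separates M F \<longleftrightarrow> (\<forall>f\<in>F. f \<noteq> (\<lambda>_. 0) \<longrightarrow> (\<exists>\<nu>\<in>M. pairing \<nu> f \<noteq> 0))"

end

(* By the strong Feller property a single measure dominates all kernels K t0 x, and T t0 maps bounded
   sequences to sequences with pointwise convergent subsequences. This compactness and the Nikodym
   convergence theorem give the equivalence of (i), (ii), (iii), and (iv) follows from (i) by taking
   the limit measures as fixed measures.

   For the converse, let omega be an invariant measure of maximal support. The fixed function that
   dominates the upper limit of T t applied to the complement of that support vanishes by the
   separation hypothesis, so everything reduces to convergence in L1(omega). There a fixed function
   h dominates all limit points, and the h-transform of the semigroup is Markovian with the invariant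
   measure rho = h omega. A limit point b of an orbit has constant L2 norm along the semigroup, hence
   the kernels act deterministically on its level sets. By compactness the ring of sets on which the
   kernels act deterministically is atomic. The images of an atom under the times k t / N! with k <= N
   cannot all be disjoint if N is large, so one of these times fixes the atom, and hence so does t.
   Therefore b is fixed, and the orbit converges to it. *)

theory Submission
  imports Defs "HOL-Library.Diagonal_Subsequence"
begin

section \<open>Bounded Borel functions and Daniell functionals\<close>

text \<open>Suprema over all large times are measurable only because \<open>P t f\<close> is
  continuous for \<open>t \<ge> t0\<close>, and different times are linked by divisibility instead
  of continuity. The second obstacle is that the semigroup is merely bounded: it is contractive in
  L1 of an invariant measure but not in the supremum norm, and it has no reason to fix constants,
  whereas the variance argument needs probability kernels. Dividing by the fixed function
  \<open>h\<close> repairs this; the zeros of \<open>h\<close> are harmless because they form a null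
  set for \<open>\<rho>\<close>. Kernels, mixtures and limits of measures are all constructed as
  functionals on bounded Borel functions that are continuous along decreasing sequences
  (\<open>daniell\<close>). Setwise limits of such functionals are again of this kind, which is how
  the limit operator acquires a kernel. A second application of \<open>P t0\<close> turns pointwise
  convergence into uniform convergence on compact sets; as \<open>Q f = P t0 (P t0 (Q f))\<close>,
  this yields the ultra Feller property.\<close>

lemma bounded_borelI:
  assumes "f \<in> borel_measurable borel" "\<And>x. \<bar>f x\<bar> \<le> C"
  shows "f \<in> bounded_borel"
  using assms unfolding bounded_borel_def by (auto simp: bounded_iff)

lemma bounded_borel_measurable [measurable_dest]:
  "f \<in> bounded_borel \<Longrightarrow> f \<in> borel_measurable borel"
  by (simp add: bounded_borel_def)

lemma bounded_borelE:
  assumes "f \<in> bounded_borel"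
  obtains C where "C > 0" "\<And>x. \<bar>f x\<bar> \<le> C"
proof -
  from assms obtain C where "\<And>x. \<bar>f x\<bar> \<le> C"
    unfolding bounded_borel_def bounded_iff by auto
  then have "\<bar>f x\<bar> \<le> max C 1" for x
    by (simp add: le_max_iff_disj)
  then show thesis by (intro that[of "max C 1"]) auto
qed

lemma bounded_borel_const [simp, intro]: "(\<lambda>x. c) \<in> bounded_borel"
  by (rule bounded_borelI[of _ "\<bar>c\<bar>"]) auto

lemma bounded_borel_add [intro]:
  assumes "f \<in> bounded_borel" "g \<in> bounded_borel"
  shows "(\<lambda>x. f x + g x) \<in> bounded_borel"
proof -
  obtain C where C: "\<And>x. \<bar>f x\<bar> \<le> C" using assms(1) by (metis bounded_borelE)
  obtain D where D: "\<And>x. \<bar>g x\<bar> \<le> D" using assms(2) by (metis bounded_borelE)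
  have [measurable]: "f \<in> borel_measurable borel" "g \<in> borel_measurable borel"
    using assms by auto
  show ?thesis
    by (rule bounded_borelI[of _ "C + D"]) (auto intro: order_trans[OF abs_triangle_ineq] add_mono C D)
qed

lemma bounded_borel_mult [intro]:
  assumes "f \<in> bounded_borel" "g \<in> bounded_borel"
  shows "(\<lambda>x. f x * g x) \<in> bounded_borel"
proof -
  obtain C where C: "\<And>x. \<bar>f x\<bar> \<le> C" "C > 0" using assms(1) by (metis bounded_borelE)
  obtain D where D: "\<And>x. \<bar>g x\<bar> \<le> D" using assms(2) by (metis bounded_borelE)
  have [measurable]: "f \<in> borel_measurable borel" "g \<in> borel_measurable borel"
    using assms by auto
  show ?thesis
    by (rule bounded_borelI[of _ "C * D"]) (auto simp: abs_mult intro!: mult_mono C less_imp_le[OF C(2)] D)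
qed

lemma bounded_borel_cmult [intro]:
  "f \<in> bounded_borel \<Longrightarrow> (\<lambda>x. c * f x) \<in> bounded_borel"
  by (rule bounded_borel_mult) auto

lemma bounded_borel_uminus [intro]:
  "f \<in> bounded_borel \<Longrightarrow> (\<lambda>x. - f x) \<in> bounded_borel"
  using bounded_borel_cmult[of f "-1"] by simp

lemma bounded_borel_diff [intro]:
  "f \<in> bounded_borel \<Longrightarrow> g \<in> bounded_borel \<Longrightarrow> (\<lambda>x. f x - g x) \<in> bounded_borel"
  using bounded_borel_add[of f "\<lambda>x. - g x"] by auto

lemma bounded_borel_power2 [intro]:
  "f \<in> bounded_borel \<Longrightarrow> (\<lambda>x. (f x)\<^sup>2) \<in> bounded_borel"
  unfolding power2_eq_square by (rule bounded_borel_mult)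

lemma bounded_borel_abs [intro]:
  assumes "f \<in> bounded_borel" shows "(\<lambda>x. \<bar>f x\<bar>) \<in> bounded_borel"
proof -
  obtain C where C: "\<And>x. \<bar>f x\<bar> \<le> C" using assms by (metis bounded_borelE)
  have [measurable]: "f \<in> borel_measurable borel" using assms by auto
  show ?thesis by (rule bounded_borelI[of _ C]) (auto simp: C)
qed

lemma bounded_borel_max [intro]:
  assumes "f \<in> bounded_borel" shows "(\<lambda>x. max 0 (f x)) \<in> bounded_borel"
proof -
  have "(\<lambda>x. max 0 (f x)) = (\<lambda>x. (1/2) * (f x + \<bar>f x\<bar>))" by (auto simp: max_def)
  then show ?thesis using bounded_borel_cmult[OF bounded_borel_add[OF assms bounded_borel_abs[OF assms]], of "1/2"] by simp
qed

lemma bounded_borel_indicator [simp, intro]: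
  "A \<in> sets borel \<Longrightarrow> indicator A \<in> bounded_borel"
  by (rule bounded_borelI[of _ 1]) (auto simp: indicator_def)

lemmas bounded_borel_intros = bounded_borel_const bounded_borel_indicator bounded_borel_add
  bounded_borel_diff bounded_borel_mult bounded_borel_uminus bounded_borel_power2 bounded_borel_abs
  bounded_borel_max

lemma bounded_borel_LIMSEQ:
  assumes "\<And>n. F n \<in> bounded_borel" "\<And>n x. \<bar>F n x\<bar> \<le> C" "\<And>x. (\<lambda>n. F n x) \<longlonglongrightarrow> f x"
  shows "f \<in> bounded_borel" "\<And>x. \<bar>f x\<bar> \<le> C"
proof -
  show le: "\<And>x. \<bar>f x\<bar> \<le> C"
    by (rule LIMSEQ_le_const2[OF tendsto_rabs[OF assms(3)]]) (use assms(2) in auto)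
  have "f \<in> borel_measurable borel"
    by (rule borel_measurable_LIMSEQ_real[OF assms(3)]) (use assms(1) in auto)
  then show "f \<in> bounded_borel" using le by (rule bounded_borelI)
qed

text \<open>Monotone class principle. The library induction for nonnegative measurable functions
  passes through functions whose boundedness has to be recovered at each stage; a general function
  is then the difference of its positive and negative parts.\<close>

lemma bounded_borel_induct [consumes 1, case_names indicator add cmult lim]:
  fixes Pr :: "('a::topological_space \<Rightarrow> real) \<Rightarrow> bool"
  assumes f: "f \<in> bounded_borel"
    and ind: "\<And>A. A \<in> sets borel \<Longrightarrow> Pr (indicator A)"
    and add: "\<And>f g. f \<in> bounded_borel \<Longrightarrow> g \<in> bounded_borel \<Longrightarrow> Pr f \<Longrightarrow> Pr g \<Longrightarrow> Pr (\<lambda>x. f x + g x)"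
    and cmult: "\<And>f c. f \<in> bounded_borel \<Longrightarrow> Pr f \<Longrightarrow> Pr (\<lambda>x. c * f x)"
    and lim: "\<And>F f. (\<And>n::nat. F n \<in> bounded_borel) \<Longrightarrow> (\<And>n. Pr (F n)) \<Longrightarrow> (\<And>x. incseq (\<lambda>n. F n x)) \<Longrightarrow>
      (\<And>x. (\<lambda>n. F n x) \<longlonglongrightarrow> f x) \<Longrightarrow> f \<in> bounded_borel \<Longrightarrow> Pr f"
  shows "Pr f"
proof -
  have nn: "g \<in> bounded_borel \<Longrightarrow> Pr g" if "g \<in> borel_measurable borel" "\<And>x. 0 \<le> g x" for g
    using that
  proof (induction g rule: borel_measurable_induct_real)
    case (set A)
    then show ?case using ind by simp
  next
    case (mult u c)
    show ?case
    \<comment> \<open>Only \<open>c * u\<close> is known to be bounded. Division transfers this to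
      \<open>u\<close>, except for \<open>c = 0\<close>, where the product is a multiple of an
      indicator.\<close>
    proof (cases "c = 0")
      case True
      then show ?thesis using cmult[OF _ ind, of "{}" 0] by simp
    next
      case False
      have "u = (\<lambda>x. (1/c) * (c * u x))" using False by auto
      then have "u \<in> bounded_borel" using bounded_borel_cmult[OF mult.prems, of "1/c"] by simp
      then show ?thesis using mult cmult by simp
    qed
  next
    case (add u v)
    obtain C where C: "\<And>x. \<bar>v x + u x\<bar> \<le> C" using add.prems by (metis bounded_borelE)
    have le: "\<bar>u x\<bar> \<le> C" "\<bar>v x\<bar> \<le> C" for x using C[of x] add(2,4)[of x] by auto
    have "u \<in> bounded_borel" by (rule bounded_borelI[OF add(1) le(1)])
    moreover have "v \<in> bounded_borel" by (rule bounded_borelI[OF add(3) le(2)])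
    ultimately show ?case using add assms(3)[of v u] by blast
  next
    case (seq U)
    obtain C where C: "\<And>x. \<bar>g x\<bar> \<le> C" using seq.prems by (metis bounded_borelE)
    have inc: "incseq (\<lambda>n. U n x)" for x using incseqD[OF seq(3)] by (auto simp: incseq_def le_fun_def)
    have conv: "(\<lambda>n. U n x) \<longlonglongrightarrow> g x" for x using seq(4)[of x] by simp
    have le: "U n x \<le> g x" for n x using inc[of x] conv[of x] by (rule incseq_le)
    have Ub: "U n \<in> bounded_borel" for n
    proof (rule bounded_borelI[of _ C])
      show "\<bar>U n x\<bar> \<le> C" for x using le[of n x] seq(2)[of n x] C[of x] by auto
    qed (use seq in auto)
    show ?case by (rule lim[OF Ub _ inc conv seq.prems]) (use seq(5) Ub in auto)
  qed
  have g: "(\<lambda>x. max 0 (f x)) \<in> bounded_borel" "(\<lambda>x. max 0 (- f x)) \<in> bounded_borel"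
    using f by auto
  have "Pr (\<lambda>x. max 0 (f x) + (-1) * max 0 (- f x))"
    using g by (intro add cmult nn bounded_borel_cmult) auto
  also have "(\<lambda>x. max 0 (f x) + (-1) * max 0 (- f x)) = f" by (auto simp: max_def)
  finally show ?thesis .
qed

text \<open>Integer times are written \<open>real (Suc n)\<close> throughout because the semigroup
  is only meaningful at positive times.\<close>

lemma real_Suc_at_top: "filterlim (\<lambda>n. real (Suc n)) at_top sequentially"
  using filterlim_compose[OF filterlim_real_sequentially filterlim_Suc] by simp

section \<open>Finite Borel measures as sigma-continuous functionals\<close>

definition finite_borel :: "'a::topological_space measure \<Rightarrow> bool" where
  "finite_borel M \<longleftrightarrow> finite_measure M \<and> sets M = sets borel"

lemma finite_borelD:
  assumes "finite_borel M"
  shows "finite_measure M" "sets M = sets borel" "space M = UNIV" "measurable M N = measurable borel N"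
proof -
  show s: "finite_measure M" "sets M = sets borel" using assms by (auto simp: finite_borel_def)
  show "space M = UNIV" using sets_eq_imp_space_eq[OF s(2)] by simp
  show "measurable M N = measurable borel N" using s(2) by (rule measurable_cong_sets) simp
qed

lemma integrable_bounded_borel:
  assumes "finite_borel M" "f \<in> bounded_borel" shows "integrable M f"
proof -
  interpret finite_measure M using assms(1) by (rule finite_borelD)
  obtain C where C: "\<And>x. \<bar>f x\<bar> \<le> C" using assms(2) by (metis bounded_borelE)
  show ?thesis
    using assms C by (intro integrable_const_bound[of _ C]) (auto simp: finite_borelD)
qed

lemma bounded_borel_DCT:
  assumes M: "finite_borel M" and F: "\<And>n. F n \<in> bounded_borel" "\<And>n x. \<bar>F n x\<bar> \<le> C"
    and lim: "AE x in M. (\<lambda>n. F n x) \<longlonglongrightarrow> f x" and f: "f \<in> bounded_borel"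
  shows "(\<lambda>n. integral\<^sup>L M (F n)) \<longlonglongrightarrow> integral\<^sup>L M f"
proof (rule integral_dominated_convergence[where w="\<lambda>_. C"])
  show "integrable M (\<lambda>_. C)" using integrable_bounded_borel[OF M] by auto
qed (use assms in \<open>auto simp: finite_borelD\<close>)

text \<open>The positive linear functionals with Daniell's continuity condition are exactly the
  integrals with respect to finite Borel measures, by \<open>daniell_integral\<close> and
  \<open>daniell_representation\<close>. Only the values on \<open>bounded_borel\<close>
  matter.\<close>

definition daniell :: "(('a::topological_space \<Rightarrow> real) \<Rightarrow> real) \<Rightarrow> bool" where
  "daniell \<Phi> \<longleftrightarrow>
     (\<forall>f\<in>bounded_borel. \<forall>g\<in>bounded_borel. \<Phi> (\<lambda>x. f x + g x) = \<Phi> f + \<Phi> g) \<and>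
     (\<forall>f\<in>bounded_borel. \<forall>c. \<Phi> (\<lambda>x. c * f x) = c * \<Phi> f) \<and>
     (\<forall>f\<in>bounded_borel. (\<forall>x. 0 \<le> f x) \<longrightarrow> 0 \<le> \<Phi> f) \<and>
     (\<forall>F. (\<forall>n::nat. F n \<in> bounded_borel) \<longrightarrow> (\<forall>x. decseq (\<lambda>n. F n x)) \<longrightarrow>
        (\<forall>x. (\<lambda>n. F n x) \<longlonglongrightarrow> 0) \<longrightarrow> (\<lambda>n. \<Phi> (F n)) \<longlonglongrightarrow> 0)"

lemma daniellD:
  assumes "daniell \<Phi>"
  shows "f \<in> bounded_borel \<Longrightarrow> g \<in> bounded_borel \<Longrightarrow> \<Phi> (\<lambda>x. f x + g x) = \<Phi> f + \<Phi> g"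
    and "f \<in> bounded_borel \<Longrightarrow> \<Phi> (\<lambda>x. c * f x) = c * \<Phi> f"
    and "f \<in> bounded_borel \<Longrightarrow> (\<And>x. 0 \<le> f x) \<Longrightarrow> 0 \<le> \<Phi> f"
    and "(\<And>n::nat. F n \<in> bounded_borel) \<Longrightarrow> (\<And>x. decseq (\<lambda>n. F n x)) \<Longrightarrow>
        (\<And>x. (\<lambda>n. F n x) \<longlonglongrightarrow> 0) \<Longrightarrow> (\<lambda>n. \<Phi> (F n)) \<longlonglongrightarrow> 0"
  using assms unfolding daniell_def by blast+

lemma daniell_diff:
  assumes "daniell \<Phi>" "f \<in> bounded_borel" "g \<in> bounded_borel"
  shows "\<Phi> (\<lambda>x. f x - g x) = \<Phi> f - \<Phi> g"
  using daniellD(1)[OF assms(1,2), of "\<lambda>x. -1 * g x"] daniellD(2)[OF assms(1,3), of "-1"] assms(3)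
  by (auto intro: bounded_borel_cmult)

lemma daniell_mono:
  assumes "daniell \<Phi>" "f \<in> bounded_borel" "g \<in> bounded_borel" "\<And>x. f x \<le> g x"
  shows "\<Phi> f \<le> \<Phi> g"
  using daniellD(3)[OF assms(1), of "\<lambda>x. g x - f x"] daniell_diff[OF assms(1,3,2)] assms by auto

lemma daniell_incseq:
  assumes "daniell \<Phi>" and F: "\<And>n::nat. F n \<in> bounded_borel" "\<And>x. incseq (\<lambda>n. F n x)" "\<And>x. (\<lambda>n. F n x) \<longlonglongrightarrow> f x"
    and f: "f \<in> bounded_borel"
  shows "(\<lambda>n. \<Phi> (F n)) \<longlonglongrightarrow> \<Phi> f"
proof -
  have "(\<lambda>n. \<Phi> (\<lambda>x. f x - F n x)) \<longlonglongrightarrow> 0"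
  proof (rule daniellD(4)[OF assms(1)])
    show "decseq (\<lambda>n. f x - F n x)" for x using F(2)[of x] by (auto simp: decseq_def incseq_def)
    show "(\<lambda>n. f x - F n x) \<longlonglongrightarrow> 0" for x using tendsto_diff[OF tendsto_const F(3)[of x], of "f x"] by simp
  qed (use F f in auto)
  then have "(\<lambda>n. \<Phi> f - \<Phi> (\<lambda>x. f x - F n x)) \<longlonglongrightarrow> \<Phi> f - 0" by (intro tendsto_intros)
  then show ?thesis using daniell_diff[OF assms(1) f F(1)] by simp
qed

lemma daniell_integral:
  assumes "finite_borel M" shows "daniell (integral\<^sup>L M)"
  unfolding daniell_def
proof (intro conjI ballI allI impI)
  fix F :: "nat \<Rightarrow> 'a \<Rightarrow> real"
  assume F: "\<forall>n. F n \<in> bounded_borel" "\<forall>x. decseq (\<lambda>n. F n x)" "\<forall>x. (\<lambda>n. F n x) \<longlonglongrightarrow> 0"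
  obtain C where C: "\<And>x. \<bar>F 0 x\<bar> \<le> C" using F(1) by (metis bounded_borelE)
  have "\<bar>F n x\<bar> \<le> C" for n x
  proof -
    have "0 \<le> F n x" by (rule decseq_ge) (use F in auto)
    moreover have "F n x \<le> F 0 x" using F(2) by (auto simp: decseq_def)
    ultimately show ?thesis using C[of x] by auto
  qed
  then show "(\<lambda>n. integral\<^sup>L M (F n)) \<longlonglongrightarrow> 0"
    using bounded_borel_DCT[OF assms, of F C "\<lambda>_. 0"] F by auto
qed (auto simp: integrable_bounded_borel[OF assms])

text \<open>Used with \<open>w = h\<close> and \<open>c = h x\<close> for the kernels of an
  h-transform, and with \<open>w\<close> an indicator and \<open>c = 1\<close> for the restriction
  of a kernel to a set.\<close>

lemma daniell_weighted:
  assumes D: "daniell \<Phi>" and w: "w \<in> bounded_borel" "\<And>x. 0 \<le> w x" and c: "0 \<le> c"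
  shows "daniell (\<lambda>f. \<Phi> (\<lambda>x. w x * f x) / c)"
  unfolding daniell_def
proof (intro conjI ballI allI impI)
  have wf: "(\<lambda>x. w x * f x) \<in> bounded_borel" if "f \<in> bounded_borel" for f using w that by auto
  fix f :: "'a \<Rightarrow> real" assume f: "f \<in> bounded_borel"
  show "\<Phi> (\<lambda>x. w x * (f x + g x)) / c = \<Phi> (\<lambda>x. w x * f x) / c + \<Phi> (\<lambda>x. w x * g x) / c"
    if "g \<in> bounded_borel" for g
    using daniellD(1)[OF D wf[OF f] wf[OF that]] by (simp add: distrib_left add_divide_distrib)
  show "\<Phi> (\<lambda>x. w x * (a * f x)) / c = a * (\<Phi> (\<lambda>x. w x * f x) / c)" for a
    using daniellD(2)[OF D wf[OF f], of a] by (simp add: mult.left_commute)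
  show "0 \<le> \<Phi> (\<lambda>x. w x * f x) / c" if "\<forall>x. 0 \<le> f x"
    using w that by (intro divide_nonneg_nonneg c daniellD(3)[OF D wf[OF f]]) auto
next
  fix F :: "nat \<Rightarrow> 'a \<Rightarrow> real"
  assume F: "\<forall>n. F n \<in> bounded_borel" "\<forall>x. decseq (\<lambda>n. F n x)" "\<forall>x. (\<lambda>n. F n x) \<longlonglongrightarrow> 0"
  have "(\<lambda>n. \<Phi> (\<lambda>x. w x * F n x)) \<longlonglongrightarrow> 0"
  proof (rule daniellD(4)[OF D])
    show "decseq (\<lambda>n. w x * F n x)" for x using F(2) w(2)[of x] by (auto simp: decseq_def intro!: mult_left_mono)
    show "(\<lambda>n. w x * F n x) \<longlonglongrightarrow> 0" for x by (rule tendsto_mult_right_zero) (use F(3) in blast)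
  qed (use F w in auto)
  then show "(\<lambda>n. \<Phi> (\<lambda>x. w x * F n x) / c) \<longlonglongrightarrow> 0" by (rule tendsto_divide_zero)
qed

text \<open>The set function \<open>A \<mapsto> \<Phi> (indicator A)\<close> is countably additive,
  since the indicators of the tails of a disjoint union decrease to 0. Both functionals then agree
  on indicators, hence everywhere by \<open>bounded_borel_induct\<close>.\<close>

lemma daniell_representation:
  assumes D: "daniell \<Phi>"
  obtains M where "finite_borel M" "\<And>f. f \<in> bounded_borel \<Longrightarrow> \<Phi> f = integral\<^sup>L M f"
proof -
  define M where "M = measure_of UNIV (sets borel) (\<lambda>A. ennreal (\<Phi> (indicator A)))"
  have sM: "sets M = sets borel" "space M = UNIV"
    unfolding M_def by (simp_all add: sigma_algebra.sets_measure_of_eq[OF sets.sigma_algebra_axioms[of borel, simplified]])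
  have pos: "0 \<le> \<Phi> (indicator A)" if "A \<in> sets borel" for A
    using that by (intro daniellD(3)[OF D]) auto
  have zero: "\<Phi> (\<lambda>x. 0) = 0"
    using daniellD(2)[OF D, of "\<lambda>x. 0" 0] by simp
  have ca: "countably_additive (sets borel) (\<lambda>A. ennreal (\<Phi> (indicator A)))"
  proof (rule countably_additiveI)
    fix A :: "nat \<Rightarrow> 'a set"
    assume A: "range A \<subseteq> sets borel" "disjoint_family A" "(\<Union>i. A i) \<in> sets borel"
    have Ai: "A i \<in> sets borel" for i using A by auto
    define U where "U n = (\<Union>i<n. A i)" for n
    have U: "U n \<in> sets borel" for n unfolding U_def using Ai by auto
    have indU: "indicator (U n) = (\<lambda>x. \<Sum>i<n. indicator (A i) x :: real)" for n
    proof
      fix x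
      have "indicator (U n) x = (\<Sum>i<n. indicator (A i) x :: real)"
        unfolding U_def using indicator_UN_disjoint[of "{..<n}" A x] A(2)
        by (auto simp: disjoint_family_on_def)
      then show "indicator (U n) x = (\<Sum>i<n. indicator (A i) x :: real)" .
    qed
    have sumU: "\<Phi> (indicator (U n)) = (\<Sum>i<n. \<Phi> (indicator (A i)))" for n
    proof (induction n)
      case 0
      have "indicator (U 0) = (\<lambda>x::'a. 0::real)" by (auto simp: U_def)
      then show ?case using zero by simp
    next
      case (Suc n)
      have "indicator (U (Suc n)) = (\<lambda>x. indicator (U n) x + indicator (A n) x :: real)"
        unfolding indU by auto
      then show ?case using Suc daniellD(1)[OF D, of "indicator (U n)" "indicator (A n)"] U Ai by auto
    qed
    let ?I = "\<Union>i. A i"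
    have "(\<lambda>n. \<Phi> (\<lambda>x. indicator ?I x - indicator (U n) x)) \<longlonglongrightarrow> 0"
    proof (rule daniellD(4)[OF D])
      show "(\<lambda>x. indicator ?I x - indicator (U n) x :: real) \<in> bounded_borel" for n
        using U A(3) by (intro bounded_borel_diff) auto
      show "decseq (\<lambda>n. indicator ?I x - indicator (U n) x :: real)" for x
        unfolding decseq_def U_def by (auto simp: indicator_def)
      show "(\<lambda>n. indicator ?I x - indicator (U n) x :: real) \<longlonglongrightarrow> 0" for x
      proof (cases "x \<in> ?I")
        case True
        then obtain i where "x \<in> A i" by auto
        then have "\<forall>\<^sub>F n in sequentially. indicator ?I x - indicator (U n) x = (0::real)"
          by (intro eventually_sequentiallyI[of "Suc i"]) (auto simp: U_def indicator_def)
        then show ?thesis by (rule tendsto_eventually)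
      next
        case False
        then have "indicator ?I x - indicator (U n) x = (0::real)" for n by (auto simp: U_def indicator_def)
        then show ?thesis by simp
      qed
    qed
    moreover have "\<Phi> (\<lambda>x. indicator ?I x - indicator (U n) x) = \<Phi> (indicator ?I) - (\<Sum>i<n. \<Phi> (indicator (A i)))" for n
      using daniell_diff[OF D, of "indicator ?I" "indicator (U n)"] U A(3) sumU by auto
    ultimately have "(\<lambda>n. \<Phi> (indicator ?I) - (\<Sum>i<n. \<Phi> (indicator (A i)))) \<longlonglongrightarrow> 0" by simp
    then have "(\<lambda>n. \<Phi> (indicator ?I) - (\<Phi> (indicator ?I) - (\<Sum>i<n. \<Phi> (indicator (A i))))) \<longlonglongrightarrow> \<Phi> (indicator ?I) - 0"
      by (intro tendsto_intros)
    then have "(\<lambda>i. \<Phi> (indicator (A i))) sums \<Phi> (indicator ?I)"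
      by (simp add: sums_def)
    then show "(\<Sum>i. ennreal (\<Phi> (indicator (A i)))) = ennreal (\<Phi> (indicator ?I))"
      using pos Ai by (intro suminf_ennreal_eq) auto
  qed
  have em: "emeasure M A = ennreal (\<Phi> (indicator A))" if "A \<in> sets borel" for A
    unfolding M_def
  proof (rule emeasure_measure_of_sigma)
    show "positive (sets borel) (\<lambda>A. ennreal (\<Phi> (indicator A)))"
      using zero by (auto simp: positive_def indicator_def [abs_def])
    show "sigma_algebra UNIV (sets borel)" using sets.sigma_algebra_axioms[of borel] by simp
  qed (use ca that in auto)
  have fM: "finite_borel M"
    unfolding finite_borel_def using sM em[of UNIV] by (auto intro!: finite_measureI)
  note DM = daniell_integral[OF fM]
  have meas: "measure M A = \<Phi> (indicator A)" if "A \<in> sets borel" for A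
    using em[OF that] pos[OF that] by (simp add: measure_def)
  have "\<Phi> f = integral\<^sup>L M f" if "f \<in> bounded_borel" for f
    using that
  proof (induction rule: bounded_borel_induct)
    case (indicator A)
    then show ?case using meas[of A] sM by simp
  next
    case (add f g)
    then show ?case using daniellD(1)[OF D] by (simp add: integrable_bounded_borel[OF fM])
  next
    case (cmult f c)
    then show ?case using daniellD(2)[OF D] by simp
  next
    case (lim F f)
    have "(\<lambda>n. \<Phi> (F n)) \<longlonglongrightarrow> \<Phi> f" "(\<lambda>n. integral\<^sup>L M (F n)) \<longlonglongrightarrow> integral\<^sup>L M f"
      by (rule daniell_incseq[OF D lim(1-4)], rule daniell_incseq[OF DM lim(1-4)])
    then show ?case using lim(5) LIMSEQ_unique by simp
  qed
  with fM show thesis by (rule that)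
qed

text \<open>The Nikodym convergence theorem. If \<open>F j\<close> decreases to \<open>0\<close> but \<open>\<Psi> (F j)\<close> does not, the
  \<open>\<Phi> n\<close> can be made to oscillate on an alternating series of a subsequence of \<open>F\<close>.\<close>

lemma daniell_limit:
  assumes D: "\<And>n::nat. daniell (\<Phi> n)"
    and lim: "\<And>f. f \<in> bounded_borel \<Longrightarrow> (\<lambda>n. \<Phi> n f) \<longlonglongrightarrow> \<Psi> f"
  shows "daniell \<Psi>"
proof -
  have add: "\<Psi> (\<lambda>x. f x + g x) = \<Psi> f + \<Psi> g" if "f \<in> bounded_borel" "g \<in> bounded_borel" for f g
  proof (rule LIMSEQ_unique[OF lim])
    show "(\<lambda>n. \<Phi> n (\<lambda>x. f x + g x)) \<longlonglongrightarrow> \<Psi> f + \<Psi> g"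
      using tendsto_add[OF lim[OF that(1)] lim[OF that(2)]] daniellD(1)[OF D that] by simp
  qed (use that in auto)
  have mult: "\<Psi> (\<lambda>x. c * f x) = c * \<Psi> f" if "f \<in> bounded_borel" for f c
  proof (rule LIMSEQ_unique[OF lim])
    show "(\<lambda>n. \<Phi> n (\<lambda>x. c * f x)) \<longlonglongrightarrow> c * \<Psi> f"
      using tendsto_mult[OF tendsto_const lim[OF that]] daniellD(2)[OF D that] by simp
  qed (use that in auto)
  have pos: "0 \<le> \<Psi> f" if "f \<in> bounded_borel" "\<And>x. 0 \<le> f x" for f
    by (rule LIMSEQ_le_const[OF lim[OF that(1)]]) (use daniellD(3)[OF D that] in auto)
  have mono: "\<Psi> f \<le> \<Psi> g" if "f \<in> bounded_borel" "g \<in> bounded_borel" "\<And>x. f x \<le> g x" for f g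
    by (rule LIMSEQ_le[OF lim lim]) (use that daniell_mono[OF D that] in auto)
  have cont: "(\<lambda>n. \<Psi> (F n)) \<longlonglongrightarrow> 0"
    if F: "\<And>n::nat. F n \<in> bounded_borel" "\<And>x. decseq (\<lambda>n. F n x)" "\<And>x. (\<lambda>n. F n x) \<longlonglongrightarrow> 0" for F
  proof -
    have F0: "0 \<le> F n x" for n x by (rule decseq_ge[OF F(2,3)])
    have Fle: "F n x \<le> F m x" if "m \<le> n" for n m x using F(2)[of x] that by (auto simp: decseq_def)
    have "decseq (\<lambda>n. \<Psi> (F n))" by (auto simp: decseq_def intro!: mono F Fle)
    moreover have "0 \<le> \<Psi> (F n)" for n by (rule pos[OF F(1) F0])
    ultimately obtain \<delta> where \<delta>: "(\<lambda>n. \<Psi> (F n)) \<longlonglongrightarrow> \<delta>" "\<And>n. \<delta> \<le> \<Psi> (F n)"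
      using decseq_convergent[of "\<lambda>n. \<Psi> (F n)" 0] by metis
    have "\<delta> \<ge> 0" by (rule LIMSEQ_le_const[OF \<delta>(1)]) (auto intro: pos F F0)
    moreover have False if "\<delta> > 0"
    proof -
      \<comment> \<open>With \<open>\<delta> = 10 * \<epsilon>\<close>, the value of
        \<open>\<Phi> (n k)\<close> at the series \<open>B\<close> built below exceeds
        \<open>8 * \<epsilon>\<close> for even \<open>k\<close> and stays below
        \<open>4 * \<epsilon>\<close> for odd \<open>k\<close>.\<close>
      define \<epsilon> where "\<epsilon> = \<delta> / 10"
      have \<epsilon>: "\<epsilon> > 0" "\<delta> = 10 * \<epsilon>" using that by (auto simp: \<epsilon>_def)
      have "\<forall>\<^sub>F j in sequentially. \<Psi> (F j) < \<delta> + \<epsilon>" by (rule order_tendstoD(2)[OF \<delta>(1)]) (use \<epsilon> in auto)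
      then obtain j0 where j0: "\<Psi> (F j0) < \<delta> + \<epsilon>" by (auto simp: eventually_sequentially)
      define good where "good j n \<longleftrightarrow> \<bar>\<Phi> n (F j) - \<Psi> (F j)\<bar> < \<epsilon> \<and> \<bar>\<Phi> n (F j0) - \<Psi> (F j0)\<bar> < \<epsilon>" for j n
      have good: "\<exists>n>m. good j n" for j m
      proof -
        have "\<forall>\<^sub>F n in sequentially. \<bar>\<Phi> n (F i) - \<Psi> (F i)\<bar> < \<epsilon>" for i
          using lim[OF F(1)[of i]] \<epsilon>(1) unfolding tendsto_iff dist_real_def by auto
        then have "\<forall>\<^sub>F n in sequentially. good j n \<and> n > m"
          unfolding good_def by (intro eventually_conj eventually_gt_at_top) auto
        then show ?thesis by (auto dest: eventually_happens)
      qed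
      \<comment> \<open>Gliding hump. In a pair \<open>p k = (j, n)\<close> the index
        \<open>n\<close> comes after \<open>j\<close> and is so large that \<open>\<Phi> n\<close>
        is close to \<open>\<Psi>\<close> at \<open>F j\<close>; the next \<open>j\<close> comes
        after \<open>n\<close> and is so large that \<open>\<Phi> n\<close> is already small on it.
        Starting at \<open>j0\<close> makes the series telescope from \<open>F j0\<close>.\<close>
      have "\<exists>p. \<forall>k::nat. (good (fst (p k)) (snd (p k)) \<and> j0 \<le> fst (p k) \<and> (k = 0 \<longrightarrow> fst (p k) = j0)) \<and>
          (fst (p k) < fst (p (Suc k)) \<and> snd (p k) < snd (p (Suc k)) \<and> \<Phi> (snd (p k)) (F (fst (p (Suc k)))) < \<epsilon>)"
      proof (rule dependent_nat_choice)
        obtain n where "good j0 n" using good by blast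
        then show "\<exists>x. good (fst x) (snd x) \<and> j0 \<le> fst x \<and> (0 = (0::nat) \<longrightarrow> fst x = j0)"
          by (intro exI[of _ "(j0, n)"]) auto
      next
        fix x and k :: nat
        assume x: "good (fst x) (snd x) \<and> j0 \<le> fst x \<and> (k = 0 \<longrightarrow> fst x = j0)"
        have "(\<lambda>j. \<Phi> (snd x) (F j)) \<longlonglongrightarrow> 0" by (rule daniellD(4)[OF D F])
        then have "\<forall>\<^sub>F j in sequentially. \<Phi> (snd x) (F j) < \<epsilon> \<and> j > fst x"
          by (intro eventually_conj order_tendstoD(2) eventually_gt_at_top) (use \<epsilon> in auto)
        then obtain j where j: "\<Phi> (snd x) (F j) < \<epsilon>" "j > fst x" by (auto dest: eventually_happens)
        obtain n where "n > snd x" "good j n" using good by blast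
        then show "\<exists>y. (good (fst y) (snd y) \<and> j0 \<le> fst y \<and> (Suc k = 0 \<longrightarrow> fst y = j0)) \<and>
            (fst x < fst y \<and> snd x < snd y \<and> \<Phi> (snd x) (F (fst y)) < \<epsilon>)"
          using j x by (intro exI[of _ "(j, n)"]) auto
      qed
      then obtain p where p: "\<And>k::nat. good (fst (p k)) (snd (p k))" "\<And>k. j0 \<le> fst (p k)" "fst (p 0) = j0"
          "\<And>k. fst (p k) < fst (p (Suc k))" "\<And>k. snd (p k) < snd (p (Suc k))"
          "\<And>k. \<Phi> (snd (p k)) (F (fst (p (Suc k)))) < \<epsilon>" by metis
      define j n where "j k = fst (p k)" and "n k = snd (p k)" for k
      note p = p[folded j_def n_def]
      have n: "strict_mono n" using p(5) by (simp add: strict_mono_Suc_iff)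
      have Fj: "F (j (Suc k)) x \<le> F (j k) x" for k x using p(4)[of k] by (intro Fle) auto
      define G where "G i x = F (j (2*i)) x - F (j (2*i+1)) x" for i x
      define B where "B x = (\<Sum>i. G i x)" for x
      have G0: "0 \<le> G i x" for i x using Fj[of "2*i" x] by (simp add: G_def)
      have partial: "(\<Sum>i<m. G i x) \<le> F j0 x - F (j (2*m)) x" for m x
      proof (induction m)
        case 0 then show ?case using p(3) by simp
      next
        case (Suc m)
        then show ?case using Fj[of "2*m+1" x] by (simp add: G_def)
      qed
      \<comment> \<open>The series omits the decrement from \<open>j (2*l+1)\<close> to
        \<open>j (2*l+2)\<close>, so this amount can be subtracted from the bound in
        \<open>partial\<close>.\<close>
      have partial2: "(\<Sum>i<m. G i x) \<le> F j0 x - F (j (2*l+1)) x + F (j (2*l+2)) x - F (j (2*m)) x" if "m \<ge> Suc l" for l m :: nat and x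
        using that
      proof (induction m rule: nat_induct_at_least)
        case base then show ?case using partial[where m=l and x=x] by (simp add: G_def)
      next
        case (Suc m)
        then show ?case using Fj[of "2*m+1" x] by (simp add: G_def)
      qed
      have sm: "summable (\<lambda>i. G i x)" for x
        by (rule summableI_nonneg_bounded[of _ "F j0 x"]) (use G0 partial F0 in \<open>auto intro: order_trans[OF partial]\<close>)
      obtain C where C: "\<And>x. \<bar>F j0 x\<bar> \<le> C" using F(1) by (metis bounded_borelE)
      have G: "G i \<in> bounded_borel" for i using F(1) by (auto simp: G_def [abs_def])
      have B: "B \<in> bounded_borel"
      proof (rule bounded_borelI[of _ C])
        show "B \<in> borel_measurable borel" unfolding B_def using G by (auto intro!: borel_measurable_suminf)
        fix x
        have "0 \<le> B x" unfolding B_def by (rule suminf_nonneg[OF sm G0])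
        moreover have "B x \<le> F j0 x" unfolding B_def
          by (rule suminf_le_const[OF sm]) (use partial F0 in \<open>auto intro: order_trans[OF partial]\<close>)
        ultimately show "\<bar>B x\<bar> \<le> C" using C[of x] by auto
      qed
      have even: "\<Phi> (n (2*i)) B > 8 * \<epsilon>" for i
      proof -
        have "G i x \<le> B x" for x unfolding B_def using sum_le_suminf[OF sm, of "{i}" x] G0 by simp
        then have "\<Phi> (n (2*i)) (G i) \<le> \<Phi> (n (2*i)) B" by (intro daniell_mono[OF D G B])
        moreover have "\<Phi> (n (2*i)) (G i) = \<Phi> (n (2*i)) (F (j (2*i))) - \<Phi> (n (2*i)) (F (j (2*i+1)))"
          unfolding G_def by (rule daniell_diff[OF D F(1) F(1)])
        ultimately show ?thesis using p(1)[of "2*i"] p(6)[of "2*i"] \<delta>(2)[of "j (2*i)"] \<epsilon> unfolding good_def by auto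
      qed
      have odd: "\<Phi> (n (2*l+1)) B < 4 * \<epsilon>" for l
      proof -
        have "B x \<le> (F j0 x - F (j (2*l+1)) x) + F (j (2*l+2)) x" for x
          unfolding B_def
        proof (rule suminf_le_const[OF sm])
          fix m
          have "(\<Sum>i<m. G i x) \<le> (\<Sum>i<max m (Suc l). G i x)" by (rule sum_mono2) (use G0 in auto)
          also have "\<dots> \<le> F j0 x - F (j (2*l+1)) x + F (j (2*l+2)) x - F (j (2*max m (Suc l))) x"
            by (rule partial2) auto
          finally show "(\<Sum>i<m. G i x) \<le> (F j0 x - F (j (2*l+1)) x) + F (j (2*l+2)) x"
            using F0[of "j (2*max m (Suc l))" x] by linarith
        qed
        then have "\<Phi> (n (2*l+1)) B \<le> \<Phi> (n (2*l+1)) (\<lambda>x. (F j0 x - F (j (2*l+1)) x) + F (j (2*l+2)) x)"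
          by (intro daniell_mono[OF D B] bounded_borel_add bounded_borel_diff F)
        also have "\<dots> = \<Phi> (n (2*l+1)) (F j0) - \<Phi> (n (2*l+1)) (F (j (2*l+1))) + \<Phi> (n (2*l+1)) (F (j (2*l+2)))"
          by (subst daniellD(1)[OF D]) (auto intro!: daniell_diff[OF D] F)
        finally show ?thesis using p(1)[of "2*l+1"] p(6)[of "2*l+1"] \<delta>(2)[of "j (2*l+1)"] \<epsilon> j0 unfolding good_def by auto
      qed
      have sub: "(\<lambda>i. \<Phi> (n (2*i)) B) \<longlonglongrightarrow> \<Psi> B" "(\<lambda>i. \<Phi> (n (2*i+1)) B) \<longlonglongrightarrow> \<Psi> B"
      proof -
        have "strict_mono (\<lambda>i. n (2*i))" "strict_mono (\<lambda>i. n (2*i+1))"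
          using n by (auto simp: strict_mono_def)
        then show "(\<lambda>i. \<Phi> (n (2*i)) B) \<longlonglongrightarrow> \<Psi> B" "(\<lambda>i. \<Phi> (n (2*i+1)) B) \<longlonglongrightarrow> \<Psi> B"
          using LIMSEQ_subseq_LIMSEQ[OF lim[OF B]] by (auto simp: o_def)
      qed
      have "8 * \<epsilon> \<le> \<Psi> B" by (rule LIMSEQ_le_const[OF sub(1)]) (use even in \<open>auto intro: less_imp_le\<close>)
      moreover have "\<Psi> B \<le> 4 * \<epsilon>" by (rule LIMSEQ_le_const2[OF sub(2)]) (use odd in \<open>auto intro: less_imp_le\<close>)
      ultimately show False using \<epsilon> by auto
    qed
    ultimately have "\<delta> = 0" by fastforce
    then show ?thesis using \<delta>(1) by simp
  qed
  show ?thesis unfolding daniell_def using add mult pos cont by blast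
qed

text \<open>Positive weights make the null sets of \<open>N\<close> the common null sets of all
  \<open>M i\<close>. The partial sums are Daniell functionals, and \<open>daniell_limit\<close>
  shows that their limit is one.\<close>

lemma countable_mixture:
  fixes M :: "nat \<Rightarrow> 'a::topological_space measure"
  assumes M: "\<And>i. finite_borel (M i)"
  obtains N and c :: "nat \<Rightarrow> real" where "finite_borel N" "\<And>i. c i > 0"
    "\<And>f. f \<in> bounded_borel \<Longrightarrow> (\<lambda>i. c i * integral\<^sup>L (M i) f) sums integral\<^sup>L N f"
proof -
  \<comment> \<open>Normalizing by the mass makes the series converge geometrically; adding 1 covers
    the zero measure.\<close>
  define c :: "nat \<Rightarrow> real" where "c i = (1/2)^i / (1 + measure (M i) UNIV)" for i
  have c: "c i > 0" for i
  proof -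
    have "1 + measure (M i) UNIV > 0" using measure_nonneg[of "M i" UNIV] by linarith
    then show ?thesis by (simp add: c_def)
  qed
  note DM = daniell_integral[OF M]
  have "daniell (\<lambda>f. \<Sum>i<n. c i * integral\<^sup>L (M i) f)" for n
    unfolding daniell_def
  proof (intro conjI ballI allI impI)
    fix f assume "f \<in> bounded_borel" "\<forall>x::'a. 0 \<le> f x"
    then show "0 \<le> (\<Sum>i<n. c i * integral\<^sup>L (M i) f)"
      by (intro sum_nonneg mult_nonneg_nonneg less_imp_le[OF c] daniellD(3)[OF DM]) auto
  next
    fix F :: "nat \<Rightarrow> 'a \<Rightarrow> real"
    assume F: "\<forall>n. F n \<in> bounded_borel" "\<forall>x. decseq (\<lambda>n. F n x)" "\<forall>x. (\<lambda>n. F n x) \<longlonglongrightarrow> 0"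
    have "(\<lambda>k. \<Sum>i<n. c i * integral\<^sup>L (M i) (F k)) \<longlonglongrightarrow> (\<Sum>i<n. c i * 0)"
      by (intro tendsto_sum tendsto_mult tendsto_const daniellD(4)[OF DM]) (use F in auto)
    then show "(\<lambda>k. \<Sum>i<n. c i * integral\<^sup>L (M i) (F k)) \<longlonglongrightarrow> 0" by simp
  qed (simp_all add: integrable_bounded_borel[OF M] distrib_left sum.distrib sum_distrib_left mult_ac)
  moreover have sums: "(\<lambda>n. \<Sum>i<n. c i * integral\<^sup>L (M i) f) \<longlonglongrightarrow> (\<Sum>i. c i * integral\<^sup>L (M i) f)"
    if f: "f \<in> bounded_borel" for f
  proof -
    obtain C where C: "C > 0" "\<And>x. \<bar>f x\<bar> \<le> C" using f by (metis bounded_borelE)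
    have "summable (\<lambda>i. c i * integral\<^sup>L (M i) f)"
    proof (rule summable_comparison_test')
      show "summable (\<lambda>i. C * (1/2)^i)" by (intro summable_mult summable_geometric) auto
      fix i
      have "\<bar>integral\<^sup>L (M i) f\<bar> \<le> (\<integral>x. \<bar>f x\<bar> \<partial>M i)" by (rule integral_abs_bound)
      also have "\<dots> \<le> (\<integral>x. C \<partial>M i)"
        by (rule integral_mono) (use f C in \<open>auto intro!: integrable_bounded_borel[OF M]\<close>)
      also have "\<dots> = C * measure (M i) UNIV" using finite_borelD[OF M] by simp
      also have "\<dots> \<le> C * (1 + measure (M i) UNIV)" using C by simp
      finally have "c i * \<bar>integral\<^sup>L (M i) f\<bar> \<le> c i * (C * (1 + measure (M i) UNIV))"
        using c[of i] by (intro mult_left_mono) auto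
      also have "\<dots> = (c i * (1 + measure (M i) UNIV)) * C" by simp
      also have "c i * (1 + measure (M i) UNIV) = (1/2)^i"
      proof -
        have "1 + measure (M i) UNIV \<noteq> 0" using measure_nonneg[of "M i" UNIV] by linarith
        then show ?thesis by (simp add: c_def)
      qed
      also have "(1/2)^i * C = C * (1/2)^i" by simp
      finally show "norm (c i * integral\<^sup>L (M i) f) \<le> C * (1/2)^i" using c[of i] by (simp add: abs_mult)
    qed
    then show ?thesis by (rule summable_LIMSEQ)
  qed
  ultimately have "daniell (\<lambda>f. \<Sum>i. c i * integral\<^sup>L (M i) f)" by (rule daniell_limit)
  then obtain N where N: "finite_borel N"
    "\<And>f. f \<in> bounded_borel \<Longrightarrow> (\<Sum>i. c i * integral\<^sup>L (M i) f) = integral\<^sup>L N f"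
    by (elim daniell_representation) blast
  have "(\<lambda>i. c i * integral\<^sup>L (M i) f) sums integral\<^sup>L N f" if "f \<in> bounded_borel" for f
    using sums[OF that] N(2)[OF that] by (simp add: sums_def)
  with N(1) c show thesis by (intro that[of N c]) auto
qed

section \<open>Markov semigroups with a compactness property\<close>

locale measure_subring = finite_measure \<rho> for \<rho> :: "'a measure" +
  fixes \<Sigma> :: "'a set set"
  assumes subring_sets: "\<Sigma> \<subseteq> sets \<rho>"
    and subring_Diff: "A \<in> \<Sigma> \<Longrightarrow> B \<in> \<Sigma> \<Longrightarrow> A - B \<in> \<Sigma>"
    and subring_UN: "(\<And>n::nat. A' n \<in> \<Sigma>) \<Longrightarrow> (\<Union>n. A' n) \<in> \<Sigma>"
begin

lemma subring_measurable [measurable_dest, simp]: "A \<in> \<Sigma> \<Longrightarrow> A \<in> sets \<rho>"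
  using subring_sets by auto

lemma subring_Int: "A \<in> \<Sigma> \<Longrightarrow> B \<in> \<Sigma> \<Longrightarrow> A \<inter> B \<in> \<Sigma>"
  using subring_Diff[of A "A - B"] subring_Diff[of A B] by (simp add: Diff_Diff_Int)

lemma subring_Un: assumes "A \<in> \<Sigma>" "B \<in> \<Sigma>" shows "A \<union> B \<in> \<Sigma>"
proof -
  have "(\<Union>n::nat. if n = 0 then A else B) \<in> \<Sigma>" by (rule subring_UN) (use assms in auto)
  also have "(\<Union>n::nat. if n = 0 then A else B) = A \<union> B" by (auto split: if_splits)
  finally show ?thesis .
qed

definition atom :: "'a set \<Rightarrow> bool" where
  "atom E \<longleftrightarrow> E \<in> \<Sigma> \<and> measure \<rho> E > 0 \<and>
     (\<forall>F\<in>\<Sigma>. F \<subseteq> E \<longrightarrow> measure \<rho> F = 0 \<or> measure \<rho> F = measure \<rho> E)"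

text \<open>If no splitting exists, the subsets of measure less than a third form an ideal that is closed
  under countable unions, and the complement of a largest such set is an atom.\<close>

lemma split_atomless:
  assumes C: "C \<in> \<Sigma>" and noatom: "\<And>E. E \<subseteq> C \<Longrightarrow> \<not> atom E"
  shows "\<exists>D\<in>\<Sigma>. D \<subseteq> C \<and> measure \<rho> C / 3 \<le> measure \<rho> D \<and> measure \<rho> C / 3 \<le> measure \<rho> (C - D)"
proof (rule ccontr)
  define c where "c = measure \<rho> C"
  assume "\<not> ?thesis"
  then have neg: "measure \<rho> D < c / 3 \<or> measure \<rho> (C - D) < c / 3" if "D \<in> \<Sigma>" "D \<subseteq> C" for D
    using that unfolding c_def by force
  have diff: "measure \<rho> (X - Y) = measure \<rho> X - measure \<rho> Y" if "X \<in> \<Sigma>" "Y \<in> \<Sigma>" "Y \<subseteq> X" for X Y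
    using that by (simp add: finite_measure_Diff)
  \<comment> \<open>If \<open>c\<close> were 0, the empty set would be a splitting.\<close>
  have c0: "c > 0"
    using neg[of "{}"] subring_Diff[OF C C] measure_nonneg[of \<rho> C] by (auto simp: c_def)
  define small where "small D \<longleftrightarrow> D \<in> \<Sigma> \<and> D \<subseteq> C \<and> measure \<rho> D < c / 3" for D
  have smallD: "D \<in> \<Sigma>" "D \<subseteq> C" "measure \<rho> D < c / 3" if "small D" for D
    using that by (auto simp: small_def)
  \<comment> \<open>No subset has measure between one third and two thirds of \<open>c\<close>:
    below two thirds, the complement has more than one third, so the set itself must have less.
    Therefore the union of two small sets is small again.\<close>
  have smallI: "small D" if "D \<in> \<Sigma>" "D \<subseteq> C" "measure \<rho> D < 2 * c / 3" for D
    using that neg[of D] diff[OF C that(1,2)] c0 unfolding small_def c_def by auto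
  have small_Un: "small (D \<union> D')" if "small D" "small D'" for D D'
  proof (rule smallI)
    show "measure \<rho> (D \<union> D') < 2 * c / 3"
      using measure_Un_le[of D \<rho> D'] smallD[OF that(1)] smallD[OF that(2)] by auto
  qed (use smallD that subring_Un in auto)
  have small_empty: "small {}" using smallI[of "{}"] subring_Diff[OF C C] c0 by auto
  define S where "S = measure \<rho> ` {D. small D}"
  have S: "S \<noteq> {}" "bdd_above S" using small_empty by (auto simp: S_def intro!: bdd_aboveI[of _ "c / 3"] less_imp_le dest: smallD)
  have "\<exists>D. small D \<and> Sup S - 1 / real (Suc n) < measure \<rho> D" for n
  proof -
    have "Sup S - 1 / real (Suc n) < Sup S" by simp
    then show ?thesis using less_cSupD[OF S(1)] unfolding S_def by blast
  qed
  then obtain D where D: "\<And>n. small (D n)" "\<And>n. Sup S - 1 / real (Suc n) < measure \<rho> (D n)" by metis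
  define U where "U n = (\<Union>i\<le>n. D i)" for n
  have U: "small (U n)" for n
  proof (induction n)
    case (Suc n)
    have "U (Suc n) = U n \<union> D (Suc n)" by (auto simp: U_def le_Suc_eq)
    then show ?case using small_Un Suc D by simp
  qed (use D in \<open>simp add: U_def\<close>)
  define V where "V = (\<Union>n. D n)"
  have V: "V \<in> \<Sigma>" "V \<subseteq> C" unfolding V_def using smallD(1,2)[OF D(1)] by (blast intro: subring_UN)+
  have UV: "(\<Union>n. U n) = V" by (auto simp: U_def V_def)
  have "(\<lambda>n. measure \<rho> (U n)) \<longlonglongrightarrow> measure \<rho> (\<Union>n. U n)"
    by (rule finite_Lim_measure_incseq)
      (use smallD[OF U] in \<open>auto intro!: incseq_SucI simp: U_def atMost_Suc\<close>)
  then have "measure \<rho> V \<le> c / 3"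
    unfolding UV by (rule LIMSEQ_le_const2) (use smallD(3)[OF U] less_imp_le in blast)
  then have sV: "small V" using V c0 by (intro smallI) auto
  have maxV: "measure \<rho> X \<le> measure \<rho> V" if "small X" for X
  proof -
    have "Sup S \<le> measure \<rho> V"
    proof (rule field_le_epsilon)
      fix e :: real assume "e > 0"
      then obtain n where "1 / real (Suc n) < e" using nat_approx_posE by blast
      moreover have "measure \<rho> (D n) \<le> measure \<rho> V"
        by (rule finite_measure_mono) (use V in \<open>auto simp: V_def\<close>)
      ultimately show "Sup S \<le> measure \<rho> V + e" using D(2)[of n] by simp
    qed
    moreover have "measure \<rho> X \<le> Sup S" using that S by (intro cSup_upper) (auto simp: S_def)
    ultimately show ?thesis by simp
  qed
  have null: "measure \<rho> X = 0" if "small X" "X \<inter> V = {}" for X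
  proof -
    have "measure \<rho> (X \<union> V) = measure \<rho> X + measure \<rho> V"
      using that smallD V by (intro finite_measure_Union) auto
    then show ?thesis using maxV[OF small_Un[OF that(1) sV]] measure_nonneg[of \<rho> X] by simp
  qed
  have "atom (C - V)"
    unfolding atom_def
  proof (intro conjI ballI impI)
    show E: "C - V \<in> \<Sigma>" using C V subring_Diff by auto
    show "0 < measure \<rho> (C - V)" using diff[OF C V] smallD(3)[OF sV] c0 by (simp add: c_def)
    fix F assume F: "F \<in> \<Sigma>" "F \<subseteq> C - V"
    show "measure \<rho> F = 0 \<or> measure \<rho> F = measure \<rho> (C - V)"
    proof (cases "measure \<rho> F < c / 3")
      case True
      then have "small F" using F by (auto simp: small_def)
      then show ?thesis using null F by auto
    next
      case False
      then have "measure \<rho> (C - F) < c / 3" using neg[of F] F by auto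
      moreover have "measure \<rho> (C - V - F) \<le> measure \<rho> (C - F)"
        using C F subring_Diff by (intro finite_measure_mono) auto
      ultimately have "small (C - V - F)" using E F subring_Diff by (auto simp: small_def)
      then have "measure \<rho> (C - V - F) = 0" using null by auto
      then show ?thesis using diff[OF E F] by simp
    qed
  qed
  then show False using noatom by auto
qed

text \<open>Induction on the family: a new set \<open>A'\<close> cuts \<open>B\<close> into two
  atomless pieces, on which the induction hypothesis gives \<open>R1\<close> and \<open>R2\<close>.
  Inside \<open>B\<close>, the symmetric difference of \<open>R1 \<union> R2\<close> with
  \<open>A'\<close> is \<open>(B1 - R1) \<union> R2\<close>, which is why the statement also carries
  lower bounds for \<open>R\<close> and for \<open>B - R\<close>.\<close>

lemma far_from_finitely_many:
  assumes "finite \<F>" "\<F> \<subseteq> \<Sigma>" "B \<in> \<Sigma>" "\<And>E. E \<subseteq> B \<Longrightarrow> \<not> atom E"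
  shows "\<exists>R\<in>\<Sigma>. R \<subseteq> B \<and> measure \<rho> B / 3 \<le> measure \<rho> R \<and> measure \<rho> B / 3 \<le> measure \<rho> (B - R) \<and>
    (\<forall>A\<in>\<F>. measure \<rho> B / 3 \<le> measure \<rho> (B \<inter> ((R - A) \<union> (A - R))))"
  using assms
proof (induction \<F> arbitrary: B rule: finite_induct)
  case empty
  then show ?case using split_atomless[of B] by auto
next
  case (insert A' \<F>)
  have A': "A' \<in> \<Sigma>" and \<F>: "\<F> \<subseteq> \<Sigma>" using insert.prems by auto
  define B1 B2 where "B1 = B \<inter> A'" and "B2 = B - A'"
  have B: "B1 \<in> \<Sigma>" "B2 \<in> \<Sigma>" unfolding B1_def B2_def using A' insert.prems subring_Int subring_Diff by auto
  have na: "\<And>E. E \<subseteq> B1 \<Longrightarrow> \<not> atom E" "\<And>E. E \<subseteq> B2 \<Longrightarrow> \<not> atom E"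
    using insert.prems(3) unfolding B1_def B2_def by blast+
  obtain R1 where R1: "R1 \<in> \<Sigma>" "R1 \<subseteq> B1" "measure \<rho> B1 / 3 \<le> measure \<rho> R1" "measure \<rho> B1 / 3 \<le> measure \<rho> (B1 - R1)"
    "\<And>A. A \<in> \<F> \<Longrightarrow> measure \<rho> B1 / 3 \<le> measure \<rho> (B1 \<inter> ((R1 - A) \<union> (A - R1)))"
    using insert.IH[OF \<F> B(1) na(1)] by blast
  obtain R2 where R2: "R2 \<in> \<Sigma>" "R2 \<subseteq> B2" "measure \<rho> B2 / 3 \<le> measure \<rho> R2" "measure \<rho> B2 / 3 \<le> measure \<rho> (B2 - R2)"
    "\<And>A. A \<in> \<F> \<Longrightarrow> measure \<rho> B2 / 3 \<le> measure \<rho> (B2 \<inter> ((R2 - A) \<union> (A - R2)))"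
    using insert.IH[OF \<F> B(2) na(2)] by blast
  have un: "measure \<rho> (X \<union> Y) = measure \<rho> X + measure \<rho> Y" if "X \<in> \<Sigma>" "Y \<in> \<Sigma>" "X \<subseteq> B1" "Y \<subseteq> B2" for X Y
    using that by (intro finite_measure_Union) (auto simp: B1_def B2_def)
  note [simp] = subring_Un subring_Diff subring_Int
  have mB: "measure \<rho> B = measure \<rho> B1 + measure \<rho> B2"
    using un[OF B] by (simp add: B1_def B2_def Int_Diff_Un)
  show ?case
  proof (intro bexI[of _ "R1 \<union> R2"] conjI ballI)
    show "R1 \<union> R2 \<in> \<Sigma>" "R1 \<union> R2 \<subseteq> B" using R1(1,2) R2(1,2) by (auto simp: B1_def B2_def)
    show "measure \<rho> B / 3 \<le> measure \<rho> (R1 \<union> R2)" using un[OF R1(1) R2(1) R1(2) R2(2)] R1(3) R2(3) mB by simp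
    have "B - (R1 \<union> R2) = (B1 - R1) \<union> (B2 - R2)" using R1(2) R2(2) by (auto simp: B1_def B2_def)
    then show "measure \<rho> B / 3 \<le> measure \<rho> (B - (R1 \<union> R2))"
      using un[of "B1 - R1" "B2 - R2"] R1 R2 B mB by auto
    fix A assume A: "A \<in> insert A' \<F>"
    show "measure \<rho> B / 3 \<le> measure \<rho> (B \<inter> ((R1 \<union> R2 - A) \<union> (A - (R1 \<union> R2))))"
    proof (cases "A \<in> \<F>")
      case True
      then have "A \<in> \<Sigma>" using \<F> by auto
      have "B \<inter> ((R1 \<union> R2 - A) \<union> (A - (R1 \<union> R2))) = (B1 \<inter> ((R1 - A) \<union> (A - R1))) \<union> (B2 \<inter> ((R2 - A) \<union> (A - R2)))"
        using R1(2) R2(2) by (auto simp: B1_def B2_def)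
      then show ?thesis
        using un[of "B1 \<inter> ((R1 - A) \<union> (A - R1))" "B2 \<inter> ((R2 - A) \<union> (A - R2))"] R1(1) R2(1) B \<open>A \<in> \<Sigma>\<close>
          R1(5)[OF True] R2(5)[OF True] mB by simp
    next
      case False
      then have "A = A'" using A by auto
      then have "B \<inter> ((R1 \<union> R2 - A) \<union> (A - (R1 \<union> R2))) = (B1 - R1) \<union> R2"
        using R1(2) R2(2) by (auto simp: B1_def B2_def)
      then show ?thesis using un[of "B1 - R1" R2] R1 R2 B mB by auto
    qed
  qed
qed

text \<open>Each new set is chosen far from all the previous ones. The indicators then have no
  L1-Cauchy subsequence if \<open>B\<close> has positive measure, which is what compactness will
  exclude.\<close>

lemma separated_sequence_if_atomless:
  assumes "B \<in> \<Sigma>" "\<And>E. E \<subseteq> B \<Longrightarrow> \<not> atom E"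
  obtains R :: "nat \<Rightarrow> 'a set" where "\<And>n. R n \<in> \<Sigma>"
    "\<And>m n. m < n \<Longrightarrow> measure \<rho> B / 3 \<le> measure \<rho> ((R n - R m) \<union> (R m - R n))"
proof -
  have "\<exists>R. finite \<F> \<and> \<F> \<subseteq> \<Sigma> \<longrightarrow> R \<in> \<Sigma> \<and> (\<forall>A\<in>\<F>. measure \<rho> B / 3 \<le> measure \<rho> ((R - A) \<union> (A - R)))" for \<F>
  proof (cases "finite \<F> \<and> \<F> \<subseteq> \<Sigma>")
    case True
    then obtain R where R: "R \<in> \<Sigma>" "\<And>A. A \<in> \<F> \<Longrightarrow> measure \<rho> B / 3 \<le> measure \<rho> (B \<inter> ((R - A) \<union> (A - R)))"
      using far_from_finitely_many[OF _ _ assms] by metis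
    have "measure \<rho> (B \<inter> ((R - A) \<union> (A - R))) \<le> measure \<rho> ((R - A) \<union> (A - R))" if "A \<in> \<F>" for A
      using R(1) that True by (intro finite_measure_mono) auto
    then show ?thesis using R by (intro exI[of _ R]) (meson order_trans)
  qed auto
  then obtain next_set where nx: "\<And>\<F>. finite \<F> \<Longrightarrow> \<F> \<subseteq> \<Sigma> \<Longrightarrow> next_set \<F> \<in> \<Sigma>"
    "\<And>\<F> A. finite \<F> \<Longrightarrow> \<F> \<subseteq> \<Sigma> \<Longrightarrow> A \<in> \<F> \<Longrightarrow> measure \<rho> B / 3 \<le> measure \<rho> ((next_set \<F> - A) \<union> (A - next_set \<F>))"
    by metis
  define S where "S = rec_nat {} (\<lambda>_ \<F>. insert (next_set \<F>) \<F>)"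
  have S_simps: "S 0 = {}" "\<And>n. S (Suc n) = insert (next_set (S n)) (S n)" by (simp_all add: S_def)
  have S: "finite (S n) \<and> S n \<subseteq> \<Sigma>" for n by (induction n) (auto simp: S_simps nx)
  have "S m \<subseteq> S n" if "m \<le> n" for m n by (rule lift_Suc_mono_le[OF _ that]) (auto simp: S_simps)
  then have mem: "next_set (S m) \<in> S n" if "m < n" for m n
    using that S_simps(2)[of m] by (metis Suc_leI insertI1 subsetD)
  show thesis
    by (rule that[of "\<lambda>n. next_set (S n)"]) (use nx S mem in auto)
qed

end

section \<open>Semigroups of positive kernels and their invariant measures\<close>

locale kernel_semigroup =
  fixes K :: "real \<Rightarrow> 'a::topological_space \<Rightarrow> 'a measure" and M :: real
  assumes finite_K: "t > 0 \<Longrightarrow> finite_borel (K t x)"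
    and measurable_K: "t > 0 \<Longrightarrow> f \<in> bounded_borel \<Longrightarrow> (\<lambda>x. integral\<^sup>L (K t x) f) \<in> borel_measurable borel"
    and bound_K: "t > 0 \<Longrightarrow> measure (K t x) UNIV \<le> M"
    and semigroup_K: "s > 0 \<Longrightarrow> t > 0 \<Longrightarrow> f \<in> bounded_borel \<Longrightarrow>
      (\<integral>y. integral\<^sup>L (K s y) f \<partial>K t x) = integral\<^sup>L (K (t + s) x) f"
begin

definition P :: "real \<Rightarrow> ('a \<Rightarrow> real) \<Rightarrow> ('a \<Rightarrow> real)" where
  "P t f = (\<lambda>x. integral\<^sup>L (K t x) f)"

lemma daniell_P: "t > 0 \<Longrightarrow> daniell (\<lambda>f. P t f x)"
  unfolding P_def by (rule daniell_integral[OF finite_K])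

lemma M_nonneg: "0 \<le> M"
  using bound_K[of 1 undefined] measure_nonneg order_trans by (metis zero_less_one)

lemma P_add: "t > 0 \<Longrightarrow> f \<in> bounded_borel \<Longrightarrow> g \<in> bounded_borel \<Longrightarrow> P t (\<lambda>x. f x + g x) y = P t f y + P t g y"
  and P_diff: "t > 0 \<Longrightarrow> f \<in> bounded_borel \<Longrightarrow> g \<in> bounded_borel \<Longrightarrow> P t (\<lambda>x. f x - g x) y = P t f y - P t g y"
  and P_cmult: "t > 0 \<Longrightarrow> f \<in> bounded_borel \<Longrightarrow> P t (\<lambda>x. c * f x) y = c * P t f y"
  and P_mono: "t > 0 \<Longrightarrow> f \<in> bounded_borel \<Longrightarrow> g \<in> bounded_borel \<Longrightarrow> (\<And>x. f x \<le> g x) \<Longrightarrow> P t f y \<le> P t g y"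
  and P_nonneg: "t > 0 \<Longrightarrow> f \<in> bounded_borel \<Longrightarrow> (\<And>x. 0 \<le> f x) \<Longrightarrow> 0 \<le> P t f y"
  using daniellD(1-3)[OF daniell_P[of t y]] daniell_diff[OF daniell_P[of t y]] daniell_mono[OF daniell_P[of t y]]
  by auto

lemma P_semigroup: "s > 0 \<Longrightarrow> t > 0 \<Longrightarrow> f \<in> bounded_borel \<Longrightarrow> P t (P s f) = P (t + s) f"
  unfolding P_def using semigroup_K by auto

lemma P_abs: "\<bar>P t f x\<bar> \<le> P t (\<lambda>x. \<bar>f x\<bar>) x"
  unfolding P_def by (rule integral_abs_bound)

lemma P_const: "t > 0 \<Longrightarrow> P t (\<lambda>_. c) x = measure (K t x) UNIV * c"
  unfolding P_def using finite_borelD[OF finite_K] by simp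

lemma P_indicator: "t > 0 \<Longrightarrow> A \<in> sets borel \<Longrightarrow> P t (indicator A) x = measure (K t x) A"
  unfolding P_def using finite_borelD[OF finite_K] by simp

lemma P_bound:
  assumes "t > 0" "f \<in> bounded_borel" "\<And>x. \<bar>f x\<bar> \<le> C"
  shows "\<bar>P t f x\<bar> \<le> M * C"
proof -
  have "\<bar>P t f x\<bar> \<le> P t (\<lambda>x. \<bar>f x\<bar>) x" by (rule P_abs)
  also have "\<dots> \<le> P t (\<lambda>_. C) x" using assms by (intro P_mono) auto
  also have "\<dots> = measure (K t x) UNIV * C" using P_const[OF assms(1)] .
  also have "\<dots> \<le> M * C" using bound_K[OF assms(1), of x] assms(3)[of x] by (intro mult_right_mono) auto
  finally show ?thesis .
qed

lemma P_bounded_borel [intro]: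
  assumes "t > 0" "f \<in> bounded_borel" shows "P t f \<in> bounded_borel"
proof -
  obtain C where "\<And>x. \<bar>f x\<bar> \<le> C" using assms by (metis bounded_borelE)
  then show ?thesis
    using assms P_bound measurable_K by (intro bounded_borelI[of _ "M * C"]) (auto simp: P_def)
qed

lemma P_DCT:
  assumes "t > 0" "\<And>n. F n \<in> bounded_borel" "\<And>n x. \<bar>F n x\<bar> \<le> C" "\<And>x. (\<lambda>n. F n x) \<longlonglongrightarrow> f x"
  shows "(\<lambda>n. P t (F n) x) \<longlonglongrightarrow> P t f x"
  unfolding P_def
  by (rule bounded_borel_DCT[OF finite_K, where C=C])
    (use assms bounded_borel_LIMSEQ(1)[OF assms(2-4)] in auto)

definition invariant :: "'a measure \<Rightarrow> bool" where
  "invariant \<omega> \<longleftrightarrow> finite_borel \<omega> \<and> (\<forall>t>0. \<forall>f\<in>bounded_borel. integral\<^sup>L \<omega> (P t f) = integral\<^sup>L \<omega> f)"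

lemma invariantD:
  assumes "invariant \<omega>"
  shows "finite_borel \<omega>" "t > 0 \<Longrightarrow> f \<in> bounded_borel \<Longrightarrow> integral\<^sup>L \<omega> (P t f) = integral\<^sup>L \<omega> f"
  using assms by (auto simp: invariant_def)

text \<open>This replaces contractivity in the supremum norm, for which only the bound
  \<open>M\<close> is available.\<close>

lemma L1_contraction:
  assumes "invariant \<omega>" "t > 0" "f \<in> bounded_borel"
  shows "(\<integral>x. \<bar>P t f x\<bar> \<partial>\<omega>) \<le> (\<integral>x. \<bar>f x\<bar> \<partial>\<omega>)"
proof -
  have "(\<integral>x. \<bar>P t f x\<bar> \<partial>\<omega>) \<le> (\<integral>x. P t (\<lambda>x. \<bar>f x\<bar>) x \<partial>\<omega>)"
    using assms by (intro integral_mono integrable_bounded_borel[OF invariantD(1)] P_abs) auto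
  also have "\<dots> = (\<integral>x. \<bar>f x\<bar> \<partial>\<omega>)" using assms by (intro invariantD(2)) auto
  finally show ?thesis .
qed

lemma L1_contraction_diff:
  assumes "invariant \<omega>" "t > 0" "f \<in> bounded_borel" "g \<in> bounded_borel"
  shows "(\<integral>x. \<bar>P t f x - P t g x\<bar> \<partial>\<omega>) \<le> (\<integral>x. \<bar>f x - g x\<bar> \<partial>\<omega>)"
  using L1_contraction[OF assms(1,2) bounded_borel_diff[OF assms(3,4)]] P_diff[OF assms(2-4)] by simp

text \<open>By the contraction estimate, \<open>P t\<close> acts on classes of functions modulo null
  sets of an invariant measure.\<close>

lemma AE_P_cong:
  assumes "invariant \<omega>" "t > 0" "f \<in> bounded_borel" "g \<in> bounded_borel" "AE x in \<omega>. f x = g x"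
  shows "AE x in \<omega>. P t f x = P t g x"
proof -
  have "(\<integral>x. \<bar>f x - g x\<bar> \<partial>\<omega>) = (\<integral>x. 0 \<partial>\<omega>)"
    using assms by (intro integral_cong_AE) (auto simp: finite_borelD[OF invariantD(1)])
  then have "(\<integral>x. \<bar>P t f x - P t g x\<bar> \<partial>\<omega>) \<le> 0" using L1_contraction_diff[OF assms(1-4)] by simp
  then have "(\<integral>x. \<bar>P t f x - P t g x\<bar> \<partial>\<omega>) = 0" by (intro antisym) auto
  then show ?thesis
    using assms by (subst (asm) integral_nonneg_eq_0_iff_AE) (auto intro!: integrable_bounded_borel[OF invariantD(1)] bounded_borel_abs bounded_borel_diff)
qed

end


section \<open>L1 convergence in the Markovian case\<close>

locale compact_markov_semigroup = kernel_semigroup K 1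
  for K :: "real \<Rightarrow> 'a::topological_space \<Rightarrow> 'a measure" +
  fixes \<rho> :: "'a measure" and t0 :: real
  assumes markov: "t > 0 \<Longrightarrow> measure (K t x) UNIV = 1"
    and invariant_\<rho>: "invariant \<rho>"
    and t0_pos: "t0 > 0"
    and compactness: "(\<And>n::nat. F n \<in> bounded_borel) \<Longrightarrow> (\<And>n x. \<bar>F n x\<bar> \<le> C) \<Longrightarrow>
      \<exists>r g. strict_mono r \<and> g \<in> bounded_borel \<and> (AE x in \<rho>. (\<lambda>n. P t0 (F (r n)) x) \<longlonglongrightarrow> g x)"
begin

lemma finite_borel_\<rho>: "finite_borel \<rho>"
  using invariant_\<rho> by (rule invariantD)

sublocale \<rho>: finite_measure \<rho>
  using finite_borelD(1)[OF finite_borel_\<rho>] .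

lemma sets_\<rho> [simp, measurable_cong]: "sets \<rho> = sets borel"
  and space_\<rho> [simp]: "space \<rho> = UNIV"
  using finite_borelD[OF finite_borel_\<rho>] by auto

lemma finite_measure_K: "t > 0 \<Longrightarrow> finite_measure (K t x)"
  by (rule finite_borelD(1)[OF finite_K])

lemma sets_K: "t > 0 \<Longrightarrow> sets (K t x) = sets borel" "t > 0 \<Longrightarrow> space (K t x) = UNIV"
  using finite_borelD[OF finite_K[of t x]] by auto

lemma measurable_\<rho> [simp]: "measurable \<rho> N = measurable borel N"
  by (rule finite_borelD(4)[OF finite_borel_\<rho>])

lemma integrable_\<rho>: "f \<in> bounded_borel \<Longrightarrow> integrable \<rho> f"
  by (rule integrable_bounded_borel[OF finite_borel_\<rho>])

lemma int_P: "t > 0 \<Longrightarrow> f \<in> bounded_borel \<Longrightarrow> integral\<^sup>L \<rho> (P t f) = integral\<^sup>L \<rho> f"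
  by (rule invariantD(2)[OF invariant_\<rho>])

lemma AE_not_in_null: "A \<in> sets borel \<Longrightarrow> measure \<rho> A = 0 \<Longrightarrow> AE x in \<rho>. x \<notin> A"
  by (rule AE_not_in) (simp add: null_sets_def \<rho>.emeasure_eq_measure)

text \<open>The points that are moved into \<open>A\<close> almost surely within time
  \<open>t\<close>; on sets in \<open>det\<close> this plays the role of the preimage under a
  deterministic motion.\<close>

definition img :: "real \<Rightarrow> 'a set \<Rightarrow> 'a set" where
  "img t A = {x. measure (K t x) A = 1}"

text \<open>The sets on which the kernels act like point maps: \<open>P t\<close> sends the
  indicator to an indicator, up to null sets, at every time.\<close>

definition det :: "'a set set" where
  "det = {A \<in> sets borel. \<forall>t>0. AE x in \<rho>. measure (K t x) A = 0 \<or> measure (K t x) A = 1}"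

lemma det_borel [measurable_dest]: "A \<in> det \<Longrightarrow> A \<in> sets borel"
  and det_AE: "A \<in> det \<Longrightarrow> t > 0 \<Longrightarrow> AE x in \<rho>. measure (K t x) A = 0 \<or> measure (K t x) A = 1"
  by (auto simp: det_def)

lemma measurable_measure_K [measurable]: "t > 0 \<Longrightarrow> A \<in> sets borel \<Longrightarrow> (\<lambda>x. measure (K t x) A) \<in> borel_measurable borel"
  using measurable_K[of t "indicator A"] sets_K by simp

lemma img_borel: "t > 0 \<Longrightarrow> A \<in> sets borel \<Longrightarrow> img t A \<in> sets borel"
  using measurable_sets_borel[OF measurable_measure_K[of t A], of "{1}"] by (simp add: img_def vimage_def)

sublocale det: measure_subring \<rho> det
proof
  show "det \<subseteq> sets \<rho>" by (auto simp: det_def)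
  show "A - B \<in> det" if A: "A \<in> det" and B: "B \<in> det" for A B
    unfolding det_def
  proof (intro CollectI conjI allI impI)
    show "A - B \<in> sets borel" using A B by auto
    fix t :: real assume t: "t > 0"
    show "AE x in \<rho>. measure (K t x) (A - B) = 0 \<or> measure (K t x) (A - B) = 1"
      using det_AE[OF A t] det_AE[OF B t]
    proof eventually_elim
      case (elim x)
      interpret finite_measure "K t x" by (rule finite_measure_K[OF t])
      have m: "A \<in> sets (K t x)" "B \<in> sets (K t x)" using A B sets_K[OF t] by auto
      have e: "measure (K t x) (A - B) = measure (K t x) A - measure (K t x) (A \<inter> B)"
        using m by (rule finite_measure_Diff')
      have le: "measure (K t x) (A \<inter> B) \<le> measure (K t x) B" "measure (K t x) (A - B) \<le> measure (K t x) A"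
        using m by (auto intro!: finite_measure_mono)
      have "measure (K t x) (A - B) \<le> measure (K t x) (UNIV - B)" using m sets_K[OF t] by (intro finite_measure_mono) auto
      also have "\<dots> = 1 - measure (K t x) B" using finite_measure_compl[OF m(2)] sets_K[OF t] markov[OF t] by simp
      finally show ?case
        using e le elim by (elim disjE) (smt (verit) measure_nonneg)+
    qed
  qed
  show "(\<Union>n. A n) \<in> det" if A: "\<And>n::nat. A n \<in> det" for A
    unfolding det_def
  proof (intro CollectI conjI allI impI)
    show "(\<Union>n. A n) \<in> sets borel" using A by auto
    fix t :: real assume t: "t > 0"
    have "AE x in \<rho>. \<forall>n. measure (K t x) (A n) = 0 \<or> measure (K t x) (A n) = 1"
      using det_AE[OF A t] by (simp add: AE_all_countable)
    then show "AE x in \<rho>. measure (K t x) (\<Union>n. A n) = 0 \<or> measure (K t x) (\<Union>n. A n) = 1"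
    proof eventually_elim
      case (elim x)
      interpret finite_measure "K t x" by (rule finite_measure_K[OF t])
      have m: "A n \<in> sets (K t x)" for n using A sets_K[OF t] by auto
      show ?case
      proof (cases "\<exists>n. measure (K t x) (A n) = 1")
        case True
        then obtain n where "measure (K t x) (A n) = 1" ..
        moreover have "measure (K t x) (A n) \<le> measure (K t x) (\<Union>n. A n)"
          using m by (intro finite_measure_mono) auto
        ultimately show ?thesis using bounded_measure[of "\<Union>n. A n"] markov[OF t, of x] sets_K(2)[OF t] by simp
      next
        case False
        then have "emeasure (K t x) (A n) = 0" for n using elim by (auto simp: emeasure_eq_measure)
        then have "emeasure (K t x) (\<Union>n. A n) = 0" using m by (intro emeasure_UN_eq_0) auto
        then show ?thesis by (simp add: measure_def)
      qed
    qed
  qed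
qed


lemma P_ind_img:
  assumes "A \<in> det" "t > 0" shows "AE x in \<rho>. P t (indicator A) x = indicator (img t A) x"
  using det_AE[OF assms] by eventually_elim (use P_indicator[of t A] assms in \<open>auto simp: img_def indicator_def\<close>)

text \<open>Almost everywhere, \<open>P t\<close> of the indicator of \<open>img s A\<close> is
  \<open>P t (P s (indicator A)) = P (t + s) (indicator A)\<close>, and the latter takes only the
  values 0 and 1 because \<open>A \<in> det\<close>.\<close>

lemma img_img:
  assumes A: "A \<in> det" and s: "s > 0" and t: "t > 0"
  shows "AE x in \<rho>. indicator (img t (img s A)) x = (indicator (img (t + s) A) x :: real)"
    and img_det: "img s A \<in> det"
proof -
  have B: "img s A \<in> sets borel" using img_borel[OF s] A by auto
  have eq: "AE x in \<rho>. P t (indicator (img s A)) x = P (t + s) (indicator A) x" if "t > 0" for t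
  proof -
    have "AE x in \<rho>. P t (P s (indicator A)) x = P t (indicator (img s A)) x"
      by (rule AE_P_cong[OF invariant_\<rho> that _ _ P_ind_img[OF A s]]) (use A s B in auto)
    moreover have "P t (P s (indicator A)) = P (t + s) (indicator A)"
      by (rule P_semigroup[OF s that]) (use A in auto)
    ultimately show ?thesis by auto
  qed
  show det: "img s A \<in> det"
    unfolding det_def
  proof (intro CollectI conjI allI impI B)
    fix t :: real assume t: "t > 0"
    show "AE x in \<rho>. measure (K t x) (img s A) = 0 \<or> measure (K t x) (img s A) = 1"
      using eq[OF t] det_AE[OF A, of "t + s"] s t A B
      by (auto simp: P_indicator elim!: eventually_elim2)
  qed
  show "AE x in \<rho>. indicator (img t (img s A)) x = (indicator (img (t + s) A) x :: real)"
    using eq[OF t] P_ind_img[OF A, of "t + s"] P_ind_img[OF det t] s t by auto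
qed

lemma measure_img:
  assumes "A \<in> det" "t > 0" shows "measure \<rho> (img t A) = measure \<rho> A"
proof -
  have A: "A \<in> sets borel" "img t A \<in> sets borel" using assms img_borel by auto
  have "measure \<rho> (img t A) = (\<integral>x. indicator (img t A) x \<partial>\<rho>)" using A by simp
  also have "\<dots> = integral\<^sup>L \<rho> (P t (indicator A))"
    using P_ind_img[OF assms] A assms bounded_borel_measurable[OF P_bounded_borel[of t "indicator A"]]
    by (intro integral_cong_AE) auto
  also have "\<dots> = measure \<rho> A" using int_P[of t "indicator A"] assms A by simp
  finally show ?thesis .
qed

lemma img_mono: assumes "A \<subseteq> B" "A \<in> sets borel" "B \<in> sets borel" "t > 0" shows "img t A \<subseteq> img t B"
proof
  fix x assume "x \<in> img t A"
  interpret finite_measure "K t x" by (rule finite_measure_K[OF assms(4)])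
  have "measure (K t x) A \<le> measure (K t x) B" using assms sets_K by (intro finite_measure_mono) auto
  then show "x \<in> img t B"
    using \<open>x \<in> img t A\<close> bounded_measure[of B] markov[OF assms(4), of x] sets_K(2)[OF assms(4)] by (simp add: img_def)
qed

lemma img_Int:
  assumes "A \<in> sets borel" "B \<in> sets borel" "t > 0" shows "img t (A \<inter> B) = img t A \<inter> img t B"
proof
  show "img t (A \<inter> B) \<subseteq> img t A \<inter> img t B"
    using img_mono[of "A \<inter> B" A t] img_mono[of "A \<inter> B" B t] assms by auto
  show "img t A \<inter> img t B \<subseteq> img t (A \<inter> B)"
  proof
    fix x assume x: "x \<in> img t A \<inter> img t B"
    interpret finite_measure "K t x" by (rule finite_measure_K[OF assms(3)])
    have m: "A \<in> sets (K t x)" "B \<in> sets (K t x)" using assms sets_K by auto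
    have "measure (K t x) (A - B) \<le> measure (K t x) (UNIV - B)" using m assms sets_K by (intro finite_measure_mono) auto
    also have "\<dots> = 1 - measure (K t x) B" using finite_measure_compl[OF m(2)] sets_K[OF assms(3)] markov[OF assms(3)] by simp
    finally have "measure (K t x) (A - B) \<le> 0" using x by (simp add: img_def)
    then have "measure (K t x) (A - B) = 0" using measure_nonneg order_antisym by blast
    then show "x \<in> img t (A \<inter> B)" using finite_measure_Diff'[OF m] x by (simp add: img_def)
  qed
qed

text \<open>\<open>P t\<close> is isometric in L1 on differences of indicators of sets in
  \<open>det\<close>: where the kernel gives both sets mass 0 or 1, the mass of the symmetric
  difference is the difference of the masses. This carries separated sequences over to the range of
  \<open>P t0\<close>.\<close>

lemma measure_symdiff_P:
  assumes A: "A \<in> det" and B: "B \<in> det" and t: "t > 0"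
  shows "measure \<rho> ((A - B) \<union> (B - A)) = (\<integral>x. \<bar>P t (indicator A) x - P t (indicator B) x\<bar> \<partial>\<rho>)"
proof -
  let ?D = "(A - B) \<union> (B - A)"
  have m: "A \<in> sets borel" "B \<in> sets borel" "?D \<in> sets borel" using A B by auto
  have D: "A - B \<in> det" "B - A \<in> det" using A B det.subring_Diff by auto
  have "measure \<rho> ?D = integral\<^sup>L \<rho> (P t (indicator ?D))"
    using int_P[OF t, of "indicator ?D"] m by simp
  also have "\<dots> = (\<integral>x. \<bar>P t (indicator A) x - P t (indicator B) x\<bar> \<partial>\<rho>)"
  proof (rule integral_cong_AE)
    show "AE x in \<rho>. P t (indicator ?D) x = \<bar>P t (indicator A) x - P t (indicator B) x\<bar>"
      using det_AE[OF A t] det_AE[OF B t]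
    proof eventually_elim
      case (elim x)
      interpret finite_measure "K t x" by (rule finite_measure_K[OF t])
      have k: "A \<in> sets (K t x)" "B \<in> sets (K t x)" using m sets_K[OF t] by auto
      have "measure (K t x) ?D = measure (K t x) (A - B) + measure (K t x) (B - A)"
        using k by (intro finite_measure_Union) auto
      moreover have "measure (K t x) (A - B) = measure (K t x) A - measure (K t x) (A \<inter> B)"
        "measure (K t x) (B - A) = measure (K t x) B - measure (K t x) (A \<inter> B)"
        using finite_measure_Diff'[OF k] finite_measure_Diff'[OF k(2,1)] by (auto simp: Int_commute)
      moreover have "measure (K t x) (A \<inter> B) = min (measure (K t x) A) (measure (K t x) B)"
      proof (cases "measure (K t x) A = 1 \<and> measure (K t x) B = 1")
        case True
        then have "x \<in> img t (A \<inter> B)" using img_Int[OF m(1,2) t] by (simp add: img_def)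
        then show ?thesis using True by (simp add: img_def)
      next
        case False
        moreover have "measure (K t x) (A \<inter> B) \<le> measure (K t x) A" "measure (K t x) (A \<inter> B) \<le> measure (K t x) B"
          using k by (auto intro!: finite_measure_mono)
        ultimately show ?thesis using elim measure_nonneg[of "K t x" "A \<inter> B"] by (auto simp del: measure_nonneg)
      qed
      ultimately have "measure (K t x) ?D = \<bar>measure (K t x) A - measure (K t x) B\<bar>" by (auto simp: min_def)
      then show ?case using P_indicator t m by simp
    qed
  qed (use m t in \<open>auto intro!: bounded_borel_measurable P_bounded_borel bounded_borel_abs bounded_borel_diff\<close>)
  finally show ?thesis .
qed

text \<open>Without atoms in \<open>B\<close> there is a separated sequence in \<open>det\<close>.
  Its image under \<open>P t0\<close> is equally separated, but has a subsequence converging almost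
  everywhere, hence in L1; two late terms lie within a sixth of the limit and so closer than a third
  to each other.\<close>

lemma atom_exists:
  assumes B: "B \<in> det" "measure \<rho> B > 0"
  obtains E where "E \<subseteq> B" "det.atom E"
proof (rule ccontr)
  assume "\<not> thesis"
  then have "\<And>E. E \<subseteq> B \<Longrightarrow> \<not> det.atom E" using that by blast
  then obtain R :: "nat \<Rightarrow> 'a set" where R: "\<And>n. R n \<in> det"
    "\<And>m n. m < n \<Longrightarrow> measure \<rho> B / 3 \<le> measure \<rho> ((R n - R m) \<union> (R m - R n))"
    using det.separated_sequence_if_atomless[OF B(1)] by blast
  have Rb: "R n \<in> sets borel" for n using R(1) by auto
  have "\<exists>r g. strict_mono r \<and> g \<in> bounded_borel \<and> (AE x in \<rho>. (\<lambda>n. P t0 (indicator (R (r n))) x) \<longlonglongrightarrow> g x)"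
    by (rule compactness[where C=1]) (use Rb in \<open>auto split: split_indicator\<close>)
  then obtain r g where r: "strict_mono r" and g: "g \<in> bounded_borel"
    and lim: "AE x in \<rho>. (\<lambda>n. P t0 (indicator (R (r n))) x) \<longlonglongrightarrow> g x" by blast
  obtain C where C: "\<And>x. \<bar>g x\<bar> \<le> C" using g by (metis bounded_borelE)
  let ?f = "\<lambda>n. P t0 (indicator (R (r n)))"
  have f: "?f n \<in> bounded_borel" for n using Rb t0_pos by auto
  have "(\<lambda>n. \<integral>x. \<bar>?f n x - g x\<bar> \<partial>\<rho>) \<longlonglongrightarrow> (\<integral>x. 0 \<partial>\<rho>)"
  proof (rule bounded_borel_DCT[OF finite_borel_\<rho>, where C="1 + C"])
    show "(\<lambda>x. \<bar>?f n x - g x\<bar>) \<in> bounded_borel" for n by (intro bounded_borel_intros f g)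
    have "\<bar>?f n x\<bar> \<le> 1 * 1" for n x by (rule P_bound) (use Rb t0_pos in \<open>auto split: split_indicator\<close>)
    then have "\<bar>?f n x - g x\<bar> \<le> 1 + C" for n x using abs_triangle_ineq4[of "?f n x" "g x"] C[of x]
      by (metis (no_types, lifting) add_mono mult_1 order_trans)
    then show "\<bar>\<bar>?f n x - g x\<bar>\<bar> \<le> 1 + C" for n x by simp
    show "AE x in \<rho>. (\<lambda>n. \<bar>?f n x - g x\<bar>) \<longlonglongrightarrow> 0"
      using lim by eventually_elim (auto intro!: tendsto_rabs_zero simp: LIM_zero)
  qed auto
  then have "\<forall>\<^sub>F n in sequentially. (\<integral>x. \<bar>?f n x - g x\<bar> \<partial>\<rho>) < measure \<rho> B / 6"
    by (rule order_tendstoD) (use B in auto)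
  then obtain N where N: "\<And>n. n \<ge> N \<Longrightarrow> (\<integral>x. \<bar>?f n x - g x\<bar> \<partial>\<rho>) < measure \<rho> B / 6"
    by (auto simp: eventually_sequentially)
  have "r N < r (Suc N)" using r by (simp add: strict_mono_Suc_iff)
  then have "measure \<rho> B / 3 \<le> (\<integral>x. \<bar>?f (Suc N) x - ?f N x\<bar> \<partial>\<rho>)"
    using R(2) measure_symdiff_P[OF R(1) R(1) t0_pos] by metis
  also have "\<dots> \<le> (\<integral>x. \<bar>?f (Suc N) x - g x\<bar> + \<bar>?f N x - g x\<bar> \<partial>\<rho>)"
    by (intro integral_mono integrable_\<rho> bounded_borel_intros f g) auto
  also have "\<dots> = (\<integral>x. \<bar>?f (Suc N) x - g x\<bar> \<partial>\<rho>) + (\<integral>x. \<bar>?f N x - g x\<bar> \<partial>\<rho>)"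
    by (intro Bochner_Integration.integral_add integrable_\<rho> bounded_borel_intros f g)
  also have "\<dots> < measure \<rho> B / 3" using N[of N] N[of "Suc N"] by simp
  finally show False by simp
qed

text \<open>Images of an atom of positive measure under the action cannot be pairwise disjoint, so some
  time step \<open>k * \<tau>\<close> fixes it; as \<open>\<tau> = t / N!\<close>, iterating this step reaches the time \<open>t\<close>.\<close>

lemma atom_fixed:
  assumes E: "det.atom E" and t: "t > 0"
  shows "AE x in \<rho>. P t (indicator E) x = indicator E x"
proof -
  have Ed: "E \<in> det" and Eb: "E \<in> sets borel" and m0: "measure \<rho> E > 0"
    and atom: "\<And>F. F \<in> det \<Longrightarrow> F \<subseteq> E \<Longrightarrow> measure \<rho> F = 0 \<or> measure \<rho> F = measure \<rho> E"
    using E by (auto simp: det.atom_def)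
  obtain N :: nat where N: "measure \<rho> UNIV < real N * measure \<rho> E" using ex_less_of_nat_mult[OF m0] by blast
  have Npos: "N > 0" using N measure_nonneg[of \<rho> UNIV] by (cases N) auto
  \<comment> \<open>The index \<open>k\<close> of the returning step is known only later; with this
    choice \<open>t\<close> is a multiple of \<open>k * \<tau>\<close> for every \<open>k\<close>
    with \<open>0 < k \<le> N\<close>.\<close>
  define \<tau> where "\<tau> = t / fact N"
  have \<tau>: "\<tau> > 0" using t by (simp add: \<tau>_def)
  \<comment> \<open>The image at index \<open>i\<close> belongs to the time
    \<open>(i + 1) * \<tau>\<close>, as time 0 is excluded.\<close>
  define E' where "E' i = img (real (Suc i) * \<tau>) E" for i
  have pos: "real (Suc i) * \<tau> > 0" for i using \<tau> by simp
  have E': "E' i \<in> det" "E' i \<in> sets borel" "measure \<rho> (E' i) = measure \<rho> E" for i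
    using img_det[OF Ed pos pos] img_borel[OF pos Eb] measure_img[OF Ed pos] unfolding E'_def by auto
  have "\<exists>i j. i < j \<and> j < N \<and> measure \<rho> (E' i \<inter> E' j) > 0"
  proof (rule ccontr)
    assume "\<not> ?thesis"
    then have null: "measure \<rho> (E' i \<inter> E' j) = 0" if "i < j" "j < N" for i j
      using that measure_nonneg[of \<rho> "E' i \<inter> E' j"] by (meson linorder_not_less order_antisym)
    have "n \<le> N \<Longrightarrow> measure \<rho> (\<Union>i<n. E' i) = real n * measure \<rho> E" for n
    proof (induction n)
      case (Suc n)
      have "measure \<rho> (E' n \<inter> (\<Union>i<n. E' i)) \<le> measure \<rho> (\<Union>i\<in>{..<n}. E' i \<inter> E' n)"
        using E' by (intro \<rho>.finite_measure_mono) auto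
      also have "\<dots> \<le> (\<Sum>i<n. measure \<rho> (E' i \<inter> E' n))"
        using E' by (intro \<rho>.finite_measure_subadditive_finite) auto
      also have "\<dots> = 0" using null Suc.prems by (intro sum.neutral) auto
      finally have "measure \<rho> (E' n \<inter> (\<Union>i<n. E' i)) = 0" using measure_nonneg[of \<rho> "E' n \<inter> (\<Union>i<n. E' i)"] by linarith
      then have "measure \<rho> (E' n \<union> (\<Union>i<n. E' i)) = measure \<rho> (E' n) + measure \<rho> (\<Union>i<n. E' i)"
        using E' measure_Un3[of "E' n" \<rho> "\<Union>i<n. E' i"] by (simp add: \<rho>.fmeasurable_eq_sets)
      moreover have "(\<Union>i<Suc n. E' i) = E' n \<union> (\<Union>i<n. E' i)" by (auto simp: less_Suc_eq)
      ultimately show ?case using Suc E' by (simp add: algebra_simps)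
    qed simp
    then have "real N * measure \<rho> E = measure \<rho> (\<Union>i<N. E' i)" by simp
    also have "\<dots> \<le> measure \<rho> UNIV" using \<rho>.bounded_measure by simp
    finally show False using N by simp
  qed
  then obtain i j where ij: "i < j" "j < N" "measure \<rho> (E' i \<inter> E' j) > 0" by blast
  define k where "k = j - i"
  have k: "0 < k" "k \<le> N" "j = i + k" using ij by (auto simp: k_def)
  have kpos: "real k * \<tau> > 0" using k \<tau> by simp
  define H where "H = img (real k * \<tau>) E"
  have H: "H \<in> det" "H \<in> sets borel" "measure \<rho> H = measure \<rho> E"
    using img_det[OF Ed kpos kpos] img_borel[OF kpos Eb] measure_img[OF Ed kpos] unfolding H_def by auto
  have sum_eq: "real (Suc i) * \<tau> + real k * \<tau> = real (Suc j) * \<tau>" using k(3) by (simp add: algebra_simps)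
  \<comment> \<open>Pulling out the common time reduces the overlap of two images to the overlap of
    \<open>E\<close> with its image \<open>H\<close> after time \<open>k * \<tau>\<close>. The
    latter has positive measure and lies in the atom \<open>E\<close>, so it has full measure in
    \<open>E\<close>, and in \<open>H\<close> as well since \<open>H\<close> has the same
    measure.\<close>
  have "AE x in \<rho>. x \<in> E' i \<inter> E' j \<longleftrightarrow> x \<in> img (real (Suc i) * \<tau>) (E \<inter> H)"
    using img_img(1)[OF Ed kpos pos[of i]]
  proof eventually_elim
    case (elim x)
    then have "x \<in> img (real (Suc i) * \<tau>) H \<longleftrightarrow> x \<in> E' j"
      unfolding sum_eq H_def E'_def by (auto simp: indicator_def split: if_splits)
    then show ?case using img_Int[OF Eb H(2) pos[of i]] by (auto simp: E'_def)
  qed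
  then have "measure \<rho> (E' i \<inter> E' j) = measure \<rho> (img (real (Suc i) * \<tau>) (E \<inter> H))"
    using E' img_borel[OF pos[of i], of "E \<inter> H"] Eb H by (intro measure_eq_AE) auto
  also have "\<dots> = measure \<rho> (E \<inter> H)"
    by (rule measure_img[OF det.subring_Int[OF Ed H(1)] pos])
  finally have mEH: "measure \<rho> (E \<inter> H) = measure \<rho> E"
    using atom[OF det.subring_Int[OF Ed H(1)]] ij(3) by auto
  have "measure \<rho> (E - H) = 0" "measure \<rho> (H - E) = 0"
    using \<rho>.finite_measure_Diff'[of E H] \<rho>.finite_measure_Diff'[of H E] mEH H Eb by (auto simp: Int_commute)
  then have "AE x in \<rho>. x \<notin> E - H" "AE x in \<rho>. x \<notin> H - E"
    using H Eb by (auto intro!: AE_not_in_null simp del: Diff_iff)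
  then have step1: "AE x in \<rho>. P (real k * \<tau>) (indicator E) x = indicator E x"
    using P_ind_img[OF Ed kpos] unfolding H_def[symmetric]
    by eventually_elim (auto simp: indicator_def)
  have iter: "AE x in \<rho>. P (real (Suc m) * (real k * \<tau>)) (indicator E) x = indicator E x" for m
  proof (induction m)
    case 0 then show ?case using step1 by simp
  next
    case (Suc m)
    have mpos: "real (Suc m) * (real k * \<tau>) > 0" using kpos by simp
    have "AE x in \<rho>. P (real (Suc m) * (real k * \<tau>)) (P (real k * \<tau>) (indicator E)) x = P (real (Suc m) * (real k * \<tau>)) (indicator E) x"
      by (rule AE_P_cong[OF invariant_\<rho> mpos _ _ step1]) (use Eb kpos in auto)
    moreover have "P (real (Suc m) * (real k * \<tau>)) (P (real k * \<tau>) (indicator E)) = P (real (Suc (Suc m)) * (real k * \<tau>)) (indicator E)"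
      using P_semigroup[OF kpos mpos, of "indicator E"] Eb by (simp add: algebra_simps)
    ultimately show ?case using Suc by auto
  qed
  have "k dvd fact N" using k by (simp add: dvd_fact)
  then obtain q where q: "fact N = k * q" by (rule dvdE)
  then have q0: "q > 0" by (metis fact_nonzero gr0I mult_0_right)
  \<comment> \<open>\<open>iter\<close> counts steps from one on, so \<open>q\<close> steps
    correspond to the index \<open>q - 1\<close>.\<close>
  have "real (Suc (q - 1)) * (real k * \<tau>) = t"
    using q0 k arg_cong[OF q, of real] by (simp add: \<tau>_def field_simps)
  then show ?thesis using iter[of "q - 1"] by metis
qed

text \<open>If \<open>A - img t A\<close> were not null, it would contain an atom \<open>E\<close>.
  As \<open>E\<close> is fixed, almost all of \<open>E\<close> lies in \<open>img t E\<close>, hence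
  in \<open>img t A\<close>, a contradiction. Equality of the measures of \<open>A\<close> and
  \<open>img t A\<close> then makes the opposite difference null.\<close>

lemma det_fixed:
  assumes A: "A \<in> det" and t: "t > 0"
  shows "AE x in \<rho>. P t (indicator A) x = indicator A x"
proof -
  have Ab: "A \<in> sets borel" "img t A \<in> sets borel" and iA: "img t A \<in> det"
    using A img_borel[OF t] img_det[OF A t t] by auto
  define B where "B = A - img t A"
  have B: "B \<in> det" unfolding B_def using A iA det.subring_Diff by auto
  have "measure \<rho> B = 0"
  proof (rule ccontr)
    assume "measure \<rho> B \<noteq> 0"
    then have "measure \<rho> B > 0" using measure_nonneg[of \<rho> B] by linarith
    then obtain E where E: "E \<subseteq> B" "det.atom E" using atom_exists[OF B] by blast
    have Eb: "E \<in> det" "E \<in> sets borel" "measure \<rho> E > 0" using E(2) by (auto simp: det.atom_def)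
    have "img t E \<subseteq> img t A" using E(1) Eb Ab t by (intro img_mono) (auto simp: B_def)
    have "AE x in \<rho>. x \<notin> E"
      using atom_fixed[OF E(2) t]
    proof eventually_elim
      case (elim x)
      show ?case
      proof
        assume "x \<in> E"
        then have "x \<in> img t E" using elim P_indicator[OF t Eb(2)] by (simp add: img_def)
        then show False using \<open>img t E \<subseteq> img t A\<close> \<open>x \<in> E\<close> E(1) by (auto simp: B_def)
      qed
    qed
    then have "measure \<rho> E = measure \<rho> {}" using Eb by (intro measure_eq_AE) auto
    then show False using Eb by simp
  qed
  moreover from this have "measure \<rho> (img t A - A) = 0"
    using \<rho>.finite_measure_Diff'[of A "img t A"] \<rho>.finite_measure_Diff'[of "img t A" A] measure_img[OF A t] Ab
    by (simp add: B_def Int_commute)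
  ultimately have "AE x in \<rho>. x \<notin> A - img t A" "AE x in \<rho>. x \<notin> img t A - A"
    using Ab by (auto intro!: AE_not_in_null simp: B_def simp del: Diff_iff)
  then show ?thesis
    using P_ind_img[OF A t] by eventually_elim (auto simp: indicator_def)
qed


text \<open>Mass one of the kernels enters through the constant term. The identity gives both
  Jensen's inequality for squares and its equality case.\<close>

lemma variance_P:
  assumes g: "g \<in> bounded_borel" and t: "t > 0"
  shows "(\<integral>y. (g y - P t g x)\<^sup>2 \<partial>K t x) = P t (\<lambda>y. (g y)\<^sup>2) x - (P t g x)\<^sup>2"
proof -
  let ?m = "P t g x"
  note I = integrable_bounded_borel[OF finite_K[OF t]]
  have "(\<integral>y. (g y - ?m)\<^sup>2 \<partial>K t x) = (\<integral>y. ((g y)\<^sup>2 + (- 2 * ?m) * g y) + ?m\<^sup>2 \<partial>K t x)"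
    by (simp add: power2_diff algebra_simps)
  also have "\<dots> = (\<integral>y. (g y)\<^sup>2 + (- 2 * ?m) * g y \<partial>K t x) + (\<integral>y. ?m\<^sup>2 \<partial>K t x)"
    by (intro Bochner_Integration.integral_add I bounded_borel_intros g)
  also have "(\<integral>y. (g y)\<^sup>2 + (- 2 * ?m) * g y \<partial>K t x) = (\<integral>y. (g y)\<^sup>2 \<partial>K t x) + (\<integral>y. (- 2 * ?m) * g y \<partial>K t x)"
    by (intro Bochner_Integration.integral_add I bounded_borel_intros g)
  also have "(\<integral>y. (- 2 * ?m) * g y \<partial>K t x) = (- 2 * ?m) * ?m" by (simp add: P_def)
  also have "(\<integral>y. ?m\<^sup>2 \<partial>K t x) = ?m\<^sup>2" using sets_K[OF t] markov[OF t] by simp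
  finally show ?thesis by (simp add: P_def power2_eq_square)
qed

lemma P_power2_le:
  assumes "g \<in> bounded_borel" "t > 0" shows "(P t g x)\<^sup>2 \<le> P t (\<lambda>y. (g y)\<^sup>2) x"
proof -
  have "0 \<le> (\<integral>y. (g y - P t g x)\<^sup>2 \<partial>K t x)" by simp
  then show ?thesis unfolding variance_P[OF assms] by simp
qed

lemma L2_contraction:
  assumes "g \<in> bounded_borel" "t > 0" shows "(\<integral>x. (P t g x)\<^sup>2 \<partial>\<rho>) \<le> (\<integral>x. (g x)\<^sup>2 \<partial>\<rho>)"
proof -
  have "(\<integral>x. (P t g x)\<^sup>2 \<partial>\<rho>) \<le> (\<integral>x. P t (\<lambda>y. (g y)\<^sup>2) x \<partial>\<rho>)"
    using assms by (intro integral_mono integrable_\<rho> P_power2_le bounded_borel_intros P_bounded_borel)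
  also have "\<dots> = (\<integral>x. (g x)\<^sup>2 \<partial>\<rho>)" using assms by (intro int_P bounded_borel_intros)
  finally show ?thesis .
qed

text \<open>Preservation of the \<open>L\<^sup>2\<close> norm makes the variance of \<open>b\<close> under almost every \<open>K t x\<close> vanish, so
  that the kernels act deterministically on the level sets of \<open>b\<close>.\<close>

lemma L2_isometric_fixed:
  assumes b: "b \<in> bounded_borel" and iso: "\<And>t. t > 0 \<Longrightarrow> (\<integral>x. (P t b x)\<^sup>2 \<partial>\<rho>) = (\<integral>x. (b x)\<^sup>2 \<partial>\<rho>)"
    and t: "t > 0"
  shows "AE x in \<rho>. P t b x = b x"
proof -
  define A where "A c = {y. b y > c}" for c
  have A: "A c \<in> sets borel" for c
    using bounded_borel_measurable[OF b] unfolding A_def by measurable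
  \<comment> \<open>The exceptional null set is the same for all \<open>c\<close>: outside it,
    \<open>b\<close> equals \<open>P t b x\<close> almost surely under \<open>K t x\<close>.\<close>
  have level: "AE x in \<rho>. \<forall>c. measure (K t x) (A c) = (if P t b x > c then 1 else 0)" if t: "t > 0" for t
  proof -
    have b2: "(\<lambda>y. (b y)\<^sup>2) \<in> bounded_borel" "(\<lambda>x. (P t b x)\<^sup>2) \<in> bounded_borel"
      using b t by (auto intro!: bounded_borel_power2)
    have "(\<integral>x. P t (\<lambda>y. (b y)\<^sup>2) x - (P t b x)\<^sup>2 \<partial>\<rho>) = (\<integral>x. P t (\<lambda>y. (b y)\<^sup>2) x \<partial>\<rho>) - (\<integral>x. (P t b x)\<^sup>2 \<partial>\<rho>)"
      using b2 t by (intro Bochner_Integration.integral_diff integrable_\<rho>) auto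
    also have "\<dots> = 0" using int_P[OF t b2(1)] iso[OF t] by simp
    finally have "AE x in \<rho>. P t (\<lambda>y. (b y)\<^sup>2) x - (P t b x)\<^sup>2 = 0"
      using b2 t P_power2_le[OF b t] by (subst (asm) integral_nonneg_eq_0_iff_AE) (auto intro!: integrable_\<rho> bounded_borel_diff)
    then show ?thesis
    proof eventually_elim
      case (elim x)
      have "(\<integral>y. (b y - P t b x)\<^sup>2 \<partial>K t x) = 0" using variance_P[OF b t] elim by simp
      then have ae: "AE y in K t x. b y = P t b x"
        by (subst (asm) integral_nonneg_eq_0_iff_AE)
          (auto intro!: integrable_bounded_borel[OF finite_K[OF t]] bounded_borel_intros b)
      show ?case
      proof
        fix c
        show "measure (K t x) (A c) = (if P t b x > c then 1 else 0)"
        proof (cases "P t b x > c")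
          case True
          have "measure (K t x) (A c) = measure (K t x) UNIV"
            using ae A sets_K[OF t] True by (intro measure_eq_AE) (auto simp: A_def)
          then show ?thesis using True markov[OF t] by simp
        next
          case False
          have "measure (K t x) (A c) = measure (K t x) {}"
            using ae A sets_K[OF t] False by (intro measure_eq_AE) (auto simp: A_def)
          then show ?thesis using False by simp
        qed
      qed
    qed
  qed
  have det: "A c \<in> det" for c
    unfolding det_def
  proof (intro CollectI conjI allI impI A)
    fix t :: real assume "t > 0"
    from level[OF this] show "AE x in \<rho>. measure (K t x) (A c) = 0 \<or> measure (K t x) (A c) = 1"
      by eventually_elim (metis (full_types))
  qed
  \<comment> \<open>Rational levels suffice to compare \<open>P t b x\<close> with
    \<open>b x\<close>, and involve only countably many null sets.\<close>
  have "AE x in \<rho>. \<forall>c. measure (K t x) (A (real_of_rat c)) = indicator (A (real_of_rat c)) x"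
    using det_fixed[OF det t] P_indicator[OF t A] by (simp add: AE_all_countable)
  then show ?thesis
    using level[OF t]
  proof eventually_elim
    case (elim x)
    have iff: "P t b x > real_of_rat c \<longleftrightarrow> b x > real_of_rat c" for c
    proof -
      have "(if P t b x > real_of_rat c then 1 else 0) = (indicator (A (real_of_rat c)) x :: real)" using elim by metis
      then show ?thesis by (auto simp: A_def indicator_def split: if_splits)
    qed
    show ?case
    proof (rule ccontr)
      assume "P t b x \<noteq> b x"
      then consider "P t b x < b x" | "b x < P t b x" by linarith
      then show False
      proof cases
        case 1
        then obtain c where "P t b x < real_of_rat c" "real_of_rat c < b x" using of_rat_dense by blast
        then show False using iff[of c] by auto
      next
        case 2
        then obtain c where "b x < real_of_rat c" "real_of_rat c < P t b x" using of_rat_dense by blast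
        then show False using iff[of c] by auto
      qed
    qed
  qed
qed

text \<open>The squared L2 norm decreases along the orbit, so a limit point \<open>b\<close> and all
  its images have the same norm, the limit of the norms along the orbit. Hence \<open>b\<close> is
  fixed by \<open>L2_isometric_fixed\<close>, and the L1 contraction keeps the orbit near
  \<open>b\<close> once it has come near.\<close>

theorem L1_convergence:
  assumes f: "f \<in> bounded_borel"
  obtains b where "b \<in> bounded_borel" "((\<lambda>t. \<integral>x. \<bar>P t f x - b x\<bar> \<partial>\<rho>) \<longlongrightarrow> 0) at_top"
proof -
  obtain C where C: "\<And>x. \<bar>f x\<bar> \<le> C" using f by (metis bounded_borelE)
  have PC: "\<bar>P t f x\<bar> \<le> C" if "t > 0" for t x using P_bound[OF that f C] by simp
  have "\<exists>r b. strict_mono r \<and> b \<in> bounded_borel \<and> (AE x in \<rho>. (\<lambda>n. P t0 (P (real (Suc (r n))) f) x) \<longlonglongrightarrow> b x)"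
    by (rule compactness[where C=C]) (use f PC in auto)
  then obtain r b where r: "strict_mono r" and b: "b \<in> bounded_borel"
    and lim: "AE x in \<rho>. (\<lambda>n. P t0 (P (real (Suc (r n))) f) x) \<longlonglongrightarrow> b x" by blast
  \<comment> \<open>The shift by \<open>t0\<close> is the application of \<open>P t0\<close> that
    provides compactness.\<close>
  define s where "s n = t0 + real (Suc (r n))" for n
  have s: "s n > 0" for n using t0_pos by (simp add: s_def)
  have s_mono: "s m < s n" if "m < n" for m n using r that by (simp add: s_def strict_mono_def)
  have s_ge: "real n < s n" for n
    using seq_suble[OF r, of n] t0_pos by (simp add: s_def)
  define G where "G n = P (s n) f" for n
  have G: "G n \<in> bounded_borel" "\<And>x. \<bar>G n x\<bar> \<le> C" for n using f s PC by (auto simp: G_def)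
  have G_eq: "P t0 (P (real (Suc (r n))) f) = G n" for n
    using P_semigroup[of "real (Suc (r n))" t0 f] f t0_pos by (simp add: G_def s_def)
  have limG: "AE x in \<rho>. (\<lambda>n. G n x) \<longlonglongrightarrow> b x" using lim unfolding G_eq .
  obtain D where D: "\<And>x. \<bar>b x\<bar> \<le> D" using b by (metis bounded_borelE)
  have L1: "(\<lambda>n. \<integral>x. \<bar>G n x - b x\<bar> \<partial>\<rho>) \<longlonglongrightarrow> 0"
  proof -
    have "(\<lambda>n. \<integral>x. \<bar>G n x - b x\<bar> \<partial>\<rho>) \<longlonglongrightarrow> (\<integral>x. 0 \<partial>\<rho>)"
    proof (rule bounded_borel_DCT[OF finite_borel_\<rho>, where C="C + D"])
      show "(\<lambda>x. \<bar>G n x - b x\<bar>) \<in> bounded_borel" for n by (intro bounded_borel_intros G b)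
      show "\<bar>\<bar>G n x - b x\<bar>\<bar> \<le> C + D" for n x using G(2)[of n x] D[of x] by linarith
      show "AE x in \<rho>. (\<lambda>n. \<bar>G n x - b x\<bar>) \<longlonglongrightarrow> 0"
        using limG by eventually_elim (auto intro!: tendsto_rabs_zero simp: LIM_zero)
    qed auto
    then show ?thesis by simp
  qed
  \<comment> \<open>For uniformly bounded functions L1 convergence implies convergence of the L2
    norms, by factoring the difference of squares.\<close>
  have sq: "(\<lambda>n. \<integral>x. (H n x)\<^sup>2 \<partial>\<rho>) \<longlonglongrightarrow> (\<integral>x. (h x)\<^sup>2 \<partial>\<rho>)"
    if H: "\<And>n. H n \<in> bounded_borel" "\<And>n x. \<bar>H n x\<bar> \<le> C" and h: "h \<in> bounded_borel" "\<And>x. \<bar>h x\<bar> \<le> D"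
      and conv: "(\<lambda>n. \<integral>x. \<bar>H n x - h x\<bar> \<partial>\<rho>) \<longlonglongrightarrow> 0" for H h
  proof (rule LIM_zero_cancel, rule tendsto_rabs_zero_cancel, rule tendsto_sandwich[OF _ _ tendsto_const])
    show "(\<lambda>n. (C + D) * (\<integral>x. \<bar>H n x - h x\<bar> \<partial>\<rho>)) \<longlonglongrightarrow> 0"
      using tendsto_mult[OF tendsto_const conv, of "C + D"] by simp
    show "\<forall>\<^sub>F n in sequentially. \<bar>(\<integral>x. (H n x)\<^sup>2 \<partial>\<rho>) - (\<integral>x. (h x)\<^sup>2 \<partial>\<rho>)\<bar> \<le> (C + D) * (\<integral>x. \<bar>H n x - h x\<bar> \<partial>\<rho>)"
    proof (intro always_eventually allI)
      fix n
      have "\<bar>(\<integral>x. (H n x)\<^sup>2 \<partial>\<rho>) - (\<integral>x. (h x)\<^sup>2 \<partial>\<rho>)\<bar> = \<bar>\<integral>x. (H n x)\<^sup>2 - (h x)\<^sup>2 \<partial>\<rho>\<bar>"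
        by (subst Bochner_Integration.integral_diff) (intro integrable_\<rho> bounded_borel_intros H h refl)+
      also have "\<dots> \<le> (\<integral>x. \<bar>(H n x)\<^sup>2 - (h x)\<^sup>2\<bar> \<partial>\<rho>)" by (rule integral_abs_bound)
      also have "\<dots> \<le> (\<integral>x. (C + D) * \<bar>H n x - h x\<bar> \<partial>\<rho>)"
      proof (rule integral_mono)
        fix x
        have "\<bar>(H n x)\<^sup>2 - (h x)\<^sup>2\<bar> = \<bar>H n x + h x\<bar> * \<bar>H n x - h x\<bar>"
          by (simp add: power2_eq_square abs_mult[symmetric] algebra_simps)
        also have "\<dots> \<le> (C + D) * \<bar>H n x - h x\<bar>"
          using H(2)[of n x] h(2)[of x] by (intro mult_right_mono) linarith+
        finally show "\<bar>(H n x)\<^sup>2 - (h x)\<^sup>2\<bar> \<le> (C + D) * \<bar>H n x - h x\<bar>" .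
      qed (intro integrable_\<rho> bounded_borel_intros H h)+
      also have "\<dots> = (C + D) * (\<integral>x. \<bar>H n x - h x\<bar> \<partial>\<rho>)" by simp
      finally show "\<bar>(\<integral>x. (H n x)\<^sup>2 \<partial>\<rho>) - (\<integral>x. (h x)\<^sup>2 \<partial>\<rho>)\<bar> \<le> (C + D) * (\<integral>x. \<bar>H n x - h x\<bar> \<partial>\<rho>)" .
    qed
  qed simp
  define N where "N t = (\<integral>x. (P t f x)\<^sup>2 \<partial>\<rho>)" for t
  have N_mono: "N u \<le> N t" if "0 < t" "t \<le> u" for t u
  proof (cases "t = u")
    case False
    then have "P u f = P (u - t) (P t f)" using P_semigroup[of t "u - t" f] f that by simp
    then show ?thesis unfolding N_def using that False f by (auto intro!: L2_contraction)
  qed simp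
  have Nlim: "(\<lambda>n. N (s n)) \<longlonglongrightarrow> (\<integral>x. (b x)\<^sup>2 \<partial>\<rho>)"
    using sq[OF G b D L1] by (simp add: N_def G_def)
  have "decseq (\<lambda>n. N (s n))" by (intro decseq_SucI N_mono s less_imp_le[OF s_mono]) auto
  then have N_ge: "(\<integral>x. (b x)\<^sup>2 \<partial>\<rho>) \<le> N (s n)" for n using Nlim by (rule decseq_ge)
  have iso: "(\<integral>x. (P t b x)\<^sup>2 \<partial>\<rho>) = (\<integral>x. (b x)\<^sup>2 \<partial>\<rho>)" if t: "t > 0" for t
  proof (rule antisym)
    show "(\<integral>x. (P t b x)\<^sup>2 \<partial>\<rho>) \<le> (\<integral>x. (b x)\<^sup>2 \<partial>\<rho>)" by (rule L2_contraction[OF b t])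
    have "(\<lambda>n. \<integral>x. (P t (G n) x)\<^sup>2 \<partial>\<rho>) \<longlonglongrightarrow> (\<integral>x. (P t b x)\<^sup>2 \<partial>\<rho>)"
    proof (rule sq)
      show "\<bar>P t (G n) x\<bar> \<le> C" for n x using P_bound[OF t G] by simp
      show "\<bar>P t b x\<bar> \<le> D" for x using P_bound[OF t b D] by simp
      show "(\<lambda>n. \<integral>x. \<bar>P t (G n) x - P t b x\<bar> \<partial>\<rho>) \<longlonglongrightarrow> 0"
        by (rule tendsto_sandwich[OF _ _ tendsto_const L1])
          (use L1_contraction_diff[OF invariant_\<rho> t G(1) b] in auto)
    qed (use t G b in auto)
    \<comment> \<open>The time \<open>t + s n\<close> need not belong to the sequence
      \<open>s\<close>. A later time \<open>s m\<close> does, and monotonicity of \<open>N\<close>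
      transfers the lower bound back.\<close>
    moreover have "(\<integral>x. (b x)\<^sup>2 \<partial>\<rho>) \<le> (\<integral>x. (P t (G n) x)\<^sup>2 \<partial>\<rho>)" for n
    proof -
      obtain m :: nat where m: "t + s n < real m" using reals_Archimedean2 by blast
      have "P t (G n) = P (t + s n) f" unfolding G_def by (rule P_semigroup[OF s t f])
      then have "(\<integral>x. (P t (G n) x)\<^sup>2 \<partial>\<rho>) = N (t + s n)" by (simp add: N_def)
      moreover have "N (s m) \<le> N (t + s n)" using m s_ge[of m] s[of n] t by (intro N_mono) auto
      ultimately show ?thesis using N_ge[of m] by simp
    qed
    ultimately show "(\<integral>x. (b x)\<^sup>2 \<partial>\<rho>) \<le> (\<integral>x. (P t b x)\<^sup>2 \<partial>\<rho>)" by (intro LIMSEQ_le_const) auto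
  qed
  have fixed: "AE x in \<rho>. P t b x = b x" if "t > 0" for t by (rule L2_isometric_fixed[OF b iso that])
  have "((\<lambda>t. \<integral>x. \<bar>P t f x - b x\<bar> \<partial>\<rho>) \<longlongrightarrow> 0) at_top"
    unfolding tendsto_iff dist_real_def
  proof (intro allI impI)
    fix e :: real assume "e > 0"
    then obtain n where n: "(\<integral>x. \<bar>G n x - b x\<bar> \<partial>\<rho>) < e"
      using order_tendstoD(2)[OF L1, of e] by (auto simp: eventually_sequentially)
    show "\<forall>\<^sub>F t in at_top. \<bar>(\<integral>x. \<bar>P t f x - b x\<bar> \<partial>\<rho>) - 0\<bar> < e"
      using eventually_gt_at_top[of "s n"]
    proof eventually_elim
      case (elim t)
      define u where "u = t - s n"
      have u: "u > 0" using elim by (simp add: u_def)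
      have eq: "P t f = P u (G n)" using P_semigroup[OF s u f, of n] by (simp add: u_def G_def)
      have "(\<integral>x. \<bar>P t f x - b x\<bar> \<partial>\<rho>) = (\<integral>x. \<bar>P u (G n) x - P u b x\<bar> \<partial>\<rho>)"
      proof (rule integral_cong_AE)
        show "AE x in \<rho>. \<bar>P t f x - b x\<bar> = \<bar>P u (G n) x - P u b x\<bar>"
          using fixed[OF u] unfolding eq by eventually_elim simp
      qed (use u G b f eq s elim bounded_borel_measurable in \<open>auto intro!: bounded_borel_intros bounded_borel_measurable P_bounded_borel\<close>)
      also have "\<dots> \<le> (\<integral>x. \<bar>G n x - b x\<bar> \<partial>\<rho>)" by (rule L1_contraction_diff[OF invariant_\<rho> u G(1) b])
      finally show ?case using n by simp
    qed
  qed
  with b show thesis by (rule that)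
qed

end

section \<open>Strongly Feller semigroups\<close>

lemma diagonal_convergent_subsequence:
  fixes c :: "nat \<Rightarrow> nat \<Rightarrow> real"
  assumes "\<And>n k. \<bar>c n k\<bar> \<le> B n"
  shows "\<exists>r :: nat \<Rightarrow> nat. strict_mono r \<and> (\<forall>n. convergent (\<lambda>k. c n (r k)))"
proof -
  let ?P = "\<lambda>n s. convergent (\<lambda>k. c n (s k))"
  interpret nat: subseqs ?P
  proof
    fix n and s :: "nat \<Rightarrow> nat" assume s: "strict_mono s"
    have "bounded (range (\<lambda>k. c n (s k)))" using assms by (auto simp: bounded_iff)
    then obtain l r where "strict_mono r" "((\<lambda>k. c n (s k)) \<circ> r) \<longlonglongrightarrow> l"
      using bounded_imp_convergent_subsequence by blast
    then show "\<exists>r'. strict_mono r' \<and> ?P n (s \<circ> r')"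
      by (auto simp: comp_def convergent_def)
  qed
  have "?P n nat.diagseq" for n
  proof -
    have Pn: "?P n (nat.seqseq (Suc n))" by (rule nat.seqseq_holds)
    have eq: "(\<lambda>k. c n ((nat.seqseq (Suc n) \<circ> (\<lambda>k. nat.fold_reduce (Suc n) k (Suc n + k))) k)) =
        (\<lambda>k. c n (nat.seqseq (Suc n) k)) \<circ> (\<lambda>k. nat.fold_reduce (Suc n) k (Suc n + k))"
      by auto
    have "?P n (nat.diagseq \<circ> ((+) (Suc n)))"
      unfolding nat.diagseq_seqseq eq
      by (intro convergent_subseq_convergent Pn nat.subseq_diagonal_rest)
    then obtain L where "(\<lambda>k. c n (nat.diagseq (k + Suc n))) \<longlonglongrightarrow> L"
      by (auto simp: add.commute dest: convergentD)
    then have "(\<lambda>k. c n (nat.diagseq k)) \<longlonglongrightarrow> L" by (rule LIMSEQ_offset)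
    then show ?thesis by (auto simp: convergent_def)
  qed
  then show ?thesis using nat.subseq_diagseq by blast
qed

lemma absolutely_continuous_density:
  assumes \<mu>: "finite_borel \<mu>" and \<nu>: "finite_borel \<nu>"
    and ac: "\<And>A. A \<in> sets borel \<Longrightarrow> measure \<mu> A = 0 \<Longrightarrow> measure \<nu> A = 0"
  obtains D :: "'a::topological_space \<Rightarrow> real" where "integrable \<mu> D" "\<And>x. 0 \<le> D x"
    "\<And>f. f \<in> bounded_borel \<Longrightarrow> integral\<^sup>L \<nu> f = (\<integral>x. D x * f x \<partial>\<mu>)"
proof -
  interpret \<mu>: finite_measure \<mu> by (rule finite_borelD[OF \<mu>])
  interpret \<nu>: finite_measure \<nu> by (rule finite_borelD[OF \<nu>])
  have sets: "sets \<nu> = sets \<mu>" using finite_borelD(2)[OF \<mu>] finite_borelD(2)[OF \<nu>] by simp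
  have "absolutely_continuous \<mu> \<nu>"
    unfolding absolutely_continuous_def null_sets_def
    using ac finite_borelD(2)[OF \<mu>] finite_borelD(2)[OF \<nu>] by (auto simp: \<mu>.emeasure_eq_measure \<nu>.emeasure_eq_measure)
  note ac = this sets
  obtain D where D: "D \<in> borel_measurable \<mu>" "AE x in \<mu>. RN_deriv \<mu> \<nu> x = ennreal (D x)" "\<And>x. 0 \<le> D x"
    using \<mu>.real_RN_deriv[OF \<nu>.finite_measure_axioms ac] by blast
  have "density \<mu> (\<lambda>x. ennreal (D x)) = density \<mu> (RN_deriv \<mu> \<nu>)"
    using D by (intro density_cong) auto
  then have dens: "density \<mu> (\<lambda>x. ennreal (D x)) = \<nu>" using \<mu>.density_RN_deriv[OF ac] by simp
  have "integrable (density \<mu> (\<lambda>x. ennreal (D x))) (\<lambda>x. 1 :: real)" unfolding dens by simp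
  then have "integrable \<mu> D" using D by (subst (asm) integrable_density) auto
  moreover have "integral\<^sup>L \<nu> f = (\<integral>x. D x * f x \<partial>\<mu>)" if "f \<in> bounded_borel" for f
    using integral_density[of f \<mu> D] bounded_borel_measurable[OF that] D finite_borelD(4)[OF \<mu>] unfolding dens by auto
  ultimately show thesis using D(3) that by blast
qed

text \<open>Finite intersections of a countable base; the empty intersection supplies the whole
  space. Stability under intersections allows Dynkin induction, countability allows a diagonal
  subsequence.\<close>

lemma countable_Int_stable_generator:
  obtains \<U> :: "'a::second_countable_topology set set"
  where "countable \<U>" "UNIV \<in> \<U>" "Int_stable \<U>" "\<U> \<subseteq> sets borel" "sigma_sets UNIV \<U> = sets borel"
proof -
  obtain \<B> :: "'a set set" where \<B>: "countable \<B>" "topological_basis \<B>"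
    using ex_countable_basis by blast
  define \<U> where "\<U> = Inter ` {F. finite F \<and> F \<subseteq> \<B>}"
  have "countable \<U>" unfolding \<U>_def using countable_Collect_finite_subset[OF \<B>(1)] by auto
  moreover have "UNIV \<in> \<U>" unfolding \<U>_def by (auto intro!: image_eqI[of _ _ "{}"])
  moreover have "Int_stable \<U>"
  proof (rule Int_stableI)
    fix a b assume "a \<in> \<U>" "b \<in> \<U>"
    then obtain F G where "a = \<Inter>F" "b = \<Inter>G" "finite F" "finite G" "F \<subseteq> \<B>" "G \<subseteq> \<B>" by (auto simp: \<U>_def)
    then show "a \<inter> b \<in> \<U>" unfolding \<U>_def by (intro image_eqI[of _ _ "F \<union> G"]) auto
  qed
  moreover have open_U: "open u" if "u \<in> \<U>" for u
    using that topological_basis_open[OF \<B>(2)] unfolding \<U>_def by (auto intro!: open_Inter)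
  then have sub: "\<U> \<subseteq> sets borel" by auto
  moreover have "sigma_sets UNIV \<U> = sets borel"
  proof
    show "sigma_sets UNIV \<U> \<subseteq> sets borel"
      using sets.sigma_sets_subset[OF sub] by simp
    have "\<B> \<subseteq> \<U>"
    proof
      fix b assume "b \<in> \<B>" then show "b \<in> \<U>" unfolding \<U>_def by (intro image_eqI[of _ _ "{b}"]) auto
    qed
    then have "sigma_sets UNIV \<B> \<subseteq> sigma_sets UNIV \<U>" by (rule sigma_sets_subseteq)
    moreover have "sets (borel :: 'a measure) = sigma_sets UNIV \<B>"
      by (subst borel_eq_countable_basis[OF \<B>]) simp
    ultimately show "sets borel \<subseteq> sigma_sets UNIV \<U>" by simp
  qed
  ultimately show thesis using that by blast
qed

text \<open>Sequential Banach-Alaoglu theorem for bounded sequences in the dual of L1. A diagonal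
  subsequence works for the countable generator; the set of good \<open>\<phi>\<close> is linear and
  closed in L1, because the functions \<open>F n\<close> are uniformly bounded, so Dynkin induction
  extends it to all indicators and density to all integrable functions.\<close>

lemma weak_star_compact:
  fixes F :: "nat \<Rightarrow> 'a::second_countable_topology \<Rightarrow> real"
  assumes \<mu>: "finite_borel \<mu>" and F: "\<And>n. F n \<in> bounded_borel" "\<And>n x. \<bar>F n x\<bar> \<le> C"
  shows "\<exists>r :: nat \<Rightarrow> nat. strict_mono r \<and>
    (\<forall>\<phi>. integrable \<mu> \<phi> \<longrightarrow> convergent (\<lambda>n. \<integral>x. \<phi> x * F (r n) x \<partial>\<mu>))"
proof -
  obtain \<U> :: "'a set set" where \<U>: "countable \<U>" "UNIV \<in> \<U>" "Int_stable \<U>" "\<U> \<subseteq> sets borel" "sigma_sets UNIV \<U> = sets borel"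
    by (rule countable_Int_stable_generator)
  note fin = finite_borelD[OF \<mu>]
  interpret \<mu>: finite_measure \<mu> by (rule fin)
  have C0: "C \<ge> 0" using F(2)[of 0 undefined] by linarith
  have prod: "integrable \<mu> (\<lambda>x. \<phi> x * F n x)" if "integrable \<mu> \<phi>" for \<phi> n
  proof (rule Bochner_Integration.integrable_bound[OF integrable_mult_left[OF that, of C]])
    show "(\<lambda>x. \<phi> x * F n x) \<in> borel_measurable \<mu>"
      using that F(1)[of n] fin(4) by (auto intro!: borel_measurable_times)
    show "AE x in \<mu>. norm (\<phi> x * F n x) \<le> norm (\<phi> x * C)"
      using F(2) C0 by (auto simp: abs_mult intro!: mult_left_mono)
  qed
  have le: "\<bar>\<integral>x. \<phi> x * F n x \<partial>\<mu>\<bar> \<le> C * (\<integral>x. \<bar>\<phi> x\<bar> \<partial>\<mu>)" if "integrable \<mu> \<phi>" for \<phi> n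
  proof -
    have "\<bar>\<integral>x. \<phi> x * F n x \<partial>\<mu>\<bar> \<le> (\<integral>x. \<bar>\<phi> x * F n x\<bar> \<partial>\<mu>)" by (rule integral_abs_bound)
    also have "\<dots> \<le> (\<integral>x. C * \<bar>\<phi> x\<bar> \<partial>\<mu>)"
    proof (rule integral_mono)
      fix x show "\<bar>\<phi> x * F n x\<bar> \<le> C * \<bar>\<phi> x\<bar>"
        using mult_left_mono[OF F(2)[of n x], of "\<bar>\<phi> x\<bar>"] by (simp add: abs_mult mult.commute)
    qed (use prod[OF that] that in auto)
    finally show ?thesis by simp
  qed
  define U where "U = from_nat_into \<U>"
  have U: "range U = \<U>" unfolding U_def using \<U>(1,2) by (intro range_from_nat_into) auto
  have intU: "integrable \<mu> (indicator A :: _ \<Rightarrow> real)" if "A \<in> sets borel" for A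
    by (rule integrable_bounded_borel[OF \<mu> bounded_borel_indicator[OF that]])
  have "\<exists>r :: nat \<Rightarrow> nat. strict_mono r \<and> (\<forall>n. convergent (\<lambda>k. \<integral>x. indicator (U n) x * F (r k) x \<partial>\<mu>))"
  proof (rule diagonal_convergent_subsequence)
    fix n k
    have "U n \<in> sets borel" using U \<U>(4) by auto
    then show "\<bar>\<integral>x. indicator (U n) x * F k x \<partial>\<mu>\<bar> \<le> C * (\<integral>x. \<bar>indicator (U n) x\<bar> \<partial>\<mu>)"
      by (rule le[OF intU])
  qed
  then obtain r :: "nat \<Rightarrow> nat" where r: "strict_mono r"
    and conv: "\<And>n. convergent (\<lambda>k. \<integral>x. indicator (U n) x * F (r k) x \<partial>\<mu>)" by blast
  define good where "good \<phi> \<longleftrightarrow> integrable \<mu> \<phi> \<and> convergent (\<lambda>n. \<integral>x. \<phi> x * F (r n) x \<partial>\<mu>)" for \<phi>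
  have good_add: "good (\<lambda>x. \<phi> x + \<psi> x)" if "good \<phi>" "good \<psi>" for \<phi> \<psi>
    using that convergent_add[of "\<lambda>n. \<integral>x. \<phi> x * F (r n) x \<partial>\<mu>" "\<lambda>n. \<integral>x. \<psi> x * F (r n) x \<partial>\<mu>"]
    by (auto simp: good_def distrib_right prod)
  have good_cmult: "good (\<lambda>x. c * \<phi> x)" if "good \<phi>" for c \<phi>
  proof -
    have "convergent (\<lambda>n. c * (\<integral>x. \<phi> x * F (r n) x \<partial>\<mu>))"
      using that by (intro convergent_mult convergent_const) (auto simp: good_def)
    then show ?thesis using that by (auto simp: good_def mult.assoc)
  qed
  have good_lim: "good \<phi>" if \<phi>: "integrable \<mu> \<phi>" and s: "\<And>i::nat. good (s i)"
      and lim: "(\<lambda>i. \<integral>x. \<bar>\<phi> x - s i x\<bar> \<partial>\<mu>) \<longlonglongrightarrow> 0" for \<phi> s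
  proof -
    have "Cauchy (\<lambda>n. \<integral>x. \<phi> x * F (r n) x \<partial>\<mu>)"
    proof (rule metric_CauchyI)
      fix e :: real assume e: "e > 0"
      \<comment> \<open>The three parts are two approximation errors and one Cauchy difference;
        \<open>C + 1\<close> avoids division by a bound that may be 0.\<close>
      then have "e / (3 * (C + 1)) > 0" using C0 by simp
      from order_tendstoD(2)[OF lim this] obtain i where i: "(\<integral>x. \<bar>\<phi> x - s i x\<bar> \<partial>\<mu>) < e / (3 * (C + 1))"
        by (auto simp: eventually_sequentially)
      have si: "integrable \<mu> (s i)" using s by (auto simp: good_def)
      have bd: "\<bar>(\<integral>x. \<phi> x * F n x \<partial>\<mu>) - (\<integral>x. s i x * F n x \<partial>\<mu>)\<bar> < e / 3" for n
      proof -
        have "(\<integral>x. \<phi> x * F n x \<partial>\<mu>) - (\<integral>x. s i x * F n x \<partial>\<mu>) = (\<integral>x. (\<phi> x - s i x) * F n x \<partial>\<mu>)"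
          using prod[OF \<phi>] prod[OF si] by (simp add: left_diff_distrib)
        then have "\<bar>(\<integral>x. \<phi> x * F n x \<partial>\<mu>) - (\<integral>x. s i x * F n x \<partial>\<mu>)\<bar> \<le> C * (\<integral>x. \<bar>\<phi> x - s i x\<bar> \<partial>\<mu>)"
          using le[of "\<lambda>x. \<phi> x - s i x" n] \<phi> si by simp
        also have "\<dots> \<le> (C + 1) * (\<integral>x. \<bar>\<phi> x - s i x\<bar> \<partial>\<mu>)"
          by (rule mult_right_mono) auto
        also have "\<dots> < (C + 1) * (e / (3 * (C + 1)))"
          using i C0 by (intro mult_strict_left_mono) auto
        also have "\<dots> = e / 3" using C0 by (simp add: field_simps)
        finally show ?thesis .
      qed
      have "Cauchy (\<lambda>n. \<integral>x. s i x * F (r n) x \<partial>\<mu>)"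
        using s[of i] by (auto simp: good_def Cauchy_convergent_iff)
      then obtain N where N: "\<And>m n. m \<ge> N \<Longrightarrow> n \<ge> N \<Longrightarrow>
          dist (\<integral>x. s i x * F (r m) x \<partial>\<mu>) (\<integral>x. s i x * F (r n) x \<partial>\<mu>) < e / 3"
        using metric_CauchyD[of "\<lambda>n. \<integral>x. s i x * F (r n) x \<partial>\<mu>" "e / 3"] e by auto
      show "\<exists>N. \<forall>m\<ge>N. \<forall>n\<ge>N. dist (\<integral>x. \<phi> x * F (r m) x \<partial>\<mu>) (\<integral>x. \<phi> x * F (r n) x \<partial>\<mu>) < e"
      proof (intro exI[of _ N] allI impI)
        fix m n assume "m \<ge> N" "n \<ge> N"
        then show "dist (\<integral>x. \<phi> x * F (r m) x \<partial>\<mu>) (\<integral>x. \<phi> x * F (r n) x \<partial>\<mu>) < e"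
          using N[of m n] bd[of "r m"] bd[of "r n"] unfolding dist_real_def by linarith
      qed
    qed
    then show ?thesis using \<phi> by (auto simp: good_def Cauchy_convergent_iff)
  qed
  have good_ind: "good (indicator A)" if "A \<in> sets borel" for A
  proof -
    have "A \<in> sigma_sets UNIV \<U>" using that \<U>(5) by simp
    from \<U>(3) subset_UNIV[of \<U>, folded Pow_UNIV] this show ?thesis
    proof (induction rule: sigma_sets_induct_disjoint)
      case (basic A)
      then obtain n where "A = U n" using U by blast
      then show ?case using conv[of n] basic \<U>(4) intU unfolding good_def by auto
    next
      case empty
      have "(indicator {} :: 'a \<Rightarrow> real) = (\<lambda>x. 0)" by (auto simp: indicator_def)
      then show ?case by (auto simp: good_def convergent_const)
    next
      case (compl A)
      obtain n where "U n = UNIV" using U \<U>(2) by (metis rangeE)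
      then have "good (indicator UNIV)" using conv[of n] intU[of UNIV] by (simp add: good_def)
      then have "good (\<lambda>x. indicator UNIV x + (-1) * indicator A x)" using compl by (intro good_add good_cmult)
      also have "(\<lambda>x. indicator UNIV x + (-1) * indicator A x) = (indicator (UNIV - A) :: 'a \<Rightarrow> real)"
        by (auto simp: indicator_def)
      finally show ?case .
    next
      case (union A)
      have A: "A i \<in> sets borel" for i using union(2) \<U>(5) by auto
      define s where "s n = (\<lambda>x. \<Sum>i<n. indicator (A i) x :: real)" for n
      have s: "s n = indicator (\<Union>i<n. A i)" for n
      proof
        fix x
        have "indicator (\<Union>i<n. A i) x = (\<Sum>i<n. indicator (A i) x :: real)"
          using indicator_UN_disjoint[of "{..<n}" A x] union(1) by (auto simp: disjoint_family_on_def)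
        then show "s n x = indicator (\<Union>i<n. A i) x" by (simp add: s_def)
      qed
      show ?case
      proof (rule good_lim)
        show "integrable \<mu> (indicator (\<Union>i. A i) :: _ \<Rightarrow> real)" using A by (intro intU) auto
        show "good (s n)" for n
        proof (induction n)
          case 0 then show ?case by (auto simp: good_def s_def convergent_const)
        next
          case (Suc n)
          have "s (Suc n) = (\<lambda>x. s n x + indicator (A n) x)" by (simp add: s_def)
          then show ?case using good_add[OF Suc union(3)[of n]] by simp
        qed
        have "(\<lambda>n. \<integral>x. \<bar>indicator (\<Union>i. A i) x - s n x\<bar> \<partial>\<mu>) \<longlonglongrightarrow> (\<integral>x. 0 \<partial>\<mu>)"
        proof (rule bounded_borel_DCT[OF \<mu>, where C=1])
          show "(\<lambda>x. \<bar>indicator (\<Union>i. A i) x - s n x\<bar>) \<in> bounded_borel" for n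
            unfolding s using A by (intro bounded_borel_intros) auto
          show "\<bar>\<bar>indicator (\<Union>i. A i) x - s n x\<bar>\<bar> \<le> 1" for n x
            unfolding s by (auto split: split_indicator)
          show "AE x in \<mu>. (\<lambda>n. \<bar>indicator (\<Union>i. A i) x - s n x\<bar>) \<longlonglongrightarrow> 0"
          proof (intro AE_I2 tendsto_rabs_zero)
            fix x
            show "(\<lambda>n. indicator (\<Union>i. A i) x - s n x) \<longlonglongrightarrow> 0"
            proof (cases "x \<in> (\<Union>i. A i)")
              case True
              then obtain i where "x \<in> A i" by auto
              then show ?thesis unfolding s
                by (intro tendsto_eventually eventually_sequentiallyI[of "Suc i"]) (auto simp: indicator_def)
            next
              case False
              then show ?thesis unfolding s by (auto simp: indicator_def)
            qed
          qed
        qed auto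
        then show "(\<lambda>n. \<integral>x. \<bar>indicator (\<Union>i. A i) x - s n x\<bar> \<partial>\<mu>) \<longlonglongrightarrow> 0" by simp
      qed
    qed
  qed
  have "good \<phi>" if "integrable \<mu> \<phi>" for \<phi>
    using that
  proof (induction rule: integrable_induct)
    case (base A c)
    then have "A \<in> sets borel" using fin by auto
    then show ?case using good_cmult[OF good_ind, of A c] by (simp add: mult.commute)
  next
    case (add f g) then show ?case by (intro good_add)
  next
    case (lim f s)
    show ?case
    proof (rule good_lim[OF lim(4) lim(5)])
      have "(\<lambda>i. \<integral>x. \<bar>f x - s i x\<bar> \<partial>\<mu>) \<longlonglongrightarrow> (\<integral>x. 0 \<partial>\<mu>)"
      \<comment> \<open>The approximating simple functions are bounded by
        \<open>2 * \<bar>f x\<bar>\<close>, which gives the factor 3 for the difference.\<close>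
      proof (rule integral_dominated_convergence[where w="\<lambda>x. 3 * \<bar>f x\<bar>"])
        show "integrable \<mu> (\<lambda>x. 3 * \<bar>f x\<bar>)" using lim(4) by auto
        show "AE x in \<mu>. (\<lambda>i. \<bar>f x - s i x\<bar>) \<longlonglongrightarrow> 0"
        proof (intro AE_I2 tendsto_rabs_zero)
          fix x assume "x \<in> space \<mu>"
          from tendsto_diff[OF tendsto_const lim(2)[OF this], of "f x"]
          show "(\<lambda>i. f x - s i x) \<longlonglongrightarrow> 0" by simp
        qed
        show "AE x in \<mu>. norm \<bar>f x - s i x\<bar> \<le> 3 * \<bar>f x\<bar>" for i
        proof (rule AE_I2)
          fix x assume "x \<in> space \<mu>"
          then show "norm \<bar>f x - s i x\<bar> \<le> 3 * \<bar>f x\<bar>" using lim(3)[of x i] by auto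
        qed
      qed (use lim(1,4) in auto)
      then show "(\<lambda>i. \<integral>x. \<bar>f x - s i x\<bar> \<partial>\<mu>) \<longlonglongrightarrow> 0" by simp
    qed
  qed
  then show ?thesis using r by (auto simp: good_def)
qed


text \<open>The envelope \<open>h n = (SUP m\<in>{n..}. \<bar>G m - g\<bar>)\<close> converts
  pointwise convergence into domination by a decreasing sequence, the form required by Daniell
  continuity and by Dini-type arguments.\<close>

lemma tail_supremum:
  assumes G: "\<And>n::nat. G n \<in> bounded_borel" "\<And>n x. \<bar>G n x\<bar> \<le> C" and lim: "\<And>x. (\<lambda>n. G n x) \<longlonglongrightarrow> g x"
  shows "\<exists>h. (\<forall>n. h n \<in> bounded_borel) \<and> (\<forall>m n x. n \<le> m \<longrightarrow> \<bar>G m x - g x\<bar> \<le> h n x) \<and>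
    (\<forall>n x. \<bar>h n x\<bar> \<le> 2 * C) \<and> (\<forall>x. decseq (\<lambda>n. h n x)) \<and> (\<forall>x. (\<lambda>n. h n x) \<longlonglongrightarrow> 0)"
proof -
  have g: "g \<in> bounded_borel" "\<And>x. \<bar>g x\<bar> \<le> C" using bounded_borel_LIMSEQ[OF G lim] by auto
  define h where "h n x = (SUP m\<in>{n..}. \<bar>G m x - g x\<bar>)" for n x
  have le: "\<bar>G m x - g x\<bar> \<le> 2 * C" for m x using G(2)[of m x] g(2)[of x] by linarith
  have bdd: "bdd_above ((\<lambda>m. \<bar>G m x - g x\<bar>) ` I)" for I x using le by (auto intro!: bdd_aboveI)
  have up: "\<bar>G m x - g x\<bar> \<le> h n x" if "m \<ge> n" for m n x
    unfolding h_def by (rule cSUP_upper[OF _ bdd]) (use that in auto)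
  have h0: "0 \<le> h n x" for n x using up[of n n x] by linarith
  have h2: "h n x \<le> 2 * C" for n x unfolding h_def by (rule cSUP_least) (use le in auto)
  have h: "h n \<in> bounded_borel" for n
  proof (rule bounded_borelI)
    show "h n \<in> borel_measurable borel"
      unfolding h_def using bdd G(1) g(1) by (intro borel_measurable_cSUP) auto
    show "\<bar>h n x\<bar> \<le> 2 * C" for x using h0[of n x] h2[of n x] by simp
  qed
  have hdec: "h n x \<le> h m x" if "m \<le> n" for m n x
    unfolding h_def by (rule cSUP_subset_mono) (use that bdd in auto)
  have hlim: "(\<lambda>n. h n x) \<longlonglongrightarrow> 0" for x
  proof (rule LIMSEQ_I)
    fix e :: real assume "e > 0"
    then have "e / 2 > 0" by simp
    then obtain N where N: "\<And>m. m \<ge> N \<Longrightarrow> \<bar>G m x - g x\<bar> < e / 2"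
      using LIMSEQ_D[OF lim[of x]] by (metis real_norm_def)
    have "h n x \<le> e / 2" if "n \<ge> N" for n
      unfolding h_def by (rule cSUP_least) (use N that in \<open>auto intro: less_imp_le\<close>)
    then show "\<exists>N. \<forall>n\<ge>N. norm (h n x - 0) < e" using h0 \<open>e > 0\<close>
      by (intro exI[of _ N]) (smt (verit) field_sum_of_halves real_norm_def)
  qed
  have "decseq (\<lambda>n. h n x)" for x using hdec by (auto simp: decseq_def)
  moreover have "\<bar>h n x\<bar> \<le> 2 * C" for n x using h0[of n x] h2[of n x] by simp
  ultimately show ?thesis using h up hlim by blast
qed

section \<open>Compactness and domination from the strong Feller property\<close>

locale strong_feller_semigroup = kernel_semigroup K M
  for K :: "real \<Rightarrow> 'a::polish_space \<Rightarrow> 'a measure" and M :: real +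
  fixes t0 :: real
  assumes t0_pos: "t0 > 0"
    and feller: "f \<in> bounded_borel \<Longrightarrow> continuous_on UNIV (P t0 f)"
begin

lemma continuous_P:
  assumes "t \<ge> t0" "f \<in> bounded_borel" shows "continuous_on UNIV (P t f)"
proof (cases "t = t0")
  case False
  then have "P t f = P t0 (P (t - t0) f)" using P_semigroup[of "t - t0" t0 f] assms t0_pos by simp
  then show ?thesis using feller[OF P_bounded_borel[of "t - t0" f]] assms False by simp
qed (use feller assms in simp)

text \<open>Mix the kernels at the points of a countable dense set. If the mixture does not charge
  \<open>A\<close>, the continuous function \<open>P t0 (indicator A)\<close> vanishes on that set
  and hence everywhere.\<close>

lemma dominating_measure:
  obtains \<mu> where "finite_borel \<mu>" "\<And>A x. A \<in> sets borel \<Longrightarrow> measure \<mu> A = 0 \<Longrightarrow> measure (K t0 x) A = 0"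
proof -
  obtain D :: "'a set" where D: "countable D" "\<And>X. open X \<Longrightarrow> X \<noteq> {} \<Longrightarrow> \<exists>d\<in>D. d \<in> X"
    using countable_dense_setE by blast
  have "D \<noteq> {}" using D(2)[of UNIV] by auto
  define d where "d = from_nat_into D"
  have d: "range d = D" unfolding d_def by (rule range_from_nat_into[OF \<open>D \<noteq> {}\<close> D(1)])
  obtain \<mu> and c :: "nat \<Rightarrow> real" where \<mu>: "finite_borel \<mu>" and c: "\<And>i. c i > 0"
    and sums: "\<And>f. f \<in> bounded_borel \<Longrightarrow> (\<lambda>i. c i * integral\<^sup>L (K t0 (d i)) f) sums integral\<^sup>L \<mu> f"
    using countable_mixture[of "\<lambda>i. K t0 (d i)"] finite_K[OF t0_pos] by blast
  have "measure (K t0 x) A = 0" if A: "A \<in> sets borel" "measure \<mu> A = 0" for A x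
  proof -
    let ?g = "P t0 (indicator A)"
    have g: "?g y = measure (K t0 y) A" for y by (rule P_indicator[OF t0_pos A(1)])
    have "(\<lambda>i. c i * ?g (d i)) sums 0"
      using sums[of "indicator A"] A finite_borelD[OF \<mu>] by (simp add: P_def)
    then have "c i * ?g (d i) = 0" for i
      using sums_unique2[of "\<lambda>i. c i * ?g (d i)" 0] suminf_eq_zero_iff[of "\<lambda>i. c i * ?g (d i)"] c g
      by (auto simp: sums_iff less_imp_le)
    then have zero: "?g (d i) = 0" for i using c[of i] by (metis less_irrefl mult_eq_0_iff)
    have cont: "continuous_on UNIV ?g" using A feller by auto
    have "open {y. ?g y \<noteq> 0}" by (intro open_Collect_neq cont continuous_on_const)
    then have "{y. ?g y \<noteq> 0} = {}"
      using D(2)[of "{y. ?g y \<noteq> 0}"] d zero by (metis (mono_tags, lifting) mem_Collect_eq rangeE)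
    then show ?thesis using g[of x] by auto
  qed
  with \<mu> show thesis by (rule that)
qed

text \<open>Every \<open>K t0 x\<close> has a density in L1 with respect to the dominating measure,
  so a single weak-star convergent subsequence yields convergence at all points
  \<open>x\<close>.\<close>

lemma pointwise_compact:
  assumes F: "\<And>n::nat. F n \<in> bounded_borel" "\<And>n x. \<bar>F n x\<bar> \<le> C"
  shows "\<exists>r g. strict_mono r \<and> g \<in> bounded_borel \<and> (\<forall>x. (\<lambda>n. P t0 (F (r n)) x) \<longlonglongrightarrow> g x)"
proof -
  obtain \<mu> where \<mu>: "finite_borel \<mu>" and ac: "\<And>A x. A \<in> sets borel \<Longrightarrow> measure \<mu> A = 0 \<Longrightarrow> measure (K t0 x) A = 0"
    using dominating_measure by blast
  obtain r :: "nat \<Rightarrow> nat" where r: "strict_mono r"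
    and conv: "\<forall>\<phi>. integrable \<mu> \<phi> \<longrightarrow> convergent (\<lambda>n. \<integral>x. \<phi> x * F (r n) x \<partial>\<mu>)"
    using weak_star_compact[where F=F and C=C, OF \<mu> F] by (elim exE conjE) (rule that)
  have "convergent (\<lambda>n. P t0 (F (r n)) x)" for x
  proof -
    obtain D where D: "integrable \<mu> D" "\<And>f. f \<in> bounded_borel \<Longrightarrow> integral\<^sup>L (K t0 x) f = (\<integral>y. D y * f y \<partial>\<mu>)"
      using absolutely_continuous_density[OF \<mu> finite_K[OF t0_pos] ac] by metis
    show ?thesis unfolding P_def D(2)[OF F(1)] by (rule conv[rule_format, OF D(1)])
  qed
  then obtain g where g: "\<And>x. (\<lambda>n. P t0 (F (r n)) x) \<longlonglongrightarrow> g x" unfolding convergent_def by metis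
  have "g \<in> bounded_borel"
    by (rule bounded_borel_LIMSEQ(1)[OF _ _ g, where C="M * C"]) (use F t0_pos P_bound in auto)
  with r g show ?thesis by blast
qed

text \<open>A variant of Dini's theorem: the open sets where \<open>P t0 (h n)\<close> is below
  \<open>e\<close> cover the compact set, and on each of them \<open>h n\<close> dominates all later
  differences \<open>G m - g\<close>.\<close>

lemma P_uniform_limit:
  assumes G: "\<And>n. G n \<in> bounded_borel" "\<And>n x. \<bar>G n x\<bar> \<le> C" and lim: "\<And>x. (\<lambda>n. G n x) \<longlonglongrightarrow> g x"
    and X: "compact X"
  shows "uniform_limit X (\<lambda>n. P t0 (G n)) (P t0 g) sequentially"
proof -
  have g: "g \<in> bounded_borel" using bounded_borel_LIMSEQ[OF G lim] by auto
  obtain h where h: "\<And>n. h n \<in> bounded_borel" and up: "\<And>m n x. n \<le> m \<Longrightarrow> \<bar>G m x - g x\<bar> \<le> h n x"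
    and h2: "\<And>n x. \<bar>h n x\<bar> \<le> 2 * C" and hlim: "\<And>x. (\<lambda>n. h n x) \<longlonglongrightarrow> 0"
    using tail_supremum[OF G lim] by blast
  have Ph: "(\<lambda>n. P t0 (h n) x) \<longlonglongrightarrow> 0" for x
    using P_DCT[OF t0_pos h, where C="2 * C" and f="\<lambda>_. 0" and x=x] h2 hlim by (simp add: P_def)
  show ?thesis
    unfolding uniform_limit_sequentially_iff
  proof (intro allI impI)
    fix e :: real assume e: "e > 0"
    have "open {x. P t0 (h n) x < e}" for n by (intro open_Collect_less feller h continuous_on_const)
    moreover have "X \<subseteq> (\<Union>n. {x. P t0 (h n) x < e})"
    proof
      fix x
      obtain n where "P t0 (h n) x < e" using order_tendstoD(2)[OF Ph e, of x] by (auto simp: eventually_sequentially)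
      then show "x \<in> (\<Union>n. {x. P t0 (h n) x < e})" by auto
    qed
    ultimately obtain I where I: "finite I" "X \<subseteq> (\<Union>n\<in>I. {x. P t0 (h n) x < e})"
      using compactE_image[OF X, of UNIV] by metis
    \<comment> \<open>The inserted 0 keeps the maximum meaningful when the subcover is
      empty.\<close>
    define N where "N = Max (insert 0 I)"
    show "\<exists>N. \<forall>n\<ge>N. \<forall>x\<in>X. dist (P t0 (G n) x) (P t0 g x) < e"
    proof (intro exI[of _ N] allI impI ballI)
      fix n x assume "n \<ge> N" "x \<in> X"
      then obtain m where m: "m \<in> I" "P t0 (h m) x < e" using I by auto
      then have "m \<le> n" using I \<open>n \<ge> N\<close> by (auto simp: N_def)
      have "\<bar>P t0 (G n) x - P t0 g x\<bar> = \<bar>P t0 (\<lambda>x. G n x - g x) x\<bar>" using P_diff[OF t0_pos G(1) g(1)] by simp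
      also have "\<dots> \<le> P t0 (\<lambda>x. \<bar>G n x - g x\<bar>) x" by (rule P_abs)
      also have "\<dots> \<le> P t0 (h m) x"
        by (intro P_mono t0_pos h up \<open>m \<le> n\<close> bounded_borel_intros G g)
      finally show "dist (P t0 (G n) x) (P t0 g x) < e" using m by (simp add: dist_real_def)
    qed
  qed
qed

text \<open>The fixed function arises from the upper limit \<open>v\<close> of \<open>P t f\<close>, which satisfies \<open>v \<le> P s v\<close>.
  Suprema over uncountably many times are measurable since they are lower semicontinuous.\<close>

lemma dominating_fixed_function:
  assumes f: "f \<in> bounded_borel" and f0: "\<And>x. 0 \<le> f x"
  obtains g where "g \<in> bounded_borel" "\<And>x. 0 \<le> g x" "\<And>t. t > 0 \<Longrightarrow> P t g = g"
    "\<And>x e. e > 0 \<Longrightarrow> \<forall>\<^sub>F t in at_top. P t f x < g x + e"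
    "\<And>\<omega>. invariant \<omega> \<Longrightarrow> integral\<^sup>L \<omega> f = 0 \<Longrightarrow> integral\<^sup>L \<omega> g = 0"
proof -
  obtain C where C: "\<And>x. \<bar>f x\<bar> \<le> C" using f by (metis bounded_borelE)
  have Pf0: "0 \<le> P t f x" if "t > 0" for t x by (rule P_nonneg[OF that f f0])
  have PfC: "P t f x \<le> M * C" if "t > 0" for t x using P_bound[OF that f C, of x] by linarith
  define I where "I n = {t0 + real n<..}" for n
  have I: "t > 0" "t \<ge> t0" if "t \<in> I n" for t n using that t0_pos by (auto simp: I_def)
  have I_ne: "I n \<noteq> {}" for n by (simp add: I_def)
  define u where "u n x = (SUP t\<in>I n. P t f x)" for n x
  have bdd: "bdd_above ((\<lambda>t. P t f x) ` I n)" for n x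
    by (rule bdd_aboveI[of _ "M * C"]) (use PfC I in auto)
  have up: "P t f x \<le> u n x" if "t \<in> I n" for t n x
    unfolding u_def by (rule cSUP_upper[OF that bdd])
  have u0: "0 \<le> u n x" for n x
  proof -
    obtain t where "t \<in> I n" using I_ne by blast
    then show ?thesis using up Pf0 I order_trans by metis
  qed
  have uC: "u n x \<le> M * C" for n x unfolding u_def by (rule cSUP_least[OF I_ne]) (use PfC I in auto)
  have level: "{x. a < u n x} = (\<Union>t\<in>I n. {x. a < P t f x})" for a n
    unfolding u_def using less_cSUP_iff[OF I_ne bdd] by auto
  have open_level: "open {x. a < P t f x}" if "t \<in> I n" for a t n
    by (intro open_Collect_less continuous_on_const continuous_P f I[OF that])
  have u: "u n \<in> bounded_borel" for n
  proof (rule bounded_borelI)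
    show "u n \<in> borel_measurable borel"
    proof (rule borel_measurableI_greater)
      fix a
      have "open {x. a < u n x}" unfolding level by (intro open_UN ballI open_level)
      then show "{x \<in> space borel. a < u n x} \<in> sets borel" by simp
    qed
    show "\<bar>u n x\<bar> \<le> M * C" for x using u0[of n x] uC[of n x] by simp
  qed
  have u_dec: "u n x \<le> u m x" if "m \<le> n" for m n x
    unfolding u_def by (rule cSUP_subset_mono[OF I_ne bdd]) (use that in \<open>auto simp: I_def\<close>)
  define v where "v x = (INF n. u n x)" for x
  have bdb: "bdd_below (range (\<lambda>n. u n x))" for x by (rule bdd_belowI[of _ 0]) (use u0 in auto)
  have vlim: "(\<lambda>n. u n x) \<longlonglongrightarrow> v x" for x
    unfolding v_def by (rule LIMSEQ_decseq_INF[OF bdb]) (use u_dec in \<open>auto simp: decseq_def\<close>)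
  have v: "v \<in> bounded_borel" "\<And>x. \<bar>v x\<bar> \<le> M * C"
  proof -
    have "\<bar>u n x\<bar> \<le> M * C" for n x using u0[of n x] uC[of n x] by simp
    from bounded_borel_LIMSEQ[OF u this vlim] show "v \<in> bounded_borel" "\<And>x. \<bar>v x\<bar> \<le> M * C" by auto
  qed
  have v0: "0 \<le> v x" for x by (rule LIMSEQ_le_const[OF vlim]) (use u0 in auto)
  have v_le: "v x \<le> u n x" for n x unfolding v_def by (rule cINF_lower[OF bdb]) auto
  have sub: "v x \<le> P s v x" if s: "s > 0" for s x
  proof (rule LIMSEQ_le_const)
    show "(\<lambda>n. P s (u n) x) \<longlonglongrightarrow> P s v x"
      using u0 uC by (intro P_DCT[OF s u _ vlim, of "M * C"]) auto
    show "\<exists>N. \<forall>n\<ge>N. v x \<le> P s (u n) x"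
    proof (intro exI[of _ 0] allI impI)
      fix n
      \<comment> \<open>Raising the index by \<open>nat \<lceil>s\<rceil>\<close> leaves room for
        the time \<open>s\<close>: if \<open>t \<in> I m\<close>, then
        \<open>t - s \<in> I n\<close>.\<close>
      define m where "m = n + nat \<lceil>s\<rceil>"
      have m: "real n + s \<le> real m" using s by (simp add: m_def)
      have "u m x \<le> P s (u n) x"
        unfolding u_def[of m]
      proof (rule cSUP_least[OF I_ne])
        fix t assume "t \<in> I m"
        then have t: "t - s \<in> I n" using m by (auto simp: I_def)
        have "P t f x = P s (P (t - s) f) x" using P_semigroup[of "t - s" s f] f s I[OF t] by simp
        also have "\<dots> \<le> P s (u n) x" using s I[OF t] f by (intro P_mono u up t) auto
        finally show "P t f x \<le> P s (u n) x" .
      qed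
      then show "v x \<le> P s (u n) x" using v_le[of x m] by simp
    qed
  qed
  have P_mono_time: "P s v x \<le> P t v x" if "0 < s" "s \<le> t" for s t x
  proof (cases "s = t")
    case False
    have "P s v x \<le> P s (P (t - s) v) x" using that False by (intro P_mono v sub P_bounded_borel) auto
    also have "\<dots> = P t v x" using P_semigroup[of "t - s" s v] that False v by simp
    finally show ?thesis .
  qed simp
  have PvC: "\<bar>P t v x\<bar> \<le> M * (M * C)" if "t > 0" for t x by (rule P_bound[OF that v])
  have "convergent (\<lambda>n. P (real (Suc n)) v x)" for x
    by (rule Bseq_mono_convergent) (use PvC P_mono_time in \<open>auto intro!: BseqI'[of _ "M * (M * C)"]\<close>)
  then obtain g where g: "\<And>x. (\<lambda>n. P (real (Suc n)) v x) \<longlonglongrightarrow> g x" unfolding convergent_def by metis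
  have Pv_bb: "P (real (Suc n)) v \<in> bounded_borel" for n using v by auto
  have g_bb: "g \<in> bounded_borel" by (rule bounded_borel_LIMSEQ(1)[OF Pv_bb PvC g]) simp
  have P_le_g: "P t v x \<le> g x" if "t > 0" for t x
  proof (rule LIMSEQ_le_const[OF g])
    show "\<exists>N. \<forall>n\<ge>N. P t v x \<le> P (real (Suc n)) v x"
      by (rule exI[of _ "nat \<lceil>t\<rceil>"]) (use that in \<open>auto intro!: P_mono_time\<close>)
  qed
  have v_le_g: "v x \<le> g x" for x using sub[of 1 x] P_le_g[of 1 x] by simp
  have fixed: "P s g = g" if s: "s > 0" for s
  proof
    fix x
    have "(\<lambda>n. P s (P (real (Suc n)) v) x) \<longlonglongrightarrow> P s g x"
      by (rule P_DCT[OF s Pv_bb _ g, of "M * (M * C)"]) (use PvC in auto)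
    moreover have "(\<lambda>n. P s (P (real (Suc n)) v) x) \<longlonglongrightarrow> g x"
    proof (rule tendsto_sandwich[OF _ _ g tendsto_const])
      have eq: "P s (P (real (Suc n)) v) = P (s + real (Suc n)) v" for n
        using P_semigroup[of "real (Suc n)" s v] s v by simp
      show "\<forall>\<^sub>F n in sequentially. P (real (Suc n)) v x \<le> P s (P (real (Suc n)) v) x"
        unfolding eq using s by (intro always_eventually allI P_mono_time) auto
      show "\<forall>\<^sub>F n in sequentially. P s (P (real (Suc n)) v) x \<le> g x"
        unfolding eq using s by (intro always_eventually allI P_le_g) auto
    qed
    ultimately show "P s g x = g x" by (rule LIMSEQ_unique)
  qed
  have ev: "\<forall>\<^sub>F t in at_top. P t f x < g x + e" if e: "e > 0" for e x
  proof -
    obtain n where n: "u n x < v x + e"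
      using order_tendstoD(2)[OF vlim, of x "v x + e"] e by (auto simp: eventually_sequentially)
    show ?thesis using eventually_gt_at_top[of "t0 + real n"]
    proof eventually_elim
      case (elim t)
      then have "P t f x \<le> u n x" by (intro up) (auto simp: I_def)
      then show ?case using n v_le_g[of x] by simp
    qed
  qed
  have null: "integral\<^sup>L \<omega> g = 0" if \<omega>: "invariant \<omega>" and zero: "integral\<^sup>L \<omega> f = 0" for \<omega>
  proof -
    note fin = finite_borelD[OF invariantD(1)[OF \<omega>]]
    note int = integrable_bounded_borel[OF invariantD(1)[OF \<omega>]]
    have null1: "{x. 0 < P t f x} \<in> null_sets \<omega>" if t: "t \<in> I 0" for t
    proof -
      have "integral\<^sup>L \<omega> (P t f) = 0" using invariantD(2)[OF \<omega> I(1)[OF t] f] zero by simp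
      then have "AE x in \<omega>. P t f x = 0"
        using f I(1)[OF t] Pf0 by (subst (asm) integral_nonneg_eq_0_iff_AE) (auto intro!: int)
      then have "AE x in \<omega>. x \<notin> {x. 0 < P t f x}" by eventually_elim auto
      then show ?thesis using open_level[OF t, of 0] fin by (subst (asm) AE_iff_null_sets[symmetric]) auto
    qed
    \<comment> \<open>Each \<open>P t f\<close> vanishes almost everywhere, but uncountably many
      times are involved. The sets of positivity are open, so countably many of them have the same
      union.\<close>
    obtain \<F> where \<F>: "\<F> \<subseteq> (\<lambda>t. {x. 0 < P t f x}) ` I 0" "countable \<F>" "\<Union>\<F> = \<Union>((\<lambda>t. {x. 0 < P t f x}) ` I 0)"
    proof (rule Lindelof[of "(\<lambda>t. {x. 0 < P t f x}) ` I 0"])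
      show "open S" if "S \<in> (\<lambda>t. {x. 0 < P t f x}) ` I 0" for S using that open_level by auto
    qed
    have "\<Union>\<F> \<in> null_sets \<omega>"
      using null_sets_UN'[OF \<F>(2), of id] \<F>(1) null1 by auto
    then have "{x. 0 < u 0 x} \<in> null_sets \<omega>" using \<F>(3) level[of 0 0] by simp
    then have "AE x in \<omega>. x \<notin> {x. 0 < u 0 x}" by (rule AE_not_in)
    then have "AE x in \<omega>. v x = 0"
    proof eventually_elim
      case (elim x) then show ?case using v_le[of x 0] v0[of x] by auto
    qed
    then have "integral\<^sup>L \<omega> v = 0"
      using v fin by (subst integral_nonneg_eq_0_iff_AE) (auto intro!: int v0)
    then have zero_n: "integral\<^sup>L \<omega> (P (real (Suc n)) v) = 0" for n
      using invariantD(2)[OF \<omega>, of "real (Suc n)" v] v by simp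
    have "(\<lambda>n. integral\<^sup>L \<omega> (P (real (Suc n)) v)) \<longlonglongrightarrow> integral\<^sup>L \<omega> g"
      by (rule bounded_borel_DCT[OF invariantD(1)[OF \<omega>] Pv_bb _ _ g_bb, where C="M * (M * C)"]) (use PvC g in auto)
    then show ?thesis unfolding zero_n using LIMSEQ_unique tendsto_const by blast
  qed
  show thesis
  proof (rule that[OF g_bb _ fixed ev null])
    show "0 \<le> g x" for x using v0[of x] v_le_g[of x] by simp
  qed
qed

end

section \<open>Convergence from the separation of fixed functions\<close>

text \<open>Cauchy criterion in a form where the approximating constant may change with
  \<open>e\<close>; it will be \<open>P s b x\<close> with a time \<open>s\<close> depending on
  \<open>e\<close>.\<close>

lemma tendsto_if_approximable:
  fixes \<phi> :: "real \<Rightarrow> real"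
  assumes "\<And>e. e > 0 \<Longrightarrow> \<exists>c. \<forall>\<^sub>F t in at_top. \<bar>\<phi> t - c\<bar> < e"
  shows "\<exists>l. (\<phi> \<longlongrightarrow> l) at_top"
proof -
  have osc: "\<exists>T. \<forall>s\<ge>T. \<forall>t\<ge>T. \<bar>\<phi> s - \<phi> t\<bar> < e" if "e > 0" for e
  proof -
    obtain c T where "\<And>t. t \<ge> T \<Longrightarrow> \<bar>\<phi> t - c\<bar> < e / 2"
      using assms[of "e / 2"] \<open>e > 0\<close> by (auto simp: eventually_at_top_linorder)
    then show ?thesis by (intro exI[of _ T]) (smt (verit) field_sum_of_halves)
  qed
  have "Cauchy (\<lambda>n. \<phi> (real n))"
  proof (rule metric_CauchyI)
    fix e :: real assume "e > 0"
    then obtain T where T: "\<And>s t. s \<ge> T \<Longrightarrow> t \<ge> T \<Longrightarrow> \<bar>\<phi> s - \<phi> t\<bar> < e" using osc by blast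
    have "T \<le> real m" if "nat \<lceil>T\<rceil> \<le> m" for m using that by linarith
    then show "\<exists>N. \<forall>m\<ge>N. \<forall>n\<ge>N. dist (\<phi> (real m)) (\<phi> (real n)) < e"
      using T unfolding dist_real_def by blast
  qed
  then obtain l where l: "(\<lambda>n. \<phi> (real n)) \<longlonglongrightarrow> l" by (auto simp: Cauchy_convergent_iff convergent_def)
  have "(\<phi> \<longlongrightarrow> l) at_top"
    unfolding tendsto_iff dist_real_def
  proof (intro allI impI)
    fix e :: real assume e: "e > 0"
    then obtain T where T: "\<And>s t. s \<ge> T \<Longrightarrow> t \<ge> T \<Longrightarrow> \<bar>\<phi> s - \<phi> t\<bar> < e / 2" using osc[of "e / 2"] by auto
    have "\<forall>\<^sub>F n in sequentially. \<bar>\<phi> (real n) - l\<bar> < e / 2 \<and> real n \<ge> T"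
      using l e unfolding tendsto_iff dist_real_def
      by (intro eventually_conj filterlim_real_sequentially[unfolded filterlim_at_top, rule_format]) (metis half_gt_zero)
    then obtain n where n: "\<bar>\<phi> (real n) - l\<bar> < e / 2" "real n \<ge> T" by (auto dest: eventually_happens)
    show "\<forall>\<^sub>F t in at_top. \<bar>\<phi> t - l\<bar> < e"
      using eventually_ge_at_top[of T] by eventually_elim (use T[OF _ n(2)] n(1) in \<open>smt (verit) field_sum_of_halves\<close>)
  qed
  then show ?thesis ..
qed

text \<open>Exhaustion: the union of a maximizing sequence attains the supremum.\<close>

lemma maximal_measure_set:
  assumes "finite_measure \<mu>" and N: "\<N> \<subseteq> sets \<mu>" "\<N> \<noteq> {}"
    and UN: "\<And>A. (\<And>n::nat. A n \<in> \<N>) \<Longrightarrow> (\<Union>n. A n) \<in> \<N>"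
  obtains A where "A \<in> \<N>" "\<And>B. B \<in> \<N> \<Longrightarrow> measure \<mu> B \<le> measure \<mu> A"
proof -
  interpret finite_measure \<mu> by fact
  define S where "S = measure \<mu> ` \<N>"
  have S: "S \<noteq> {}" "bdd_above S" using N bounded_measure by (auto simp: S_def intro!: bdd_aboveI[of _ "measure \<mu> (space \<mu>)"])
  have "\<exists>A\<in>\<N>. Sup S - 1 / real (Suc n) < measure \<mu> A" for n
  proof -
    have "Sup S - 1 / real (Suc n) < Sup S" by simp
    then show ?thesis using less_cSupD[OF S(1)] unfolding S_def by blast
  qed
  then obtain A where A: "\<And>n. A n \<in> \<N>" "\<And>n. Sup S - 1 / real (Suc n) < measure \<mu> (A n)" by metis
  have "Sup S \<le> measure \<mu> (\<Union>n. A n)"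
  proof (rule field_le_epsilon)
    fix e :: real assume "e > 0"
    then obtain n where "1 / real (Suc n) < e" using nat_approx_posE by blast
    moreover have "measure \<mu> (A n) \<le> measure \<mu> (\<Union>n. A n)"
      by (rule finite_measure_mono) (use UN[of A, OF A(1)] N in auto)
    ultimately show "Sup S \<le> measure \<mu> (\<Union>n. A n) + e" using A(2)[of n] by simp
  qed
  moreover have "measure \<mu> B \<le> Sup S" if "B \<in> \<N>" for B
    using that S by (intro cSup_upper) (auto simp: S_def)
  ultimately show thesis using UN[of A, OF A(1)] by (intro that) (auto intro: order_trans)
qed

text \<open>Truncation of the density: \<open>D \<le> n + max 0 (D - n)\<close>. The bounded part is
  controlled by the L1 convergence, the excess by \<open>C\<close> times its small integral;
  \<open>C + 1\<close> and \<open>n + 1\<close> serve to avoid division by 0.\<close>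

lemma absolutely_continuous_L1_tendsto:
  assumes \<omega>: "finite_borel \<omega>" and \<nu>: "finite_borel \<nu>"
    and ac: "\<And>A. A \<in> sets borel \<Longrightarrow> measure \<omega> A = 0 \<Longrightarrow> measure \<nu> A = 0"
    and u: "\<forall>\<^sub>F t in F. u t \<in> bounded_borel \<and> (\<forall>x. \<bar>u t x\<bar> \<le> C)"
    and lim: "((\<lambda>t. \<integral>x. \<bar>u t x\<bar> \<partial>\<omega>) \<longlongrightarrow> 0) F" and e: "e > 0"
  shows "\<forall>\<^sub>F t in F. (\<integral>x. \<bar>u t x\<bar> \<partial>\<nu>) < e"
proof (cases "F = bot")
  case False
  have "\<exists>t. \<forall>x. \<bar>u t x\<bar> \<le> C" using eventually_happens'[OF False u] by auto
  then have C: "C \<ge> 0" by (metis abs_ge_zero order_trans)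
  obtain D where D: "integrable \<omega> D" "\<And>x. 0 \<le> D x"
    and dens: "\<And>f. f \<in> bounded_borel \<Longrightarrow> integral\<^sup>L \<nu> f = (\<integral>x. D x * f x \<partial>\<omega>)"
    using absolutely_continuous_density[OF \<omega> \<nu> ac] by metis
  have meas: "D \<in> borel_measurable \<omega>" using D(1) by auto
  have excess: "integrable \<omega> (\<lambda>x. max 0 (D x - c))" if "c \<ge> 0" for c
    by (rule Bochner_Integration.integrable_bound[OF D(1)]) (use D(2) meas that in auto)
  have "(\<lambda>n. \<integral>x. max 0 (D x - real n) \<partial>\<omega>) \<longlonglongrightarrow> (\<integral>x. 0 \<partial>\<omega>)"
  proof (rule integral_dominated_convergence[where w=D])
    show "AE x in \<omega>. (\<lambda>n. max 0 (D x - real n)) \<longlonglongrightarrow> 0"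
    proof (rule AE_I2)
      fix x
      show "(\<lambda>n. max 0 (D x - real n)) \<longlonglongrightarrow> 0"
        by (rule tendsto_eventually, rule eventually_sequentiallyI[of "nat \<lceil>D x\<rceil>"]) linarith
    qed
  qed (use D meas in auto)
  then have "\<forall>\<^sub>F n in sequentially. (\<integral>x. max 0 (D x - real n) \<partial>\<omega>) < e / (2 * (C + 1))"
    by (rule order_tendstoD) (use e C in auto)
  then obtain n where n: "(\<integral>x. max 0 (D x - real n) \<partial>\<omega>) < e / (2 * (C + 1))" by (auto simp: eventually_sequentially)
  have "\<forall>\<^sub>F t in F. (\<integral>x. \<bar>u t x\<bar> \<partial>\<omega>) < e / (2 * (real n + 1))"
    by (rule order_tendstoD[OF lim]) (use e in auto)
  then show ?thesis using u
  proof eventually_elim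
    case (elim t)
    have ut: "(\<lambda>x. \<bar>u t x\<bar>) \<in> bounded_borel" using elim by auto
    have int1: "integrable \<omega> (\<lambda>x. real n * \<bar>u t x\<bar>)" "integrable \<omega> (\<lambda>x. C * max 0 (D x - real n))"
      using integrable_bounded_borel[OF \<omega> ut] excess[of "real n"] by auto
    have "(\<integral>x. \<bar>u t x\<bar> \<partial>\<nu>) = (\<integral>x. D x * \<bar>u t x\<bar> \<partial>\<omega>)" by (rule dens[OF ut])
    also have "\<dots> \<le> (\<integral>x. real n * \<bar>u t x\<bar> + C * max 0 (D x - real n) \<partial>\<omega>)"
    proof (rule integral_mono')
      show "integrable \<omega> (\<lambda>x. real n * \<bar>u t x\<bar> + C * max 0 (D x - real n))" using int1 by auto
      fix x
      have "D x * \<bar>u t x\<bar> \<le> (real n + max 0 (D x - real n)) * \<bar>u t x\<bar>" by (intro mult_right_mono) auto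
      also have "\<dots> = real n * \<bar>u t x\<bar> + max 0 (D x - real n) * \<bar>u t x\<bar>" by (rule distrib_right)
      also have "max 0 (D x - real n) * \<bar>u t x\<bar> \<le> max 0 (D x - real n) * C"
        using elim by (intro mult_left_mono) auto
      finally show "D x * \<bar>u t x\<bar> \<le> real n * \<bar>u t x\<bar> + C * max 0 (D x - real n)" by (simp add: mult.commute)
      show "0 \<le> real n * \<bar>u t x\<bar> + C * max 0 (D x - real n)" using C by auto
    qed
    also have "\<dots> = real n * (\<integral>x. \<bar>u t x\<bar> \<partial>\<omega>) + C * (\<integral>x. max 0 (D x - real n) \<partial>\<omega>)"
      using int1 by (subst Bochner_Integration.integral_add) auto
    also have "\<dots> < e"
    proof -
      have "real n * (\<integral>x. \<bar>u t x\<bar> \<partial>\<omega>) \<le> (real n + 1) * (\<integral>x. \<bar>u t x\<bar> \<partial>\<omega>)" by (intro mult_right_mono) auto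
      also have "\<dots> < (real n + 1) * (e / (2 * (real n + 1)))" using elim by (intro mult_strict_left_mono) auto
      also have "\<dots> = e / 2" by (simp add: field_simps)
      finally have 1: "real n * (\<integral>x. \<bar>u t x\<bar> \<partial>\<omega>) < e / 2" .
      have "C * (\<integral>x. max 0 (D x - real n) \<partial>\<omega>) \<le> (C + 1) * (\<integral>x. max 0 (D x - real n) \<partial>\<omega>)"
        by (intro mult_right_mono integral_nonneg_AE) auto
      also have "\<dots> < (C + 1) * (e / (2 * (C + 1)))" using n C by (intro mult_strict_left_mono) auto
      also have "\<dots> = e / 2" using C by (simp add: field_simps)
      finally show ?thesis using 1 by simp
    qed
    finally show ?case .
  qed
qed simp

section \<open>Reduction to the Markovian case and convergence at every point\<close>

context strong_feller_semigroup
begin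

text \<open>Doob's h-transform \<open>f \<mapsto> P t (h f) / h\<close> fixes constants because
  \<open>h\<close> is fixed, and leaves \<open>\<rho> = h \<omega>\<close> invariant because
  \<open>\<omega>\<close> is invariant. The Markovian convergence theorem applies to it and is
  translated back.\<close>

lemma L1_convergence_of_h_bounded:
  assumes \<omega>: "invariant \<omega>" and h: "h \<in> bounded_borel" "\<And>x. 0 \<le> h x" and h_fix: "\<And>t. t > 0 \<Longrightarrow> P t h = h"
    and a: "a \<in> bounded_borel"
  obtains b where "b \<in> bounded_borel" "((\<lambda>t. \<integral>x. \<bar>P t (\<lambda>x. h x * a x) x - b x\<bar> \<partial>\<omega>) \<longlongrightarrow> 0) at_top"
proof -
  \<comment> \<open>At zeros of \<open>h\<close> the transformed semigroup is the identity, so that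
    its kernel there is a point mass and the Markov and semigroup properties hold at every
    point.\<close>
  define Q where "Q t f x = (if h x > 0 then P t (\<lambda>y. h y * f y) x / h x else f x)" for t :: real and f x
  have hf: "(\<lambda>y. h y * f y) \<in> bounded_borel" if "f \<in> bounded_borel" for f using h that by auto
  have Phf: "\<bar>P t (\<lambda>y. h y * f y) x\<bar> \<le> C * h x" if t: "t > 0" and f: "f \<in> bounded_borel" "\<And>x. \<bar>f x\<bar> \<le> C" for t f x C
  proof -
    have "\<bar>P t (\<lambda>y. h y * f y) x\<bar> \<le> P t (\<lambda>y. \<bar>h y * f y\<bar>) x" by (rule P_abs)
    also have "\<dots> \<le> P t (\<lambda>y. C * h y) x"
    proof (rule P_mono[OF t])
      show "\<bar>h y * f y\<bar> \<le> C * h y" for y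
        using mult_left_mono[OF f(2)[of y] h(2)[of y]] h(2)[of y] by (simp add: abs_mult mult.commute)
    qed (use h f in \<open>auto intro!: bounded_borel_abs bounded_borel_mult\<close>)
    also have "\<dots> = C * h x" using P_cmult[OF t h(1)] h_fix[OF t] by simp
    finally show ?thesis .
  qed
  \<comment> \<open>At a zero of \<open>h\<close>, the bound \<open>C * h x\<close> of
    \<open>Phf\<close> forces the right-hand side to vanish too.\<close>
  have hQ: "h x * Q t f x = P t (\<lambda>y. h y * f y) x" if t: "t > 0" and f: "f \<in> bounded_borel" for t f x
  proof (cases "h x > 0")
    case False
    then have "h x = 0" using h(2)[of x] by simp
    moreover obtain C where "\<And>x. \<bar>f x\<bar> \<le> C" using f by (metis bounded_borelE)
    ultimately show ?thesis using Phf[OF t f, of C x] by simp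
  qed (simp add: Q_def)
  have Q_le: "\<bar>Q t f x\<bar> \<le> C" if t: "t > 0" and f: "f \<in> bounded_borel" "\<And>x. \<bar>f x\<bar> \<le> C" for t f x C
    using Phf[OF t f, of x] f(2)[of x] by (auto simp: Q_def abs_divide divide_le_eq)
  have Q_bb: "Q t f \<in> bounded_borel" if t: "t > 0" and f: "f \<in> bounded_borel" for t f
  proof -
    obtain C where C: "\<And>x. \<bar>f x\<bar> \<le> C" using f by (metis bounded_borelE)
    have [measurable]: "h \<in> borel_measurable borel" "f \<in> borel_measurable borel" "P t (\<lambda>y. h y * f y) \<in> borel_measurable borel"
      using h f P_bounded_borel[OF t hf[OF f]] by auto
    show ?thesis unfolding Q_def [abs_def] by (rule bounded_borelI[of _ C]) (use Q_le[OF t f C] in \<open>auto simp: Q_def\<close>)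
  qed
  have Q_daniell: "daniell (\<lambda>f. Q t f x)" if t: "t > 0" for t x
  proof (cases "h x > 0")
    case True
    have "daniell (\<lambda>f. P t (\<lambda>y. h y * f y) x / h x)" by (rule daniell_weighted[OF daniell_P[OF t] h h(2)])
    then show ?thesis using True by (simp add: Q_def)
  next
    case False
    then show ?thesis by (simp add: Q_def daniell_def)
  qed
  have "\<exists>N. finite_borel N \<and> (\<forall>f\<in>bounded_borel. Q t f x = integral\<^sup>L N f)" if "t > 0" for t x
    using daniell_representation[OF Q_daniell[OF that]] by metis
  then obtain q where q: "\<And>t x. t > 0 \<Longrightarrow> finite_borel (q t x)"
    "\<And>t x f. t > 0 \<Longrightarrow> f \<in> bounded_borel \<Longrightarrow> integral\<^sup>L (q t x) f = Q t f x" by metis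
  define \<rho> where "\<rho> = density \<omega> (\<lambda>x. ennreal (h x))"
  note fin\<omega> = invariantD(1)[OF \<omega>]
  have \<rho>: "finite_borel \<rho>"
  proof -
    have "emeasure \<rho> (space \<rho>) = (\<integral>\<^sup>+x. ennreal (h x) \<partial>\<omega>)"
      unfolding \<rho>_def using h finite_borelD[OF fin\<omega>] by (subst emeasure_density) auto
    also have "\<dots> < \<infinity>"
      using integrable_bounded_borel[OF fin\<omega> h(1)] h(2) by (simp add: integrable_iff_bounded)
    finally show ?thesis unfolding finite_borel_def using finite_borelD[OF fin\<omega>]
      by (auto intro!: finite_measureI simp: \<rho>_def)
  qed
  have int_\<rho>: "integral\<^sup>L \<rho> f = (\<integral>x. h x * f x \<partial>\<omega>)" if "f \<in> bounded_borel" for f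
    unfolding \<rho>_def using h bounded_borel_measurable[OF that] bounded_borel_measurable[OF h(1)] finite_borelD(4)[OF fin\<omega>]
    by (subst integral_density) auto
  have q_mass: "measure (q t x) UNIV = 1" if t: "t > 0" for t x
    using q(2)[OF t, of "\<lambda>_. 1" x] h_fix[OF t] finite_borelD(3)[OF q(1)[OF t]] by (auto simp: Q_def split: if_splits)
  interpret q: kernel_semigroup q 1
  proof
    fix s t :: real and x and f :: "'a \<Rightarrow> real"
    assume s: "s > 0" and t: "t > 0" and f: "f \<in> bounded_borel"
    have "(\<integral>y. integral\<^sup>L (q s y) f \<partial>q t x) = Q t (Q s f) x" using q(2)[OF s f] q(2)[OF t Q_bb[OF s f]] by simp
    also have "\<dots> = Q (t + s) f x"
      using P_semigroup[OF s t hf[OF f]] s by (auto simp: Q_def[of t] Q_def[of "t + s"] hQ[OF s f]) (simp add: Q_def)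
    finally show "(\<integral>y. integral\<^sup>L (q s y) f \<partial>q t x) = integral\<^sup>L (q (t + s) x) f" using q(2)[of "t + s" f] s t f by simp
  qed (use q Q_bb q_mass in auto)
  have qP: "q.P t f = Q t f" if "t > 0" "f \<in> bounded_borel" for t f using q(2)[OF that] by (auto simp: q.P_def)
  interpret q: compact_markov_semigroup q \<rho> t0
  proof
    show "q.invariant \<rho>"
      unfolding q.invariant_def
    proof (intro conjI allI impI ballI \<rho>)
      fix t :: real and f :: "'a \<Rightarrow> real" assume t: "t > 0" and f: "f \<in> bounded_borel"
      have "integral\<^sup>L \<rho> (q.P t f) = (\<integral>x. P t (\<lambda>y. h y * f y) x \<partial>\<omega>)"
        using int_\<rho>[OF Q_bb[OF t f]] hQ[OF t f] qP[OF t f] by simp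
      also have "\<dots> = integral\<^sup>L \<rho> f" using invariantD(2)[OF \<omega> t hf[OF f]] int_\<rho>[OF f] by simp
      finally show "integral\<^sup>L \<rho> (q.P t f) = integral\<^sup>L \<rho> f" .
    qed
    fix F :: "nat \<Rightarrow> 'a \<Rightarrow> real" and C :: real
    assume F: "\<And>n. F n \<in> bounded_borel" "\<And>n x. \<bar>F n x\<bar> \<le> C"
    obtain H where H: "\<And>x. \<bar>h x\<bar> \<le> H" using h by (metis bounded_borelE)
    have bd: "\<bar>h x * F n x\<bar> \<le> H * C" for n x
      using H[of x] F(2)[of n x] unfolding abs_mult by (intro mult_mono) auto
    have "\<exists>r g. strict_mono r \<and> g \<in> bounded_borel \<and> (\<forall>x. (\<lambda>n. P t0 (\<lambda>y. h y * F (r n) y) x) \<longlonglongrightarrow> g x)"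
      by (rule pointwise_compact[OF hf[OF F(1)] bd])
    then obtain r :: "nat \<Rightarrow> nat" and g where r: "strict_mono r" and g: "g \<in> bounded_borel"
      and lim: "\<And>x. (\<lambda>n. P t0 (\<lambda>y. h y * F (r n) y) x) \<longlonglongrightarrow> g x" by blast
    define G where "G x = (if h x > 0 then g x / h x else 0)" for x
    have gh: "\<bar>g x\<bar> \<le> C * h x" for x
      by (rule LIMSEQ_le_const2[OF tendsto_rabs[OF lim]]) (use Phf[OF t0_pos F] in auto)
    have "C \<ge> 0" using F(2)[of 0 undefined] by linarith
    have G: "G \<in> bounded_borel"
    proof (rule bounded_borelI)
      have [measurable]: "h \<in> borel_measurable borel" "g \<in> borel_measurable borel" using h g by auto
      show "G \<in> borel_measurable borel" unfolding G_def by measurable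
      show "\<bar>G x\<bar> \<le> C" for x using gh[of x] \<open>C \<ge> 0\<close> by (auto simp: G_def abs_divide divide_le_eq)
    qed
    have hm: "h \<in> borel_measurable \<omega>"
      using bounded_borel_measurable[OF h(1)] by (simp add: finite_borelD(4)[OF fin\<omega>])
    \<comment> \<open>Convergence after division by \<open>h\<close> is only known where
      \<open>h\<close> is positive; this is why compactness is demanded almost everywhere.\<close>
    have "AE x in \<rho>. h x > 0"
      unfolding \<rho>_def using hm by (subst AE_density) auto
    then have "AE x in \<rho>. (\<lambda>n. q.P t0 (F (r n)) x) \<longlonglongrightarrow> G x"
    proof eventually_elim
      case (elim x)
      then show ?case using tendsto_divide[OF lim[of x] tendsto_const[of "h x"]] qP[OF t0_pos F(1)] by (simp add: Q_def G_def)
    qed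
    then show "\<exists>r g. strict_mono r \<and> g \<in> bounded_borel \<and> (AE x in \<rho>. (\<lambda>n. q.P t0 (F (r n)) x) \<longlonglongrightarrow> g x)"
      using r G by blast
  qed (use q_mass t0_pos in auto)
  obtain b where b: "b \<in> bounded_borel" "((\<lambda>t. \<integral>x. \<bar>q.P t a x - b x\<bar> \<partial>\<rho>) \<longlongrightarrow> 0) at_top"
    using q.L1_convergence[OF a] by blast
  show thesis
  proof (rule that)
    show hb: "(\<lambda>x. h x * b x) \<in> bounded_borel" by (rule hf[OF b(1)])
    have "\<forall>\<^sub>F t in at_top. (\<integral>x. \<bar>q.P t a x - b x\<bar> \<partial>\<rho>) = (\<integral>x. \<bar>P t (\<lambda>x. h x * a x) x - h x * b x\<bar> \<partial>\<omega>)"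
      using eventually_gt_at_top[of 0]
    proof eventually_elim
      case (elim t)
      have "(\<integral>x. \<bar>q.P t a x - b x\<bar> \<partial>\<rho>) = (\<integral>x. h x * \<bar>Q t a x - b x\<bar> \<partial>\<omega>)"
        unfolding qP[OF elim a] by (intro int_\<rho> bounded_borel_intros Q_bb elim a b)
      \<comment> \<open>The L1 distance for \<open>\<rho>\<close> between transformed functions is
        the L1 distance for \<open>\<omega>\<close> between the original ones.\<close>
      moreover have "h x * \<bar>Q t a x - b x\<bar> = \<bar>P t (\<lambda>x. h x * a x) x - h x * b x\<bar>" for x
        using h(2)[of x] hQ[OF elim a, of x] by (metis abs_mult abs_of_nonneg right_diff_distrib)
      ultimately show ?case by simp
    qed
    then show "((\<lambda>t. \<integral>x. \<bar>P t (\<lambda>x. h x * a x) x - h x * b x\<bar> \<partial>\<omega>) \<longlongrightarrow> 0) at_top"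
      by (rule Lim_transform_eventually[OF b(2)])
  qed
qed


text \<open>One time \<open>s\<close> at which the orbit of \<open>f\<close> is close to
  \<open>a\<close> is enough: from then on the contraction keeps it close to the orbit of
  \<open>a\<close>.\<close>

lemma P_diff_L1_tendsto:
  assumes \<omega>: "invariant \<omega>" and f: "f \<in> bounded_borel" and a: "a \<in> bounded_borel" and b: "b \<in> bounded_borel"
    and near: "\<And>e. e > 0 \<Longrightarrow> \<exists>s>0. (\<integral>x. \<bar>P s f x - a x\<bar> \<partial>\<omega>) < e"
    and lim: "((\<lambda>t. \<integral>x. \<bar>P t a x - b x\<bar> \<partial>\<omega>) \<longlongrightarrow> 0) at_top"
  shows "((\<lambda>t. \<integral>x. \<bar>P t f x - b x\<bar> \<partial>\<omega>) \<longlongrightarrow> 0) at_top"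
  unfolding tendsto_iff dist_real_def
proof (intro allI impI)
  fix e :: real assume e: "e > 0"
  obtain s where s: "s > 0" "(\<integral>x. \<bar>P s f x - a x\<bar> \<partial>\<omega>) < e / 2" using near[of "e / 2"] e by auto
  have "\<forall>\<^sub>F t in at_top. (\<integral>x. \<bar>P t a x - b x\<bar> \<partial>\<omega>) < e / 2" using order_tendstoD(2)[OF lim, of "e / 2"] e by simp
  then obtain U where U: "\<And>t. t \<ge> U \<Longrightarrow> (\<integral>x. \<bar>P t a x - b x\<bar> \<partial>\<omega>) < e / 2"
    by (auto simp: eventually_at_top_linorder)
  note int = integrable_bounded_borel[OF invariantD(1)[OF \<omega>]]
  show "\<forall>\<^sub>F t in at_top. \<bar>(\<integral>x. \<bar>P t f x - b x\<bar> \<partial>\<omega>) - 0\<bar> < e"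
    using eventually_gt_at_top[of "s + max U 0"]
  proof eventually_elim
    case (elim t)
    define u where "u = t - s"
    have u: "u > 0" "u \<ge> U" using elim by (auto simp: u_def)
    have eq: "P t f = P u (P s f)" using P_semigroup[OF s(1) u(1) f] by (simp add: u_def)
    have "(\<integral>x. \<bar>P t f x - b x\<bar> \<partial>\<omega>) \<le> (\<integral>x. \<bar>P u (P s f) x - P u a x\<bar> + \<bar>P u a x - b x\<bar> \<partial>\<omega>)"
      unfolding eq by (intro integral_mono int bounded_borel_intros P_bounded_borel u s f a b) auto
    also have "\<dots> = (\<integral>x. \<bar>P u (P s f) x - P u a x\<bar> \<partial>\<omega>) + (\<integral>x. \<bar>P u a x - b x\<bar> \<partial>\<omega>)"
      by (intro Bochner_Integration.integral_add int bounded_borel_intros P_bounded_borel u s f a b)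
    also have "(\<integral>x. \<bar>P u (P s f) x - P u a x\<bar> \<partial>\<omega>) \<le> (\<integral>x. \<bar>P s f x - a x\<bar> \<partial>\<omega>)"
      by (intro L1_contraction_diff \<omega> u P_bounded_borel s f a)
    finally show ?case using s(2) U[OF u(2)] by simp
  qed
qed

text \<open>All limit points of the orbit of \<open>f\<close> are dominated by a fixed function \<open>h\<close>, and the
  \<open>h\<close>-transform of the semigroup is Markovian.\<close>

lemma L1_convergence_invariant:
  assumes \<omega>: "invariant \<omega>" and f: "f \<in> bounded_borel"
  obtains b where "b \<in> bounded_borel" "((\<lambda>t. \<integral>x. \<bar>P t f x - b x\<bar> \<partial>\<omega>) \<longlongrightarrow> 0) at_top"
proof -
  obtain C where C: "C > 0" "\<And>x. \<bar>f x\<bar> \<le> C" using f by (metis bounded_borelE)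
  \<comment> \<open>\<open>h\<close> dominates the upper limit of \<open>P t 1\<close>, so
    \<open>C * h\<close> dominates every pointwise limit along the orbit of
    \<open>f\<close>.\<close>
  obtain h where h: "h \<in> bounded_borel" "\<And>x. 0 \<le> h x" "\<And>t. t > 0 \<Longrightarrow> P t h = h"
    and ev: "\<And>x e. e > 0 \<Longrightarrow> \<forall>\<^sub>F t in at_top. P t (\<lambda>_. 1) x < h x + e"
    using dominating_fixed_function[of "\<lambda>_. 1"] by (metis bounded_borel_const zero_le_one)
  have PC: "\<bar>P t f x\<bar> \<le> C * P t (\<lambda>_. 1) x" if t: "t > 0" for t x
  proof -
    have "\<bar>P t f x\<bar> \<le> P t (\<lambda>x. \<bar>f x\<bar>) x" by (rule P_abs)
    also have "\<dots> \<le> P t (\<lambda>_. C * 1) x" using C f t by (intro P_mono) auto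
    also have "\<dots> = C * P t (\<lambda>_. 1) x" by (rule P_cmult[OF t]) simp
    finally show ?thesis .
  qed
  have PMC: "\<bar>P t f x\<bar> \<le> M * C" if "t > 0" for t x by (rule P_bound[OF that f C(2)])
  have "\<exists>r a. strict_mono r \<and> a \<in> bounded_borel \<and> (\<forall>x. (\<lambda>n. P t0 (P (real (Suc (r n))) f) x) \<longlonglongrightarrow> a x)"
    by (rule pointwise_compact[where C="M * C"]) (use PMC f in auto)
  then obtain r a0 where r: "strict_mono r" and a0: "a0 \<in> bounded_borel"
    and lim: "\<And>x. (\<lambda>n. P t0 (P (real (Suc (r n))) f) x) \<longlonglongrightarrow> a0 x" by blast
  define s where "s n = t0 + real (Suc (r n))" for n
  have s: "s n > 0" for n using t0_pos by (simp add: s_def)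
  have s_ge: "real n \<le> s n" for n using seq_suble[OF r, of n] t0_pos by (simp add: s_def)
  have s_top: "filterlim s at_top sequentially"
    by (rule filterlim_at_top_mono[OF filterlim_real_sequentially]) (use s_ge in auto)
  have s_eq: "P t0 (P (real (Suc (r n))) f) = P (s n) f" for n
    using P_semigroup[of "real (Suc (r n))" t0 f] t0_pos f by (simp add: s_def)
  note lim = lim[unfolded s_eq]
  have a0h: "\<bar>a0 x\<bar> \<le> C * h x" for x
  proof (rule field_le_epsilon)
    fix e :: real assume "e > 0"
    then have "\<forall>\<^sub>F n in sequentially. P (s n) (\<lambda>_. 1) x < h x + e / C"
      using C(1) by (intro eventually_compose_filterlim[OF ev s_top]) simp
    then have "\<forall>\<^sub>F n in sequentially. \<bar>P (s n) f x\<bar> \<le> C * h x + e"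
    proof eventually_elim
      case (elim n)
      have "C * P (s n) (\<lambda>_. 1) x \<le> C * (h x + e / C)" using elim C(1) by (intro mult_left_mono) auto
      then show ?case using PC[OF s, of n x] C(1) by (simp add: distrib_left)
    qed
    then show "\<bar>a0 x\<bar> \<le> C * h x + e"
      by (intro tendsto_upperbound[OF tendsto_rabs[OF lim[of x]]]) auto
  qed
  \<comment> \<open>Because \<open>\<bar>a0\<bar> \<le> C * h\<close>, the quotient is bounded and
    \<open>a0 = h * a\<close> also holds at the zeros of \<open>h\<close>.\<close>
  define a where "a x = (if h x > 0 then a0 x / h x else 0)" for x
  have a: "a \<in> bounded_borel"
  proof (rule bounded_borelI)
    have [measurable]: "h \<in> borel_measurable borel" "a0 \<in> borel_measurable borel" using h a0 by auto
    show "a \<in> borel_measurable borel" unfolding a_def by measurable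
    show "\<bar>a x\<bar> \<le> C" for x using a0h[of x] C(1) by (auto simp: a_def abs_divide divide_le_eq)
  qed
  have ha: "(\<lambda>x. h x * a x) = a0"
  proof
    fix x show "h x * a x = a0 x" using a0h[of x] h(2)[of x] by (auto simp: a_def)
  qed
  obtain b where b: "b \<in> bounded_borel" "((\<lambda>t. \<integral>x. \<bar>P t a0 x - b x\<bar> \<partial>\<omega>) \<longlongrightarrow> 0) at_top"
    using L1_convergence_of_h_bounded[OF \<omega> h a] unfolding ha by blast
  obtain D where D: "\<And>x. \<bar>a0 x\<bar> \<le> D" using a0 by (metis bounded_borelE)
  have "(\<lambda>n. \<integral>x. \<bar>P (s n) f x - a0 x\<bar> \<partial>\<omega>) \<longlonglongrightarrow> (\<integral>x. 0 \<partial>\<omega>)"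
  proof (rule bounded_borel_DCT[OF invariantD(1)[OF \<omega>], where C="M * C + D"])
    show "(\<lambda>x. \<bar>P (s n) f x - a0 x\<bar>) \<in> bounded_borel" for n
      by (intro bounded_borel_intros P_bounded_borel s f a0)
    show "\<bar>\<bar>P (s n) f x - a0 x\<bar>\<bar> \<le> M * C + D" for n x using PMC[OF s, of n x] D[of x] by linarith
    show "AE x in \<omega>. (\<lambda>n. \<bar>P (s n) f x - a0 x\<bar>) \<longlonglongrightarrow> 0"
      using lim by (auto intro!: tendsto_rabs_zero simp: LIM_zero)
  qed auto
  then have near: "\<exists>s>0. (\<integral>x. \<bar>P s f x - a0 x\<bar> \<partial>\<omega>) < e" if e: "e > 0" for e
    using order_tendstoD(2)[of _ _ _ e] e s by (fastforce simp: eventually_sequentially)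
  show thesis using that[OF b(1) P_diff_L1_tendsto[OF \<omega> f a0 b(1) near b(2)]] .
qed

lemma maximal_null_set:
  assumes \<mu>: "finite_borel \<mu>" and \<omega>: "finite_borel \<omega>"
  shows "\<exists>A\<in>sets borel. measure \<omega> A = 0 \<and> (\<forall>B\<in>sets borel. measure \<omega> B = 0 \<longrightarrow> measure \<mu> B \<le> measure \<mu> A)"
proof -
  interpret \<omega>: finite_measure \<omega> by (rule finite_borelD[OF \<omega>])
  have null: "A \<in> sets borel \<and> measure \<omega> A = 0 \<longleftrightarrow> A \<in> null_sets \<omega>" for A
    using finite_borelD(2)[OF \<omega>] by (auto simp: null_sets_def \<omega>.emeasure_eq_measure)
  obtain A where "A \<in> null_sets \<omega>" "\<And>B. B \<in> null_sets \<omega> \<Longrightarrow> measure \<mu> B \<le> measure \<mu> A"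
  proof (rule maximal_measure_set[of \<mu> "null_sets \<omega>"])
    show "finite_measure \<mu>" by (rule finite_borelD[OF \<mu>])
    show "null_sets \<omega> \<subseteq> sets \<mu>" using finite_borelD(2)[OF \<omega>] finite_borelD(2)[OF \<mu>] by (auto simp: null_sets_def)
  qed auto
  then show ?thesis using null by blast
qed

text \<open>Invariance passes to the convergent weighted sum, and positivity of the weights makes
  its null sets null for each summand.\<close>

lemma invariant_mixture:
  assumes "\<And>i::nat. invariant (\<omega> i)"
  shows "\<exists>\<omega>'. invariant \<omega>' \<and> (\<forall>A\<in>sets borel. measure \<omega>' A = 0 \<longrightarrow> (\<forall>i. measure (\<omega> i) A = 0))"
proof -
  obtain \<omega>' and c :: "nat \<Rightarrow> real" where \<omega>': "finite_borel \<omega>'" and c: "\<And>i. c i > 0"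
    and sums: "\<And>f. f \<in> bounded_borel \<Longrightarrow> (\<lambda>i. c i * integral\<^sup>L (\<omega> i) f) sums integral\<^sup>L \<omega>' f"
    using countable_mixture[of \<omega>] invariantD(1)[OF assms] by blast
  have "invariant \<omega>'"
    unfolding invariant_def
  proof (intro conjI allI impI ballI \<omega>')
    fix t :: real and f :: "'a \<Rightarrow> real" assume t: "t > 0" and f: "f \<in> bounded_borel"
    have "(\<lambda>i. c i * integral\<^sup>L (\<omega> i) (P t f)) sums integral\<^sup>L \<omega>' (P t f)" using sums t f by auto
    then show "integral\<^sup>L \<omega>' (P t f) = integral\<^sup>L \<omega>' f"
      unfolding invariantD(2)[OF assms t f] using sums[OF f] sums_unique2 by blast
  qed
  moreover have "measure (\<omega> i) A = 0" if A: "A \<in> sets borel" "measure \<omega>' A = 0" for A i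
  proof -
    have eq: "(\<lambda>i. c i * measure (\<omega> i) A) sums 0"
      using sums[of "indicator A"] A finite_borelD[OF \<omega>'] finite_borelD[OF invariantD(1)[OF assms]] by simp
    have "c i * measure (\<omega> i) A \<le> 0"
      using sum_le_suminf[OF sums_summable[OF eq], of "{i}"] sums_unique[OF eq] c by (simp add: less_imp_le)
    then have "measure (\<omega> i) A \<le> 0" using c[of i] by (simp add: mult_le_0_iff)
    then show ?thesis using measure_nonneg order_antisym by blast
  qed
  ultimately show ?thesis by blast
qed

text \<open>\<open>\<omega>\<close> minimizes the \<open>\<mu>\<close>-measure of the largest \<open>\<omega>\<close>-null set, which is \<open>D\<close>.\<close>

lemma maximal_invariant_measure:
  assumes \<mu>: "finite_borel \<mu>" and ac: "\<And>A x. A \<in> sets borel \<Longrightarrow> measure \<mu> A = 0 \<Longrightarrow> measure (K t0 x) A = 0"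
  obtains \<omega> D where "invariant \<omega>" "D \<in> sets borel" "\<And>\<omega>'. invariant \<omega>' \<Longrightarrow> measure \<omega>' D = 0"
    "\<And>A. A \<in> sets borel \<Longrightarrow> A \<inter> D = {} \<Longrightarrow> measure \<omega> A = 0 \<Longrightarrow> measure \<mu> A = 0"
proof -
  interpret \<mu>: finite_measure \<mu> by (rule finite_borelD[OF \<mu>])
  note [simp] = finite_borelD(2)[OF \<mu>]
  \<comment> \<open>\<open>P t0\<close> sends the indicator of a \<open>\<mu>\<close>-null set to 0,
    so no invariant measure charges that set.\<close>
  have inv_ac: "measure \<omega> A = 0" if \<omega>: "invariant \<omega>" and A: "A \<in> sets borel" "measure \<mu> A = 0" for \<omega> A
  proof -
    have "P t0 (indicator A) = (\<lambda>x. 0)" using P_indicator[OF t0_pos A(1)] ac[OF A] by auto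
    then show ?thesis
      using invariantD(2)[OF \<omega> t0_pos, of "indicator A"] A finite_borelD[OF invariantD(1)[OF \<omega>]] by simp
  qed
  have "\<exists>A. invariant \<omega> \<longrightarrow> A \<in> sets borel \<and> measure \<omega> A = 0 \<and> (\<forall>B\<in>sets borel. measure \<omega> B = 0 \<longrightarrow> measure \<mu> B \<le> measure \<mu> A)" for \<omega>
    using maximal_null_set[OF \<mu> invariantD(1), of \<omega>] by blast
  then obtain Z where Z: "\<And>\<omega>. invariant \<omega> \<Longrightarrow> Z \<omega> \<in> sets borel" "\<And>\<omega>. invariant \<omega> \<Longrightarrow> measure \<omega> (Z \<omega>) = 0"
    "\<And>\<omega> B. invariant \<omega> \<Longrightarrow> B \<in> sets borel \<Longrightarrow> measure \<omega> B = 0 \<Longrightarrow> measure \<mu> B \<le> measure \<mu> (Z \<omega>)"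
    by metis
  define S where "S = (\<lambda>\<omega>. measure \<mu> (Z \<omega>)) ` Collect invariant"
  \<comment> \<open>The zero measure ensures that the infimum is taken over a nonempty set.\<close>
  have "invariant (null_measure borel)"
    unfolding invariant_def finite_borel_def by (auto intro!: finite_measureI)
  then have S: "S \<noteq> {}" "bdd_below S" by (auto simp: S_def intro!: bdd_belowI[of _ 0])
  have "\<exists>\<omega>. invariant \<omega> \<and> measure \<mu> (Z \<omega>) < Inf S + 1 / real (Suc n)" for n
  proof -
    have "Inf S < Inf S + 1 / real (Suc n)" by simp
    then show ?thesis using cInf_lessD[OF S(1)] unfolding S_def by blast
  qed
  then obtain \<omega>s where \<omega>s: "\<And>n. invariant (\<omega>s n)" "\<And>n. measure \<mu> (Z (\<omega>s n)) < Inf S + 1 / real (Suc n)" by metis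
  obtain \<omega> where \<omega>: "invariant \<omega>" and null: "\<And>A i. A \<in> sets borel \<Longrightarrow> measure \<omega> A = 0 \<Longrightarrow> measure (\<omega>s i) A = 0"
    using invariant_mixture[of \<omega>s, OF \<omega>s(1)] by blast
  have "measure \<mu> (Z \<omega>) \<le> Inf S"
  proof (rule field_le_epsilon)
    fix e :: real assume "e > 0"
    then obtain n where "1 / real (Suc n) < e" using nat_approx_posE by blast
    moreover have "measure \<mu> (Z \<omega>) \<le> measure \<mu> (Z (\<omega>s n))"
      by (rule Z(3)[OF \<omega>s(1) Z(1)[OF \<omega>] null[OF Z(1,2)[OF \<omega>]]])
    ultimately show "measure \<mu> (Z \<omega>) \<le> Inf S + e" using \<omega>s(2)[of n] by simp
  qed
  then have min: "measure \<mu> (Z \<omega>) \<le> measure \<mu> (Z \<omega>')" if "invariant \<omega>'" for \<omega>'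
    using that S(2) by (auto simp: S_def intro: order_trans cInf_lower)
  define D where "D = Z \<omega>"
  have D: "D \<in> sets borel" "measure \<omega> D = 0" using Z[OF \<omega>] by (auto simp: D_def)
  \<comment> \<open>Any \<open>\<omega>\<close>-null set is contained in \<open>D\<close> up to a
    \<open>\<mu>\<close>-null set, since otherwise its union with \<open>D\<close> would be a larger
    \<open>\<omega>\<close>-null set.\<close>
  have maxi: "measure \<mu> (A - D) = 0" if A: "A \<in> sets borel" "measure \<omega> A = 0" for A
  proof -
    have "measure \<omega> (A \<union> D) \<le> measure \<omega> A + measure \<omega> D"
      using A D finite_borelD[OF invariantD(1)[OF \<omega>]] by (intro measure_Un_le) auto
    then have "measure \<omega> (A \<union> D) = 0" using A D measure_nonneg[of \<omega> "A \<union> D"] by linarith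
    then have "measure \<mu> (A \<union> D) \<le> measure \<mu> D" unfolding D_def using A Z[OF \<omega>] by (intro Z(3)[OF \<omega>]) auto
    moreover have "measure \<mu> (A \<union> D) = measure \<mu> (A - D) + measure \<mu> D"
      using \<mu>.finite_measure_Union[of "A - D" D] A D by (simp add: Diff_disjoint Int_commute)
    ultimately show ?thesis using measure_nonneg[of \<mu> "A - D"] by linarith
  qed
  \<comment> \<open>Mix \<open>\<omega>\<close> with \<open>\<omega>'\<close>. The largest null set
    \<open>E\<close> of the mixture lies in \<open>D\<close> modulo \<open>\<mu>\<close> and, by
    minimality of \<open>\<omega>\<close>, is not smaller than \<open>D\<close>. So
    \<open>D - E\<close> is \<open>\<mu>\<close>-null and thus \<open>\<omega>'\<close>-null, while
    \<open>E\<close> is \<open>\<omega>'\<close>-null by construction.\<close>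
  have zero: "measure \<omega>' D = 0" if \<omega>': "invariant \<omega>'" for \<omega>'
  proof -
    obtain \<omega>2 where \<omega>2: "invariant \<omega>2"
      and null2: "\<And>A i. A \<in> sets borel \<Longrightarrow> measure \<omega>2 A = 0 \<Longrightarrow> measure (if i = (0::nat) then \<omega> else \<omega>') A = 0"
    proof -
      have "\<And>i::nat. invariant (if i = 0 then \<omega> else \<omega>')" using \<omega> \<omega>' by simp
      from invariant_mixture[of "\<lambda>i. if i = 0 then \<omega> else \<omega>'", OF this] that show thesis by blast
    qed
    define E where "E = Z \<omega>2"
    have E: "E \<in> sets borel" "measure \<omega>2 E = 0" using Z[OF \<omega>2] by (auto simp: E_def)
    have E0: "measure \<omega> E = 0" "measure \<omega>' E = 0" using null2[OF E, of 0] null2[OF E, of 1] by auto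
    have "measure \<mu> E = measure \<mu> (E - D) + measure \<mu> (E \<inter> D)"
      using \<mu>.finite_measure_Diff'[of E D] E D by simp
    then have "measure \<mu> D \<le> measure \<mu> (E \<inter> D)" using maxi[OF E(1) E0(1)] min[OF \<omega>2] by (simp add: D_def E_def)
    then have "measure \<mu> (D - E) \<le> 0" using \<mu>.finite_measure_Diff'[of D E] E D by (simp add: Int_commute)
    then have "measure \<mu> (D - E) = 0" using measure_nonneg order_antisym by blast
    then have "measure \<omega>' (D - E) = 0" using inv_ac[OF \<omega>'] D E by auto
    moreover have "measure \<omega>' D \<le> measure \<omega>' (D - E) + measure \<omega>' E"
    proof -
      interpret finite_measure \<omega>' by (rule finite_borelD[OF invariantD(1)[OF \<omega>']])
      have "measure \<omega>' D \<le> measure \<omega>' ((D - E) \<union> E)"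
        using D E finite_borelD[OF invariantD(1)[OF \<omega>']] by (intro finite_measure_mono) auto
      also have "\<dots> \<le> measure \<omega>' (D - E) + measure \<omega>' E"
        using D E finite_borelD[OF invariantD(1)[OF \<omega>']] by (intro measure_Un_le) auto
      finally show ?thesis .
    qed
    ultimately show ?thesis using E0 measure_nonneg[of \<omega>' D] by linarith
  qed
  have "measure \<mu> A = 0" if "A \<in> sets borel" "A \<inter> D = {}" "measure \<omega> A = 0" for A
    using maxi[OF that(1,3)] that(2) by (simp add: Diff_triv)
  with \<omega> D(1) zero show thesis by (rule that)
qed

text \<open>Write \<open>P t f x\<close> as \<open>P s\<close> applied to \<open>P (t - s) f\<close>
  at \<open>x\<close> and split \<open>K s x\<close> along \<open>D\<close>. The mass on
  \<open>D\<close> is small for a suitable large \<open>s\<close>, as the fixed function dominating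
  it is 0. The part off \<open>D\<close> is absolutely continuous with respect to
  \<open>\<omega>\<close>, so the L1 convergence to \<open>b\<close> is visible to it. Hence
  \<open>P t f x\<close> is eventually close to \<open>P s b x\<close>.\<close>

theorem pointwise_convergence:
  assumes sep: "\<And>g. g \<in> bounded_borel \<Longrightarrow> (\<And>x. 0 \<le> g x) \<Longrightarrow> (\<And>t. t > 0 \<Longrightarrow> P t g = g) \<Longrightarrow>
      (\<And>\<omega>. invariant \<omega> \<Longrightarrow> integral\<^sup>L \<omega> g = 0) \<Longrightarrow> g = (\<lambda>_. 0)"
    and f: "f \<in> bounded_borel"
  shows "\<exists>l. ((\<lambda>t. P t f x) \<longlongrightarrow> l) at_top"
proof (rule tendsto_if_approximable)
  obtain \<mu> where \<mu>: "finite_borel \<mu>" and ac: "\<And>A x. A \<in> sets borel \<Longrightarrow> measure \<mu> A = 0 \<Longrightarrow> measure (K t0 x) A = 0"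
    using dominating_measure by blast
  obtain \<omega> D where \<omega>: "invariant \<omega>" and D: "D \<in> sets borel" "\<And>\<omega>'. invariant \<omega>' \<Longrightarrow> measure \<omega>' D = 0"
    and ac\<omega>: "\<And>A. A \<in> sets borel \<Longrightarrow> A \<inter> D = {} \<Longrightarrow> measure \<omega> A = 0 \<Longrightarrow> measure \<mu> A = 0"
    using maximal_invariant_measure[OF \<mu> ac] by metis
  obtain g where g: "g \<in> bounded_borel" "\<And>x. 0 \<le> g x" "\<And>t. t > 0 \<Longrightarrow> P t g = g"
    and ev: "\<And>x e. e > 0 \<Longrightarrow> \<forall>\<^sub>F t in at_top. P t (indicator D) x < g x + e"
    and g_null: "\<And>\<omega>. invariant \<omega> \<Longrightarrow> integral\<^sup>L \<omega> (indicator D :: _ \<Rightarrow> real) = 0 \<Longrightarrow> integral\<^sup>L \<omega> g = 0"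
    by (rule dominating_fixed_function[of "indicator D"]) (use D in auto)
  have g0: "g = (\<lambda>_. 0)"
  proof (rule sep[OF g])
    fix \<omega> assume \<omega>: "invariant \<omega>"
    show "integral\<^sup>L \<omega> g = 0"
      by (rule g_null[OF \<omega>]) (use D finite_borelD[OF invariantD(1)[OF \<omega>]] \<omega> in auto)
  qed
  obtain b where b: "b \<in> bounded_borel" and L1: "((\<lambda>t. \<integral>x. \<bar>P t f x - b x\<bar> \<partial>\<omega>) \<longlongrightarrow> 0) at_top"
    using L1_convergence_invariant[OF \<omega> f] by blast
  obtain C where C: "\<And>x. \<bar>f x\<bar> \<le> C" using f by (metis bounded_borelE)
  obtain B where B: "B > 0" "\<And>x. \<bar>b x\<bar> \<le> B" using b by (metis bounded_borelE)
  define C' where "C' = M * C + B"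
  have "C \<ge> 0" using C[of undefined] by linarith
  then have C': "C' > 0" using B M_nonneg by (auto simp: C'_def intro: add_nonneg_pos)
  have diff: "\<bar>P t f y - b y\<bar> \<le> C'" if "t > 0" for t y
    using P_bound[OF that f C, of y] B(2)[of y] unfolding C'_def by linarith
  have diff_bb: "(\<lambda>y. P t f y - b y) \<in> bounded_borel" if "t > 0" for t using that f b by auto
  fix e :: real assume e: "e > 0"
  then have "\<forall>\<^sub>F s in at_top. P s (indicator D) x < e / (2 * C')" using ev[of "e / (2 * C')" x] C' g0 by simp
  then have "\<forall>\<^sub>F s in at_top. P s (indicator D) x < e / (2 * C') \<and> s > t0"
    by (intro eventually_conj eventually_gt_at_top)
  then obtain s where s: "P s (indicator D) x < e / (2 * C')" "s > t0" by (auto dest: eventually_happens)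
  have s0: "s > 0" using s t0_pos by simp
  have comp: "indicator (- D) \<in> bounded_borel" using D by auto
  have "daniell (\<lambda>\<phi>. P s (\<lambda>y. indicator (- D) y * \<phi> y) x)"
    using daniell_weighted[OF daniell_P[OF s0] comp _ zero_le_one] by simp
  then obtain \<nu> where \<nu>: "finite_borel \<nu>"
    "\<And>\<phi>. \<phi> \<in> bounded_borel \<Longrightarrow> P s (\<lambda>y. indicator (- D) y * \<phi> y) x = integral\<^sup>L \<nu> \<phi>"
    by (elim daniell_representation) blast
  \<comment> \<open>Off \<open>D\<close> an \<open>\<omega>\<close>-null set is
    \<open>\<mu>\<close>-null, hence null for all \<open>K t0 y\<close>; as \<open>s > t0\<close>,
    the semigroup law makes it null for \<open>K s x\<close>.\<close>
  have \<nu>_ac: "measure \<nu> A = 0" if A: "A \<in> sets borel" "measure \<omega> A = 0" for A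
  proof -
    interpret \<omega>: finite_measure \<omega> by (rule finite_borelD[OF invariantD(1)[OF \<omega>]])
    have AD: "A - D \<in> sets borel" using A D by auto
    have "measure \<omega> (A - D) \<le> measure \<omega> A"
      using A D finite_borelD[OF invariantD(1)[OF \<omega>]] by (intro \<omega>.finite_measure_mono) auto
    then have "measure \<omega> (A - D) = 0" using A measure_nonneg[of \<omega> "A - D"] by linarith
    then have "measure \<mu> (A - D) = 0" using AD by (intro ac\<omega>) auto
    then have "P t0 (indicator (A - D)) = (\<lambda>x. 0)" using P_indicator[OF t0_pos AD] ac[OF AD] by auto
    then have "P s (indicator (A - D)) x = P (s - t0) (\<lambda>x. 0) x"
      using P_semigroup[of t0 "s - t0" "indicator (A - D)"] t0_pos s AD by simp
    then have "P s (indicator (A - D)) x = 0" by (simp add: P_def)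
    moreover have "(\<lambda>y. indicator (- D) y * indicator A y) = (indicator (A - D) :: 'a \<Rightarrow> real)"
      by (auto simp: indicator_def)
    ultimately show ?thesis using \<nu>(2)[of "indicator A"] A finite_borelD[OF \<nu>(1)] by simp
  qed
  have "\<forall>\<^sub>F t in at_top. (\<integral>y. \<bar>P t f y - b y\<bar> \<partial>\<nu>) < e / 2"
  proof (rule absolutely_continuous_L1_tendsto[OF invariantD(1)[OF \<omega>] \<nu>(1) \<nu>_ac _ L1])
    show "\<forall>\<^sub>F t in at_top. (\<lambda>y. P t f y - b y) \<in> bounded_borel \<and> (\<forall>y. \<bar>P t f y - b y\<bar> \<le> C')"
      using eventually_gt_at_top[of 0] by eventually_elim (use diff diff_bb in auto)
  qed (use e in auto)
  then obtain U where U: "\<And>t. t \<ge> U \<Longrightarrow> (\<integral>y. \<bar>P t f y - b y\<bar> \<partial>\<nu>) < e / 2"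
    by (auto simp: eventually_at_top_linorder)
  have "\<forall>\<^sub>F t in at_top. \<bar>P t f x - P s b x\<bar> < e"
    using eventually_gt_at_top[of "s + max U 0"]
  proof eventually_elim
    case (elim t)
    define u where "u = t - s"
    have u: "u > 0" "u \<ge> U" using elim by (auto simp: u_def)
    let ?d = "\<lambda>y. \<bar>P u f y - b y\<bar>"
    have d: "?d \<in> bounded_borel" using diff_bb[OF u(1)] by auto
    have "P t f x = P s (P u f) x" using P_semigroup[OF u(1) s0 f] by (simp add: u_def)
    then have "P t f x - P s b x = P s (\<lambda>y. P u f y - b y) x" using P_diff[OF s0 P_bounded_borel[OF u(1) f] b] by simp
    then have "\<bar>P t f x - P s b x\<bar> \<le> P s ?d x" by (metis P_abs)
    also have "\<dots> \<le> P s (\<lambda>y. indicator (- D) y * ?d y + C' * indicator D y) x"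
    proof (rule P_mono[OF s0 d])
      show "(\<lambda>y. indicator (- D) y * ?d y + C' * indicator D y) \<in> bounded_borel"
        by (intro bounded_borel_add bounded_borel_mult comp d bounded_borel_indicator bounded_borel_const D)
      show "?d y \<le> indicator (- D) y * ?d y + C' * indicator D y" for y
        using diff[OF u(1), of y] by (auto simp: indicator_def)
    qed
    also have "\<dots> = P s (\<lambda>y. indicator (- D) y * ?d y) x + P s (\<lambda>y. C' * indicator D y) x"
      using comp d D by (intro P_add[OF s0]) auto
    also have "P s (\<lambda>y. indicator (- D) y * ?d y) x = integral\<^sup>L \<nu> ?d" by (rule \<nu>(2)[OF d])
    also have "P s (\<lambda>y. C' * indicator D y) x = C' * P s (indicator D) x"
      using D by (intro P_cmult[OF s0]) auto
    also have "C' * P s (indicator D) x < C' * (e / (2 * C'))" using s(1) C' by (intro mult_strict_left_mono)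
    also have "C' * (e / (2 * C')) = e / 2" using C' by simp
    finally show ?case using U[OF u(2)] by simp
  qed
  then show "\<exists>c. \<forall>\<^sub>F t in at_top. \<bar>P t f x - c\<bar> < e" ..
qed

end

section \<open>Limit operators and the strict topology\<close>

lemma compact_insert_range_LIMSEQ:
  fixes f :: "nat \<Rightarrow> 'a::topological_space"
  assumes "f \<longlonglongrightarrow> l" shows "compact (insert l (range f))"
proof (rule compactI)
  fix \<C> assume \<C>: "\<forall>t\<in>\<C>. open t" "insert l (range f) \<subseteq> \<Union>\<C>"
  then obtain U where U: "U \<in> \<C>" "l \<in> U" by blast
  then obtain N where N: "\<And>n. n \<ge> N \<Longrightarrow> f n \<in> U"
    using topological_tendstoD[OF assms, of U] \<C>(1) by (auto simp: eventually_sequentially)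
  have "\<exists>V\<in>\<C>. f n \<in> V" for n using \<C>(2) by blast
  then obtain V where V: "\<And>n. V n \<in> \<C>" "\<And>n. f n \<in> V n" by metis
  have "f n \<in> \<Union>(insert U (V ` {..<N}))" for n using N[of n] V(2)[of n] by (cases "n < N") auto
  then show "\<exists>C'\<subseteq>\<C>. finite C' \<and> insert l (range f) \<subseteq> \<Union>C'"
    using U V(1) by (intro exI[of _ "insert U (V ` {..<N})"]) auto
qed

lemma sup_norm_le: "(\<And>x. \<bar>f x\<bar> \<le> c) \<Longrightarrow> sup_norm f \<le> ennreal c"
  unfolding sup_norm_def by (intro SUP_least ennreal_leI)

lemma sup_norm_lessE:
  assumes "sup_norm f < ennreal e"
  obtains c where "0 \<le> c" "c < e" "\<And>x. \<bar>f x\<bar> \<le> c"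
proof -
  obtain c where c: "sup_norm f < c" "c < ennreal e" using dense[OF assms] by blast
  then have fin: "c = ennreal (enn2real c)" by (metis ennreal_enn2real ennreal_less_top less_trans)
  have "ennreal \<bar>f x\<bar> \<le> sup_norm f" for x unfolding sup_norm_def by (rule SUP_upper) simp
  then have "ennreal \<bar>f x\<bar> \<le> ennreal (enn2real c)" for x using c fin by (metis less_imp_le order_trans)
  then have "\<bar>f x\<bar> \<le> enn2real c" for x by (simp add: ennreal_le_iff)
  moreover have "enn2real c < e" using c(2) fin by (metis enn2real_nonneg ennreal_less_iff)
  ultimately show thesis using that enn2real_nonneg by blast
qed

lemma topspace_strict_topology [simp]: "topspace strict_topology = bcontfun"
proof
  show "topspace strict_topology \<subseteq> (bcontfun :: ('a \<Rightarrow> real) set)"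
    unfolding strict_topology_def by auto
  show "(bcontfun :: ('a \<Rightarrow> real) set) \<subseteq> topspace strict_topology"
  proof
    fix f :: "'a \<Rightarrow> real" assume f: "f \<in> bcontfun"
    have "(\<lambda>_. 0 :: real) \<in> vanishing_at_infinity" unfolding vanishing_at_infinity_def by auto
    moreover have "f \<in> {g \<in> bcontfun. sup_norm (\<lambda>x. 0 * (g x - f x)) < ennreal 1}"
      using f by (auto simp: sup_norm_def)
    ultimately show "f \<in> topspace strict_topology"
      unfolding strict_topology_def topology_generated_by_topspace using f zero_less_one by blast
  qed
qed

lemma openin_strict_topology:
  assumes "\<phi> \<in> vanishing_at_infinity" "f \<in> bcontfun" "0 < e"
  shows "openin strict_topology {g \<in> bcontfun. sup_norm (\<lambda>x. \<phi> x * (g x - f x)) < ennreal e}"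
  unfolding strict_topology_def by (rule topology_generated_by_Basis) (use assms in blast)

text \<open>The indicator of a point vanishes at infinity, so the weights include all point
  evaluations, which separate functions. The Hausdorff property makes compact sets closed.\<close>

lemma Hausdorff_strict_topology: "Hausdorff_space (strict_topology :: ('a::topological_space \<Rightarrow> real) topology)"
  unfolding Hausdorff_space_def topspace_strict_topology
proof (intro allI impI)
  fix f g :: "'a \<Rightarrow> real" assume fg: "f \<in> bcontfun \<and> g \<in> bcontfun \<and> f \<noteq> g"
  then obtain x where x: "f x \<noteq> g x" by auto
  define e where "e = \<bar>f x - g x\<bar> / 2"
  have e: "e > 0" using x by (simp add: e_def)
  have \<phi>: "indicator {x} \<in> (vanishing_at_infinity :: ('a \<Rightarrow> real) set)"
    unfolding vanishing_at_infinity_def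
  proof (intro CollectI conjI allI impI)
    show "bounded (range (indicator {x} :: 'a \<Rightarrow> real))" by (auto simp: bounded_iff indicator_def)
    fix \<epsilon> :: real assume "\<epsilon> > 0"
    then show "\<exists>K. compact K \<and> (\<forall>y. y \<notin> K \<longrightarrow> \<bar>indicator {x} y\<bar> \<le> \<epsilon>)" by (intro exI[of _ "{x}"]) auto
  qed
  define U where "U h = {k \<in> bcontfun. sup_norm (\<lambda>y. indicator {x} y * (k y - h y)) < ennreal e}" for h :: "'a \<Rightarrow> real"
  have U_mem: "h \<in> U h" if "h \<in> bcontfun" for h using that e by (simp add: U_def sup_norm_def)
  have near: "\<bar>k x - h x\<bar> < e" if "k \<in> U h" for k h
  proof -
    have "sup_norm (\<lambda>y. indicator {x} y * (k y - h y)) < ennreal e" using that by (simp add: U_def)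
    then obtain c where "c < e" "\<And>y. \<bar>indicator {x} y * (k y - h y)\<bar> \<le> c" by (elim sup_norm_lessE) (rule that)
    from this(1) this(2)[of x] show ?thesis by simp
  qed
  show "\<exists>U V. openin strict_topology U \<and> openin strict_topology V \<and> f \<in> U \<and> g \<in> V \<and> disjnt U V"
  proof (rule exI[of _ "U f"], rule exI[of _ "U g"], intro conjI)
    show "openin strict_topology (U f)" "openin strict_topology (U g)"
      unfolding U_def using fg openin_strict_topology[OF \<phi> _ e] by auto
    show "f \<in> U f" "g \<in> U g" using U_mem fg by auto
    have False if "k \<in> U f" "k \<in> U g" for k
      using near[OF that(1)] near[OF that(2)] abs_triangle_ineq[of "f x - k x" "k x - g x"]
      by (simp add: e_def abs_minus_commute)
    then show "disjnt (U f) (U g)" by (auto simp: disjnt_iff)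
  qed
qed

text \<open>On a bounded equicontinuous set the strict topology is coarser than pointwise convergence, so
  that Tychonoff's theorem applies.\<close>

lemma strict_relatively_compact:
  fixes S :: "('a::metric_space \<Rightarrow> real) set"
  assumes bd: "\<And>f x. f \<in> S \<Longrightarrow> \<bar>f x\<bar> \<le> C"
    and eq: "\<And>x e. e > 0 \<Longrightarrow> \<exists>d>0. \<forall>y. dist y x < d \<longrightarrow> (\<forall>f\<in>S. \<bar>f y - f x\<bar> \<le> e)"
  shows "relatively_compactin strict_topology S"
proof -
  have "\<exists>d. \<forall>x e. e > 0 \<longrightarrow> d x e > 0 \<and> (\<forall>y. dist y x < d x e \<longrightarrow> (\<forall>f\<in>S. \<bar>f y - f x\<bar> \<le> e))"
    by (intro choice allI) (use eq in blast)
  then obtain d where d: "\<And>x e. e > 0 \<Longrightarrow> d x e > 0"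
    and deq: "\<And>x e y f. e > 0 \<Longrightarrow> dist y x < d x e \<Longrightarrow> f \<in> S \<Longrightarrow> \<bar>f y - f x\<bar> \<le> e"
    by blast
  \<comment> \<open>Fixing the bound and one modulus \<open>d\<close> for all of \<open>S\<close>,
    with weak inequalities, makes \<open>E\<close> closed under pointwise limits.\<close>
  define E where "E = {g. (\<forall>x. \<bar>g x\<bar> \<le> C) \<and> (\<forall>x e y. e > 0 \<longrightarrow> dist y x < d x e \<longrightarrow> \<bar>g y - g x\<bar> \<le> e)}"
  have E_bd: "\<bar>g x\<bar> \<le> C" and E_eq: "e > 0 \<Longrightarrow> dist y x < d x e \<Longrightarrow> \<bar>g y - g x\<bar> \<le> e" if "g \<in> E" for g x y e
    using that by (auto simp: E_def)
  have SE: "S \<subseteq> E" using bd deq by (auto simp: E_def)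
  have EC: "E \<subseteq> bcontfun"
  proof
    fix g assume g: "g \<in> E"
    have "continuous_on UNIV g"
      unfolding continuous_on_iff
    proof (intro ballI allI impI)
      fix x :: 'a and e :: real assume "e > 0"
      then show "\<exists>\<delta>>0. \<forall>y\<in>UNIV. dist y x < \<delta> \<longrightarrow> dist (g y) (g x) < e"
        using E_eq[OF g, of "e / 2" _ x] d[of "e / 2" x]
        by (intro exI[of _ "d x (e / 2)"]) (fastforce simp: dist_real_def)
    qed
    moreover have "bounded (range g)" using E_bd[OF g] by (auto simp: bounded_iff)
    ultimately show "g \<in> bcontfun" by (simp add: bcontfun_def)
  qed
  have coord: "continuous_on UNIV (\<lambda>g :: 'a \<Rightarrow> real. g x)" for x
    by (rule continuous_on_product_coordinates)
  have "closed E"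
    unfolding E_def
    by (intro closed_Collect_conj closed_Collect_all closed_Collect_imp open_Collect_const closed_Collect_le
        continuous_intros coord)
  moreover have "compact (PiE UNIV (\<lambda>_::'a. {-C..C}))"
  proof -
    have "compactin (product_topology (\<lambda>_::'a. euclidean) UNIV) (PiE UNIV (\<lambda>_. {-C..C}))"
      by (subst compactin_PiE) auto
    then show ?thesis by (simp add: euclidean_product_topology)
  qed
  moreover have "E \<subseteq> PiE UNIV (\<lambda>_::'a. {-C..C})" 
  proof
    fix g assume "g \<in> E"
    from E_bd[OF this] have "-C \<le> g x \<and> g x \<le> C" for x by (simp add: abs_le_iff minus_le_iff)
    then show "g \<in> PiE UNIV (\<lambda>_::'a. {-C..C})" by auto
  qed
  ultimately have compE: "compact E" by (metis compact_Int_closed inf.absorb_iff2 inf_commute)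
  have "continuous_map (top_of_set E) strict_topology id"
    unfolding strict_topology_def
  proof (rule continuous_on_generated_topo)
    show "id ` topspace (top_of_set E) \<subseteq> \<Union> {{g \<in> bcontfun. sup_norm (\<lambda>x. \<phi> x * (g x - f x)) < ennreal \<epsilon>} |\<phi> f \<epsilon>.
        \<phi> \<in> vanishing_at_infinity \<and> f \<in> bcontfun \<and> 0 < \<epsilon>}"
      using EC unfolding topology_generated_by_topspace[symmetric] strict_topology_def[symmetric] by simp
    fix U :: "('a \<Rightarrow> real) set"
    assume "U \<in> {{g \<in> bcontfun. sup_norm (\<lambda>x. \<phi> x * (g x - f x)) < ennreal \<epsilon>} |\<phi> f \<epsilon>.
        \<phi> \<in> vanishing_at_infinity \<and> f \<in> bcontfun \<and> 0 < \<epsilon>}"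
    then obtain \<phi> f \<epsilon> where U: "U = {g \<in> bcontfun. sup_norm (\<lambda>x. \<phi> x * (g x - f x)) < ennreal \<epsilon>}"
      and \<phi>: "\<phi> \<in> vanishing_at_infinity" and \<epsilon>: "0 < \<epsilon>" by blast
    have "\<exists>T. openin (top_of_set E) T \<and> g0 \<in> T \<and> T \<subseteq> U \<inter> E" if g0: "g0 \<in> U \<inter> E" for g0
    proof -
      obtain c where c: "0 \<le> c" "c < \<epsilon>" "\<And>x. \<bar>\<phi> x * (g0 x - f x)\<bar> \<le> c"
      proof -
        have "sup_norm (\<lambda>x. \<phi> x * (g0 x - f x)) < ennreal \<epsilon>" using g0 U by auto
        then show thesis by (rule sup_norm_lessE) (rule that)
      qed
      define \<eta> where "\<eta> = (\<epsilon> - c) / 2"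
      have \<eta>: "\<eta> > 0" "c + \<eta> < \<epsilon>" using c by (auto simp: \<eta>_def field_simps)
      obtain \<Phi>' where "\<And>x. \<bar>\<phi> x\<bar> \<le> \<Phi>'" using \<phi> by (auto simp: vanishing_at_infinity_def bounded_iff)
      then obtain \<Phi> where \<Phi>: "\<Phi> > 0" "\<And>x. \<bar>\<phi> x\<bar> \<le> \<Phi>"
        by (metis less_max_iff_disj max.coboundedI1 zero_less_one)
      have C0: "C \<ge> 0" using E_bd[of g0 undefined] g0 by auto
      \<comment> \<open>Two members of \<open>E\<close> differ by at most \<open>2 * C\<close>, so
        outside \<open>X\<close> the weighted difference is at most \<open>\<eta>\<close>; the added
        1 covers \<open>C = 0\<close>.\<close>
      then have "\<eta> / (2 * C + 1) > 0" using \<eta> by simp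
      then obtain X where X: "compact X" "\<And>x. x \<notin> X \<Longrightarrow> \<bar>\<phi> x\<bar> \<le> \<eta> / (2 * C + 1)"
        using \<phi> unfolding vanishing_at_infinity_def by blast
      \<comment> \<open>On \<open>X\<close> the difference is estimated in three parts: from a point
        to a nearby point of the finite net \<open>I\<close> for each of the two functions, and
        between the functions at that net point.\<close>
      define \<delta> where "\<delta> = \<eta> / (3 * \<Phi>)"
      have \<delta>: "\<delta> > 0" "3 * \<delta> * \<Phi> = \<eta>" using \<eta> \<Phi> by (auto simp: \<delta>_def)
      have "X \<subseteq> (\<Union>x\<in>X. ball x (d x \<delta>))" using d[OF \<delta>(1)] by auto
      then obtain I where I: "I \<subseteq> X" "finite I" "X \<subseteq> (\<Union>x\<in>I. ball x (d x \<delta>))"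
        using compactE_image[OF X(1), of X "\<lambda>x. ball x (d x \<delta>)"] by (metis open_ball)
      define V where "V = (\<Inter>x\<in>I. {g :: 'a \<Rightarrow> real. \<bar>g x - g0 x\<bar> < \<delta>})"
      have "open V" unfolding V_def
        by (intro open_INT I(2) ballI open_Collect_less continuous_intros coord)
      have "g \<in> U" if g: "g \<in> E" "g \<in> V" for g
      proof -
        have small: "\<bar>\<phi> x * (g x - g0 x)\<bar> \<le> \<eta>" for x
        proof (cases "x \<in> X")
          case True
          then obtain y where y: "y \<in> I" "dist x y < d y \<delta>" using I(3) by (auto simp: dist_commute)
          have "\<bar>g x - g y\<bar> \<le> \<delta>" "\<bar>g0 x - g0 y\<bar> \<le> \<delta>" "\<bar>g y - g0 y\<bar> < \<delta>"
            using E_eq[OF _ \<delta>(1) y(2)] g g0 y(1) by (auto simp: V_def)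
          then have "\<bar>g x - g0 x\<bar> \<le> 3 * \<delta>" by linarith
          then have "\<bar>\<phi> x\<bar> * \<bar>g x - g0 x\<bar> \<le> \<Phi> * (3 * \<delta>)" using \<Phi> by (intro mult_mono) auto
          then show ?thesis using \<delta>(2) by (simp add: abs_mult mult_ac)
        next
          case False
          have "\<bar>g x - g0 x\<bar> \<le> 2 * C + 1" using E_bd[OF g(1), of x] E_bd[of g0 x] g0 by auto
          then have "\<bar>\<phi> x\<bar> * \<bar>g x - g0 x\<bar> \<le> (\<eta> / (2 * C + 1)) * (2 * C + 1)"
            using X(2)[OF False] \<eta> C0 by (intro mult_mono) auto
          then show ?thesis using C0 by (simp add: abs_mult)
        qed
        have "\<bar>\<phi> x * (g x - f x)\<bar> \<le> c + \<eta>" for x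
        proof -
          have "\<phi> x * (g x - f x) = \<phi> x * (g0 x - f x) + \<phi> x * (g x - g0 x)" by (simp add: algebra_simps)
          then show ?thesis using c(3)[of x] small[of x] by linarith
        qed
        then have "sup_norm (\<lambda>x. \<phi> x * (g x - f x)) \<le> ennreal (c + \<eta>)" by (rule sup_norm_le)
        also have "\<dots> < ennreal \<epsilon>" using \<eta> c by (intro ennreal_lessI) auto
        finally show ?thesis using U EC g by auto
      qed
      then have "E \<inter> V \<subseteq> U \<inter> E" by auto
      moreover have "g0 \<in> E \<inter> V" using g0 \<delta> by (auto simp: V_def)
      ultimately show ?thesis using openin_open_Int[OF \<open>open V\<close>, of E] by blast
    qed
    then have "openin (top_of_set E) (U \<inter> E)" by (subst openin_subopen) blast
    then show "openin (top_of_set E) (id -` U \<inter> topspace (top_of_set E))" by simp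
  qed
  from image_compactin[OF _ this, of E] have comp: "compactin strict_topology E"
    using compE by (simp add: compactin_subtopology)
  then have "closedin strict_topology E" by (intro compactin_imp_closedin Hausdorff_strict_topology)
  then have "strict_topology closure_of S \<subseteq> E" using SE by (intro closure_of_minimal)
  then have "compactin strict_topology (strict_topology closure_of S)"
    by (rule closed_compactin[OF comp _ closedin_closure_of])
  then show ?thesis using SE EC by (auto simp: relatively_compactin_def)
qed

context strong_feller_semigroup
begin

text \<open>A counterexample gives points \<open>y n\<close> tending to \<open>x\<close> and bounded
  functions \<open>f n\<close>. Along a subsequence \<open>P t0 (f n)\<close> converges pointwise,
  so a second \<open>P t0\<close> converges uniformly on the compact set formed by \<open>x\<close>
  and the points \<open>y n\<close>; continuity of the limit contradicts the gap
  \<open>e\<close>.\<close>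

lemma equicontinuous_P_P:
  assumes e: "e > 0"
  shows "\<exists>d>0. \<forall>y. dist y x < d \<longrightarrow>
    (\<forall>f\<in>bounded_borel. (\<forall>z. \<bar>f z\<bar> \<le> C) \<longrightarrow> \<bar>P t0 (P t0 f) y - P t0 (P t0 f) x\<bar> \<le> e)"
proof (rule ccontr)
  assume neg: "\<not> ?thesis"
  have "\<exists>y f. dist y x < 1 / real (Suc n) \<and> f \<in> bounded_borel \<and> (\<forall>z. \<bar>f z\<bar> \<le> C) \<and>
      \<bar>P t0 (P t0 f) y - P t0 (P t0 f) x\<bar> > e" for n
  proof (rule ccontr)
    assume "\<not> ?thesis"
    then have "\<forall>y. dist y x < 1 / real (Suc n) \<longrightarrow>
        (\<forall>f\<in>bounded_borel. (\<forall>z. \<bar>f z\<bar> \<le> C) \<longrightarrow> \<bar>P t0 (P t0 f) y - P t0 (P t0 f) x\<bar> \<le> e)"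
      by (metis linorder_not_le)
    then show False using neg by (metis of_nat_0_less_iff zero_less_Suc zero_less_divide_1_iff)
  qed
  then obtain y f where y: "\<And>n. dist (y n) x < 1 / real (Suc n)" and f: "\<And>n. f n \<in> bounded_borel" "\<And>n z. \<bar>f n z\<bar> \<le> C"
    and far: "\<And>n. \<bar>P t0 (P t0 (f n)) (y n) - P t0 (P t0 (f n)) x\<bar> > e" by metis
  obtain r g where r: "strict_mono r" and g: "g \<in> bounded_borel" and lim: "\<And>x. (\<lambda>n. P t0 (f (r n)) x) \<longlonglongrightarrow> g x"
    using pointwise_compact[of f C, OF f] by blast
  have "(\<lambda>n. dist (y n) x) \<longlonglongrightarrow> 0"
    by (rule tendsto_sandwich[OF _ _ tendsto_const LIMSEQ_inverse_real_of_nat])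
      (use y in \<open>auto intro!: always_eventually less_imp_le simp: inverse_eq_divide\<close>)
  then have "y \<longlonglongrightarrow> x" by (subst tendsto_dist_iff)
  then have yr: "(\<lambda>n. y (r n)) \<longlonglongrightarrow> x" using LIMSEQ_subseq_LIMSEQ[OF _ r, of y x] by (simp add: o_def)
  define X where "X = insert x (range (\<lambda>n. y (r n)))"
  have X: "compact X" unfolding X_def by (rule compact_insert_range_LIMSEQ[OF yr])
  have unif: "uniform_limit X (\<lambda>n. P t0 (P t0 (f (r n)))) (P t0 g) sequentially"
    by (rule P_uniform_limit[OF _ _ lim X, where C="M * C"]) (use f t0_pos P_bound in auto)
  have "isCont (P t0 g) x" using feller[OF g] by (simp add: continuous_on_eq_continuous_at)
  then have cont: "(\<lambda>n. P t0 g (y (r n))) \<longlonglongrightarrow> P t0 g x" using yr by (rule isCont_tendsto_compose)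
  have "\<forall>\<^sub>F n in sequentially. \<bar>P t0 g (y (r n)) - P t0 g x\<bar> < e / 3"
    using tendstoD[OF cont, of "e / 3"] e by (simp add: dist_real_def)
  moreover have "\<forall>\<^sub>F n in sequentially. \<forall>z\<in>X. dist (P t0 (P t0 (f (r n))) z) (P t0 g z) < e / 3"
    using uniform_limitD[OF unif, of "e / 3"] e by simp
  ultimately have "\<forall>\<^sub>F n in sequentially. False"
  proof eventually_elim
    case (elim n)
    have "dist (P t0 (P t0 (f (r n))) (y (r n))) (P t0 g (y (r n))) < e / 3" "dist (P t0 (P t0 (f (r n))) x) (P t0 g x) < e / 3"
      using elim(2) by (auto simp: X_def)
    then show False using elim(1) far[of "r n"] unfolding dist_real_def by linarith
  qed
  then show False by simp
qed

end

section \<open>The limit operator of a pointwise convergent semigroup\<close>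

locale convergent_semigroup = strong_feller_semigroup K M t0
  for K :: "real \<Rightarrow> 'a::polish_space \<Rightarrow> 'a measure" and M t0 :: real +
  fixes Q :: "('a \<Rightarrow> real) \<Rightarrow> ('a \<Rightarrow> real)"
  assumes Q_bounded_borel: "f \<in> bounded_borel \<Longrightarrow> Q f \<in> bounded_borel"
    and Q_tendsto: "f \<in> bounded_borel \<Longrightarrow> ((\<lambda>t. P t f x) \<longlongrightarrow> Q f x) at_top"
begin

lemma Q_LIMSEQ:
  assumes "f \<in> bounded_borel" "filterlim s at_top sequentially" shows "(\<lambda>n. P (s n) f x) \<longlonglongrightarrow> Q f x"
  by (rule filterlim_compose[OF Q_tendsto[OF assms(1)] assms(2)])

text \<open>By the Nikodym convergence theorem the limit functional at each point is again given by
  a measure.\<close>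

lemma daniell_Q: "daniell (\<lambda>f. Q f x)"
  by (rule daniell_limit[of "\<lambda>n f. P (real (Suc n)) f x"]) (use daniell_P Q_LIMSEQ real_Suc_at_top in auto)

lemma Q_bound: assumes "f \<in> bounded_borel" "\<And>x. \<bar>f x\<bar> \<le> C" shows "\<bar>Q f x\<bar> \<le> M * C"
  by (rule LIMSEQ_le_const2[OF tendsto_rabs[OF Q_LIMSEQ[OF assms(1) real_Suc_at_top]]]) (use P_bound[OF _ assms] in auto)

lemma Q_P: assumes f: "f \<in> bounded_borel" and s: "s > 0" shows "Q (P s f) = Q f"
proof
  fix x
  have "(\<lambda>n. P (real (Suc n)) (P s f) x) \<longlonglongrightarrow> Q (P s f) x"
    using f s by (intro Q_LIMSEQ real_Suc_at_top) auto
  moreover have "P (real (Suc n)) (P s f) = P (s + real (Suc n)) f" for n using P_semigroup[OF s _ f] by (simp add: add.commute)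
  moreover have "(\<lambda>n. P (s + real (Suc n)) f x) \<longlonglongrightarrow> Q f x"
    by (intro Q_LIMSEQ f filterlim_tendsto_add_at_top[OF tendsto_const real_Suc_at_top])
  ultimately show "Q (P s f) x = Q f x" using LIMSEQ_unique by force
qed

lemma P_Q: assumes f: "f \<in> bounded_borel" and s: "s > 0" shows "P s (Q f) = Q f"
proof
  fix x
  obtain C where C: "\<And>x. \<bar>f x\<bar> \<le> C" using f by (metis bounded_borelE)
  have "(\<lambda>n. P s (P (real (Suc n)) f) x) \<longlonglongrightarrow> P s (Q f) x"
    by (rule P_DCT[OF s _ _ Q_LIMSEQ[OF f real_Suc_at_top], where C="M * C"]) (use f P_bound[OF _ f C] in auto)
  moreover have "P s (P (real (Suc n)) f) = P (s + real (Suc n)) f" for n using P_semigroup[OF _ s f] by simp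
  moreover have "(\<lambda>n. P (s + real (Suc n)) f x) \<longlonglongrightarrow> Q f x"
    by (intro Q_LIMSEQ f filterlim_tendsto_add_at_top[OF tendsto_const real_Suc_at_top])
  ultimately show "P s (Q f) x = Q f x" using LIMSEQ_unique by force
qed

text \<open>\<open>Q f = P t0 (Q f)\<close> lies in the range of the strongly Feller
  operator.\<close>

lemma continuous_Q: "f \<in> bounded_borel \<Longrightarrow> continuous_on UNIV (Q f)"
  using feller[OF Q_bounded_borel] P_Q[OF _ t0_pos] by metis

text \<open>The times left after splitting off one \<open>P t0\<close> must still tend to
  infinity.\<close>

lemma at_top_sequence:
  fixes Pr :: "real \<Rightarrow> bool"
  assumes "\<not> eventually Pr at_top"
  obtains t :: "nat \<Rightarrow> real" where "\<And>n. \<not> Pr (t n)" "\<And>n. t0 < t n"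
    "filterlim (\<lambda>n. t n - t0) at_top sequentially"
proof -
  have "\<exists>t. \<not> Pr t \<and> t \<ge> real n + t0 + 1" for n
    using assms unfolding eventually_at_top_linorder by blast
  then obtain t where t: "\<And>n. \<not> Pr (t n)" "\<And>n. t n \<ge> real n + t0 + 1" by metis
  have ge: "real n \<le> t n - t0" for n using t(2)[of n] by linarith
  then have "filterlim (\<lambda>n. t n - t0) at_top sequentially"
    by (intro filterlim_at_top_mono[OF filterlim_real_sequentially]) auto
  moreover have "t0 < t n" for n using t(2)[of n] by linarith
  ultimately show thesis using that t ge by blast
qed

text \<open>Along any sequence of times, \<open>P (t n) f\<close> is \<open>P t0\<close> applied to
  a bounded, pointwise convergent sequence, so \<open>P_uniform_limit\<close> applies and its limit
  is \<open>P t0 (Q f) = Q f\<close>.\<close>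

lemma uniform_limit_Q:
  assumes f: "f \<in> bounded_borel" and X: "compact X"
  shows "uniform_limit X (\<lambda>t. P t f) (Q f) at_top"
proof (rule ccontr)
  assume "\<not> ?thesis"
  then obtain e where e: "e > 0" and neg: "\<not> (\<forall>\<^sub>F t in at_top. \<forall>x\<in>X. dist (P t f x) (Q f x) < e)"
    unfolding uniform_limit_iff by blast
  obtain t where t: "\<And>n. \<not> (\<forall>x\<in>X. dist (P (t n) f x) (Q f x) < e)" "\<And>n. t0 < t n"
    and top: "filterlim (\<lambda>n. t n - t0) at_top sequentially"
    using at_top_sequence[OF neg] by metis
  obtain C where C: "\<And>x. \<bar>f x\<bar> \<le> C" using f by (metis bounded_borelE)
  have "uniform_limit X (\<lambda>n. P t0 (P (t n - t0) f)) (P t0 (Q f)) sequentially"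
    by (rule P_uniform_limit[OF _ _ Q_LIMSEQ[OF f top] X, where C="M * C"])
      (use t(2) f P_bound[OF _ f C] in auto)
  moreover have "P t0 (P (t n - t0) f) = P (t n) f" for n
    using P_semigroup[of "t n - t0" t0 f] t(2)[of n] t0_pos f by simp
  ultimately have "uniform_limit X (\<lambda>n. P (t n) f) (Q f) sequentially" using P_Q[OF f t0_pos] by simp
  then have "\<forall>\<^sub>F n in sequentially. \<forall>x\<in>X. dist (P (t n) f x) (Q f x) < e" using e unfolding uniform_limit_iff by blast
  then show False using t(1) by (auto simp: eventually_sequentially)
qed

text \<open>Convergence uniformly in \<open>A\<close>: a counterexample sequence \<open>A n\<close> is replaced by \<open>P t0 1\<^sub>A\<close>, which
  converges pointwise along a subsequence, and domination by a decreasing sequence \<open>h\<close> makes the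
  convergence uniform in \<open>n\<close>.\<close>

lemma uniform_setwise_convergence:
  assumes \<nu>: "finite_borel \<nu>" and e: "e > 0"
  shows "\<forall>\<^sub>F t in at_top. \<forall>A\<in>sets borel. \<bar>integral\<^sup>L \<nu> (P t (indicator A)) - integral\<^sup>L \<nu> (Q (indicator A))\<bar> < e"
proof (rule ccontr)
  assume neg: "\<not> ?thesis"
  obtain t where t: "\<And>n. \<not> (\<forall>A\<in>sets borel. \<bar>integral\<^sup>L \<nu> (P (t n) (indicator A)) - integral\<^sup>L \<nu> (Q (indicator A))\<bar> < e)"
    "\<And>n. t0 < t n" and top: "filterlim (\<lambda>n. t n - t0) at_top sequentially"
    using at_top_sequence[OF neg] by metis
  then obtain A where A: "\<And>n. A n \<in> sets borel"
    and far: "\<And>n. \<bar>integral\<^sup>L \<nu> (P (t n) (indicator (A n))) - integral\<^sup>L \<nu> (Q (indicator (A n)))\<bar> \<ge> e"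
    by (metis linorder_not_le)
  have ind: "indicator (A n) \<in> bounded_borel" "\<bar>indicator (A n) x :: real\<bar> \<le> 1" for n x
    using A by (auto simp: indicator_def)
  obtain r g where r: "strict_mono r" and g: "g \<in> bounded_borel"
    and lim: "\<And>x. (\<lambda>n. P t0 (indicator (A (r n))) x) \<longlonglongrightarrow> g x"
    using pointwise_compact[of "\<lambda>n. indicator (A n)" 1, OF ind] by blast
  define v where "v n = P t0 (indicator (A (r n)))" for n
  have v: "v n \<in> bounded_borel" "\<bar>v n x\<bar> \<le> M" for n x
    using ind t0_pos P_bound[OF t0_pos ind(1) ind(2)] by (auto simp: v_def)
  obtain h where h: "\<And>n. h n \<in> bounded_borel" and up: "\<And>m n x. n \<le> m \<Longrightarrow> \<bar>v m x - g x\<bar> \<le> h n x"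
    and h2: "\<And>n x. \<bar>h n x\<bar> \<le> 2 * M" and hdec: "\<And>x. decseq (\<lambda>n. h n x)" and hlim: "\<And>x. (\<lambda>n. h n x) \<longlonglongrightarrow> 0"
    using tail_supremum[OF v lim[folded v_def]] by blast
  define s where "s n = t (r n) - t0" for n
  have s: "s n > 0" for n using t(2)[of "r n"] by (simp add: s_def)
  have s_top: "filterlim s at_top sequentially"
    unfolding s_def using filterlim_compose[OF top filterlim_subseq[OF r]] by (simp add: o_def)
  have Pv: "P (t (r n)) (indicator (A (r n))) = P (s n) (v n)" for n
    using P_semigroup[OF t0_pos s ind(1), of n "r n"] by (simp add: s_def v_def)
  have Qv: "Q (indicator (A (r n))) = Q (v n)" for n
    unfolding v_def using Q_P[OF ind(1) t0_pos] by simp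
  note int = integrable_bounded_borel[OF \<nu>]
  have limP: "(\<lambda>n. integral\<^sup>L \<nu> (P (s n) f)) \<longlonglongrightarrow> integral\<^sup>L \<nu> (Q f)" if f: "f \<in> bounded_borel" for f
  proof -
    obtain C where C: "\<And>x. \<bar>f x\<bar> \<le> C" using f by (metis bounded_borelE)
    show ?thesis
      by (rule bounded_borel_DCT[OF \<nu>, where C="M * C"])
        (use f s P_bound[OF s f C] Q_LIMSEQ[OF f s_top] Q_bounded_borel in auto)
  qed
  have "(\<lambda>n. integral\<^sup>L \<nu> (Q (h n))) \<longlonglongrightarrow> integral\<^sup>L \<nu> (\<lambda>_. 0)"
    by (rule bounded_borel_DCT[OF \<nu>, where C="M * (2 * M)"])
      (use Q_bounded_borel h Q_bound[OF h h2] daniellD(4)[OF daniell_Q h hdec hlim] in auto)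
  then have "\<forall>\<^sub>F n in sequentially. integral\<^sup>L \<nu> (Q (h n)) < e / 4"
    by (rule order_tendstoD) (use e in auto)
  \<comment> \<open>The index \<open>m\<close> is fixed by means of \<open>Q\<close> alone; then
    \<open>P (s n) (h m)\<close> tends to \<open>Q (h m)\<close>. Comparing \<open>v n\<close> with
    \<open>g\<close> under both operators costs two quarters of \<open>e\<close>, and the
    convergence at \<open>g\<close> a third one.\<close>
  then obtain m where m: "integral\<^sup>L \<nu> (Q (h m)) < e / 4" by (auto simp: eventually_sequentially)
  have "\<forall>\<^sub>F n in sequentially. integral\<^sup>L \<nu> (P (s n) (h m)) < e / 4"
    by (rule order_tendstoD(2)[OF limP[OF h] m])
  moreover have "\<forall>\<^sub>F n in sequentially. \<bar>integral\<^sup>L \<nu> (P (s n) g) - integral\<^sup>L \<nu> (Q g)\<bar> < e / 4"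
    using tendstoD[OF limP[OF g], of "e / 4"] e by (simp add: dist_real_def)
  ultimately have "\<forall>\<^sub>F n in sequentially. False"
    using eventually_ge_at_top[of m]
  proof eventually_elim
    case (elim n)
    have le: "\<bar>\<Psi> (v n) - \<Psi> g\<bar> \<le> \<Psi> (h m)" if "daniell \<Psi>" for \<Psi>
    proof -
      have "\<Psi> (\<lambda>x. v n x - g x) \<le> \<Psi> (h m)" "\<Psi> (\<lambda>x. g x - v n x) \<le> \<Psi> (h m)"
        using up[OF elim(3)] by (auto intro!: daniell_mono[OF that] bounded_borel_diff v g h simp: abs_le_iff minus_diff_eq)
      then show ?thesis using daniell_diff[OF that v(1) g] daniell_diff[OF that g v(1)] by (simp add: abs_le_iff)
    qed
    have P1: "\<bar>integral\<^sup>L \<nu> (P (s n) (v n)) - integral\<^sup>L \<nu> (P (s n) g)\<bar> \<le> integral\<^sup>L \<nu> (P (s n) (h m))"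
    proof -
      have "\<bar>integral\<^sup>L \<nu> (P (s n) (v n)) - integral\<^sup>L \<nu> (P (s n) g)\<bar> = \<bar>\<integral>x. P (s n) (v n) x - P (s n) g x \<partial>\<nu>\<bar>"
        by (subst Bochner_Integration.integral_diff) (intro int P_bounded_borel s v g refl)+
      also have "\<dots> \<le> (\<integral>x. \<bar>P (s n) (v n) x - P (s n) g x\<bar> \<partial>\<nu>)" by (rule integral_abs_bound)
      also have "\<dots> \<le> integral\<^sup>L \<nu> (P (s n) (h m))"
        by (intro integral_mono int le[OF daniell_P[OF s]] bounded_borel_abs bounded_borel_diff P_bounded_borel s v g h)
      finally show ?thesis .
    qed
    have Q1: "\<bar>integral\<^sup>L \<nu> (Q (v n)) - integral\<^sup>L \<nu> (Q g)\<bar> \<le> integral\<^sup>L \<nu> (Q (h m))"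
    proof -
      have "\<bar>integral\<^sup>L \<nu> (Q (v n)) - integral\<^sup>L \<nu> (Q g)\<bar> = \<bar>\<integral>x. Q (v n) x - Q g x \<partial>\<nu>\<bar>"
        by (subst Bochner_Integration.integral_diff) (intro int Q_bounded_borel v g refl)+
      also have "\<dots> \<le> (\<integral>x. \<bar>Q (v n) x - Q g x\<bar> \<partial>\<nu>)" by (rule integral_abs_bound)
      also have "\<dots> \<le> integral\<^sup>L \<nu> (Q (h m))"
        by (intro integral_mono int le[OF daniell_Q] bounded_borel_abs bounded_borel_diff Q_bounded_borel v g h)
      finally show ?thesis .
    qed
    show False using P1 Q1 elim m far[of "r n"] unfolding Pv Qv by linarith
  qed
  then show False by simp
qed

end

section \<open>Signed measures\<close>

lemma signed_measuresD:
  assumes "\<nu> \<in> signed_measures"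
  shows "\<nu> {} = 0" "A \<notin> sets borel \<Longrightarrow> \<nu> A = 0"
    "(\<And>n::nat. A' n \<in> sets borel) \<Longrightarrow> disjoint_family A' \<Longrightarrow> (\<lambda>n. \<nu> (A' n)) sums \<nu> (\<Union>n. A' n)"
  using assms unfolding signed_measures_def by auto

lemma signed_measure_Un:
  assumes \<nu>: "\<nu> \<in> signed_measures" and AB: "A \<in> sets borel" "B \<in> sets borel" "A \<inter> B = {}"
  shows "\<nu> (A \<union> B) = \<nu> A + \<nu> B"
proof -
  have "(\<lambda>n. \<nu> (binaryset A B n)) sums \<nu> (\<Union>n. binaryset A B n)"
    using AB by (intro signed_measuresD(3)[OF \<nu>]) (auto simp: binaryset_def disjoint_family_on_def)
  moreover have "(\<lambda>n. \<nu> (binaryset A B n)) sums (\<nu> A + \<nu> B)"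
    by (rule binaryset_sums[of \<nu>, OF signed_measuresD(1)[OF \<nu>]])
  ultimately show ?thesis using sums_unique2 by (simp add: UN_binaryset_eq)
qed

lemma signed_measure_Diff:
  assumes "\<nu> \<in> signed_measures" "A \<in> sets borel" "B \<in> sets borel" "B \<subseteq> A"
  shows "\<nu> (A - B) = \<nu> A - \<nu> B"
proof -
  have "\<nu> ((A - B) \<union> B) = \<nu> (A - B) + \<nu> B" using assms by (intro signed_measure_Un) auto
  moreover have "(A - B) \<union> B = A" using assms(4) by auto
  ultimately show ?thesis by simp
qed

lemma signed_measure_diff:
  assumes "\<mu> \<in> signed_measures" "\<nu> \<in> signed_measures"
  shows "(\<lambda>A. \<mu> A - \<nu> A) \<in> signed_measures"
  using assms unfolding signed_measures_def by (auto intro!: sums_diff)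

lemma signed_measure_uminus: "\<nu> \<in> signed_measures \<Longrightarrow> (\<lambda>A. - \<nu> A) \<in> signed_measures"
  unfolding signed_measures_def by (auto intro!: sums_minus)

lemma signed_measure_measure: assumes "finite_borel M" shows "measure M \<in> signed_measures"
proof -
  interpret finite_measure M by (rule finite_borelD[OF assms])
  show ?thesis
    unfolding signed_measures_def
    using finite_borelD(2)[OF assms] by (auto intro!: finite_measure_UNION measure_notin_sets)
qed

text \<open>A set function unbounded on the subsets of \<open>E\<close> is unbounded on some \<open>E' \<subseteq> E\<close> with
  \<open>\<bar>\<nu> (E - E')\<bar> \<ge> 1\<close>; iterating yields infinitely many disjoint sets of large measure.\<close>

lemma signed_measure_bounded:
  assumes \<nu>: "\<nu> \<in> signed_measures"
  obtains C where "\<And>A. A \<in> sets borel \<Longrightarrow> \<bar>\<nu> A\<bar> \<le> C"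
proof (rule ccontr)
  assume no_bound: "\<not> thesis"
  define bad where "bad E \<longleftrightarrow> E \<in> sets borel \<and> (\<forall>C. \<exists>B\<in>sets borel. B \<subseteq> E \<and> \<bar>\<nu> B\<bar> > C)" for E
  have "bad UNIV" unfolding bad_def using no_bound that by (auto simp: not_le[symmetric])
  have step: "\<exists>E'. bad E' \<and> E' \<subseteq> E \<and> \<bar>\<nu> (E - E')\<bar> \<ge> 1" if E: "bad E" for E
  proof -
    have Eb: "E \<in> sets borel" using E by (simp add: bad_def)
    \<comment> \<open>The excess over \<open>\<bar>\<nu> E\<bar>\<close> makes both \<open>B\<close>
      and \<open>E - B\<close> large in absolute value. One of the two is bad again, and the other
      one is the part that is removed.\<close>
    obtain B where B: "B \<in> sets borel" "B \<subseteq> E" "\<bar>\<nu> B\<bar> > \<bar>\<nu> E\<bar> + 1" using E unfolding bad_def by blast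
    have diff: "\<nu> (E - B) = \<nu> E - \<nu> B" by (rule signed_measure_Diff[OF \<nu> Eb B(1,2)])
    have "bad B \<or> bad (E - B)"
    proof (rule ccontr)
      assume "\<not> ?thesis"
      then obtain C1 C2 where C: "\<And>X. X \<in> sets borel \<Longrightarrow> X \<subseteq> B \<Longrightarrow> \<bar>\<nu> X\<bar> \<le> C1"
        "\<And>X. X \<in> sets borel \<Longrightarrow> X \<subseteq> E - B \<Longrightarrow> \<bar>\<nu> X\<bar> \<le> C2"
        using B Eb unfolding bad_def by (metis linorder_not_le sets.Diff)
      obtain X where X: "X \<in> sets borel" "X \<subseteq> E" "\<bar>\<nu> X\<bar> > C1 + C2" using E unfolding bad_def by blast
      have "\<nu> X = \<nu> (X \<inter> B) + \<nu> (X - B)"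
        using signed_measure_Un[OF \<nu>, of "X \<inter> B" "X - B"] X B by (simp add: Int_Diff_Un Int_Diff_disjoint)
      moreover have "\<bar>\<nu> (X \<inter> B)\<bar> \<le> C1" "\<bar>\<nu> (X - B)\<bar> \<le> C2" using X B by (auto intro!: C)
      ultimately show False using X by linarith
    qed
    then show ?thesis
    proof
      assume "bad B"
      then show ?thesis using B diff by (intro exI[of _ B]) auto
    next
      assume "bad (E - B)"
      moreover have "E - (E - B) = B" using B by auto
      ultimately show ?thesis using B by (intro exI[of _ "E - B"]) auto
    qed
  qed
  have "\<exists>E. \<forall>n::nat. bad (E n) \<and> (E (Suc n) \<subseteq> E n \<and> \<bar>\<nu> (E n - E (Suc n))\<bar> \<ge> 1)"
    by (rule dependent_nat_choice) (use \<open>bad UNIV\<close> step in auto)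
  then obtain E where E: "\<And>n::nat. bad (E n)" "\<And>n. E (Suc n) \<subseteq> E n" "\<And>n. \<bar>\<nu> (E n - E (Suc n))\<bar> \<ge> 1" by blast
  have "E n \<subseteq> E m" if "m \<le> n" for m n using that by (induction n rule: dec_induct) (use E(2) in auto)
  then have sub: "E n \<subseteq> E (Suc m)" if "m < n" for m n using that Suc_leI by blast
  have "disjoint_family (\<lambda>n. E n - E (Suc n))"
    unfolding disjoint_family_on_def
  proof (intro ballI impI)
    fix m n :: nat assume "m \<noteq> n"
    then consider "m < n" | "n < m" by linarith
    then show "(E m - E (Suc m)) \<inter> (E n - E (Suc n)) = {}" by cases (use sub in blast)+
  qed
  then have "(\<lambda>n. \<nu> (E n - E (Suc n))) sums \<nu> (\<Union>n. E n - E (Suc n))"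
    using E(1) by (intro signed_measuresD(3)[OF \<nu>]) (auto simp: bad_def)
  then have "(\<lambda>n. \<nu> (E n - E (Suc n))) \<longlonglongrightarrow> 0" by (intro summable_LIMSEQ_zero sums_summable)
  from tendstoD[OF this zero_less_one] obtain n where "\<bar>\<nu> (E n - E (Suc n))\<bar> < 1" by (auto simp: eventually_sequentially)
  then show False using E(3)[of n] by simp
qed

section \<open>Jordan decomposition and pairing\<close>

definition upper_variation :: "('a::topological_space set \<Rightarrow> real) \<Rightarrow> 'a set \<Rightarrow> real" where
  "upper_variation \<nu> A = (SUP B\<in>{B \<in> sets borel. B \<subseteq> A}. \<nu> B)"

lemma upper_variation_upper:
  assumes \<nu>: "\<nu> \<in> signed_measures" and "B \<in> sets borel" "B \<subseteq> A"
  shows "\<nu> B \<le> upper_variation \<nu> A"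
proof -
  obtain C where C: "\<And>A. A \<in> sets borel \<Longrightarrow> \<bar>\<nu> A\<bar> \<le> C" using signed_measure_bounded[OF \<nu>] by blast
  have "bdd_above (\<nu> ` {B \<in> sets borel. B \<subseteq> A})"
    by (rule bdd_aboveI[of _ C]) (use C in \<open>auto simp: abs_le_iff\<close>)
  then show ?thesis unfolding upper_variation_def using assms by (intro cSUP_upper) auto
qed

lemma upper_variation_least:
  assumes "\<And>B. B \<in> sets borel \<Longrightarrow> B \<subseteq> A \<Longrightarrow> \<nu> B \<le> c"
  shows "upper_variation \<nu> A \<le> c"
  unfolding upper_variation_def by (rule cSUP_least) (use assms in auto)

lemma upper_variation_nonneg: "\<nu> \<in> signed_measures \<Longrightarrow> 0 \<le> upper_variation \<nu> A"
  using upper_variation_upper[of \<nu> "{}" A] signed_measuresD(1)[of \<nu>] by simp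

text \<open>No Hahn decomposition is involved. Superadditivity on disjoint sets bounds the partial
  sums from above; conversely, a Borel subset \<open>B\<close> of the union is cut into the pieces
  \<open>B \<inter> A n\<close>, each estimated by its own upper variation.\<close>

lemma upper_variation_sums:
  assumes \<nu>: "\<nu> \<in> signed_measures" and A: "\<And>n::nat. A n \<in> sets borel" "disjoint_family A"
  shows "(\<lambda>n. upper_variation \<nu> (A n)) sums upper_variation \<nu> (\<Union>n. A n)"
proof -
  let ?p = "upper_variation \<nu>"
  have mono: "?p X \<le> ?p Y" if "X \<subseteq> Y" for X Y
    by (rule upper_variation_least) (use that in \<open>auto intro!: upper_variation_upper[OF \<nu>]\<close>)
  have super: "?p X + ?p Y \<le> ?p (X \<union> Y)" if "X \<inter> Y = {}" for X Y
  proof -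
    have "\<nu> X' + ?p Y \<le> ?p (X \<union> Y)" if X': "X' \<in> sets borel" "X' \<subseteq> X" for X'
    proof -
      have "\<nu> Y' \<le> ?p (X \<union> Y) - \<nu> X'" if Y': "Y' \<in> sets borel" "Y' \<subseteq> Y" for Y'
      proof -
        have "\<nu> X' + \<nu> Y' = \<nu> (X' \<union> Y')"
          using X' Y' \<open>X \<inter> Y = {}\<close> by (intro signed_measure_Un[OF \<nu>, symmetric]) auto
        also have "\<dots> \<le> ?p (X \<union> Y)" using X' Y' by (intro upper_variation_upper[OF \<nu>]) auto
        finally show ?thesis by simp
      qed
      then have "?p Y \<le> ?p (X \<union> Y) - \<nu> X'" by (rule upper_variation_least)
      then show ?thesis by simp
    qed
    then have "\<nu> X' \<le> ?p (X \<union> Y) - ?p Y" if "X' \<in> sets borel" "X' \<subseteq> X" for X'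
      using that by (simp add: le_diff_eq)
    then have "?p X \<le> ?p (X \<union> Y) - ?p Y" by (rule upper_variation_least)
    then show ?thesis by simp
  qed
  have partial: "(\<Sum>i<n. ?p (A i)) \<le> ?p (\<Union>i<n. A i)" for n
  proof (induction n)
    case 0 then show ?case using upper_variation_nonneg[OF \<nu>] by simp
  next
    case (Suc n)
    have "A i \<inter> A n = {}" if "i < n" for i using disjoint_family_onD[OF A(2), of i n] that by simp
    then have "(\<Union>i<n. A i) \<inter> A n = {}" by blast
    then have "?p (\<Union>i<n. A i) + ?p (A n) \<le> ?p ((\<Union>i<n. A i) \<union> A n)" by (rule super)
    also have "(\<Union>i<n. A i) \<union> A n = (\<Union>i<Suc n. A i)" by (auto simp: less_Suc_eq)
    finally show ?case using Suc by simp
  qed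
  have le: "(\<Sum>i<n. ?p (A i)) \<le> ?p (\<Union>i. A i)" for n
    by (rule order_trans[OF partial mono]) auto
  have sm: "summable (\<lambda>n. ?p (A n))"
    by (rule summableI_nonneg_bounded[OF upper_variation_nonneg[OF \<nu>] le])
  have "?p (\<Union>n. A n) \<le> (\<Sum>n. ?p (A n))"
  proof (rule upper_variation_least)
    fix B assume B: "B \<in> sets borel" "B \<subseteq> (\<Union>n. A n)"
    have "(\<lambda>n. \<nu> (B \<inter> A n)) sums \<nu> (\<Union>n. B \<inter> A n)"
      using A B by (intro signed_measuresD(3)[OF \<nu>]) (auto simp: disjoint_family_on_def)
    moreover have "(\<Union>n. B \<inter> A n) = B" using B by auto
    ultimately have s: "(\<lambda>n. \<nu> (B \<inter> A n)) sums \<nu> B" by simp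
    show "\<nu> B \<le> (\<Sum>n. ?p (A n))"
      by (rule sums_le[OF _ s summable_sums[OF sm]]) (use A B in \<open>auto intro!: upper_variation_upper[OF \<nu>]\<close>)
  qed
  moreover have "(\<Sum>n. ?p (A n)) \<le> ?p (\<Union>n. A n)" by (rule suminf_le_const[OF sm le])
  ultimately show ?thesis using summable_sums[OF sm] by (metis order_antisym)
qed

text \<open>Boundedness of signed measures makes the extended supremum in the definition finite, so
  it is the real supremum \<open>upper_variation\<close>.\<close>

lemma positive_part:
  assumes \<nu>: "\<nu> \<in> signed_measures"
  shows finite_borel_positive_part: "finite_borel (positive_part \<nu>)"
    and measure_positive_part: "A \<in> sets borel \<Longrightarrow> measure (positive_part \<nu>) A = upper_variation \<nu> A"
proof -
  let ?p = "upper_variation \<nu>"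
  let ?f = "\<lambda>A. SUP B\<in>{B \<in> sets borel. B \<subseteq> A}. ennreal (\<nu> B)"
  note p0 = upper_variation_nonneg[OF \<nu>]
  have f: "?f A = ennreal (?p A)" for A
  proof (rule antisym)
    show le: "?f A \<le> ennreal (?p A)" by (intro SUP_least ennreal_leI upper_variation_upper[OF \<nu>]) auto
    define s where "s = enn2real (?f A)"
    have "?f A < top" using le by (rule le_less_trans) simp
    then have s: "?f A = ennreal s" unfolding s_def by (rule ennreal_enn2real[symmetric])
    have "\<nu> B \<le> s" if "B \<in> sets borel" "B \<subseteq> A" for B
    proof -
      have "ennreal (\<nu> B) \<le> ennreal s" unfolding s[symmetric] using that by (intro SUP_upper) auto
      then show ?thesis by (simp add: ennreal_le_iff s_def)
    qed
    then have "?p A \<le> s" by (rule upper_variation_least)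
    then show "ennreal (?p A) \<le> ?f A" unfolding s by (rule ennreal_leI)
  qed
  have def: "positive_part \<nu> = measure_of UNIV (sets borel) (\<lambda>A. ennreal (?p A))"
    unfolding positive_part_def f ..
  have sets: "sets (positive_part \<nu>) = sets borel" "space (positive_part \<nu>) = UNIV"
    unfolding def by (simp_all add: sigma_algebra.sets_measure_of_eq[OF sets.sigma_algebra_axioms[of borel, simplified]])
  have em: "emeasure (positive_part \<nu>) A = ennreal (?p A)" if "A \<in> sets borel" for A
    unfolding def
  proof (rule emeasure_measure_of_sigma)
    show "sigma_algebra UNIV (sets borel)" using sets.sigma_algebra_axioms[of borel] by simp
    have "?p {} \<le> 0" by (rule upper_variation_least) (use signed_measuresD(1)[OF \<nu>] in auto)
    then show "positive (sets borel) (\<lambda>A. ennreal (?p A))" by (auto simp: positive_def ennreal_eq_0_iff)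
    show "countably_additive (sets borel) (\<lambda>A. ennreal (?p A))"
    proof (rule countably_additiveI)
      fix A :: "nat \<Rightarrow> 'a set" assume "range A \<subseteq> sets borel" "disjoint_family A"
      then show "(\<Sum>i. ennreal (?p (A i))) = ennreal (?p (\<Union>i. A i))"
        by (intro suminf_ennreal_eq p0 upper_variation_sums[OF \<nu>]) auto
    qed
  qed (use that in auto)
  show "finite_borel (positive_part \<nu>)"
    unfolding finite_borel_def using sets em[of UNIV] by (auto intro!: finite_measureI)
  show "measure (positive_part \<nu>) A = ?p A" if "A \<in> sets borel"
    using em[OF that] p0 by (simp add: measure_def)
qed

text \<open>For \<open>B \<subseteq> A\<close>, the value
  \<open>\<nu> B = \<nu> A - \<nu> (A - B)\<close> is at most \<open>\<nu> A\<close> plus the upper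
  variation of \<open>-\<nu>\<close>. The supremum over \<open>B\<close> gives one inequality, and
  the same for \<open>-\<nu>\<close> the other.\<close>

lemma Jordan_decomposition:
  assumes \<nu>: "\<nu> \<in> signed_measures" and A: "A \<in> sets borel"
  shows "\<nu> A = measure (positive_part \<nu>) A - measure (positive_part (\<lambda>A. - \<nu> A)) A"
proof -
  have le: "upper_variation \<mu> A \<le> \<mu> A + upper_variation (\<lambda>A. - \<mu> A) A" if \<mu>: "\<mu> \<in> signed_measures" for \<mu>
  proof (rule upper_variation_least)
    fix B assume B: "B \<in> sets borel" "B \<subseteq> A"
    have "- \<mu> (A - B) \<le> upper_variation (\<lambda>A. - \<mu> A) A"
      using upper_variation_upper[OF signed_measure_uminus[OF \<mu>], of "A - B" A] A B by auto
    then show "\<mu> B \<le> \<mu> A + upper_variation (\<lambda>A. - \<mu> A) A" using signed_measure_Diff[OF \<mu> A B] by simp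
  qed
  show ?thesis
    using le[OF \<nu>] le[OF signed_measure_uminus[OF \<nu>]] measure_positive_part[OF \<nu> A]
      measure_positive_part[OF signed_measure_uminus[OF \<nu>] A] by simp
qed

text \<open>The pairing can be computed from any representation as a difference of two functionals,
  which need not be the Jordan parts.\<close>

lemma pairing_eqI:
  assumes \<nu>: "\<nu> \<in> signed_measures" and D: "daniell \<Phi>" "daniell \<Psi>"
    and eq: "\<And>A. A \<in> sets borel \<Longrightarrow> \<nu> A = \<Phi> (indicator A) - \<Psi> (indicator A)"
    and f: "f \<in> bounded_borel"
  shows "pairing \<nu> f = \<Phi> f - \<Psi> f"
  using f
proof (induction rule: bounded_borel_induct)
  note fin = finite_borel_positive_part[OF \<nu>] finite_borel_positive_part[OF signed_measure_uminus[OF \<nu>]]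
  note pd = daniell_integral[OF fin(1)] daniell_integral[OF fin(2)]
  {
    case (indicator A)
    then show ?case using Jordan_decomposition[OF \<nu>] eq finite_borelD[OF fin(1)] finite_borelD[OF fin(2)]
      by (simp add: pairing_def)
  next
    case (add f g)
    then show ?case
      using daniellD(1)[OF pd(1)] daniellD(1)[OF pd(2)] daniellD(1)[OF D(1)] daniellD(1)[OF D(2)] by (simp add: pairing_def)
  next
    case (cmult f c)
    then show ?case
      using daniellD(2)[OF D(1)] daniellD(2)[OF D(2)] by (simp add: pairing_def flip: right_diff_distrib)
  next
    case (lim F f)
    have "(\<lambda>n. pairing \<nu> (F n)) \<longlonglongrightarrow> pairing \<nu> f"
      unfolding pairing_def by (intro tendsto_diff daniell_incseq[OF pd(1) lim(1-4)] daniell_incseq[OF pd(2) lim(1-4)])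
    moreover have "(\<lambda>n. \<Phi> (F n) - \<Psi> (F n)) \<longlonglongrightarrow> \<Phi> f - \<Psi> f"
      by (intro tendsto_diff daniell_incseq[OF D(1) lim(1-4)] daniell_incseq[OF D(2) lim(1-4)])
    ultimately show ?case using lim(5) LIMSEQ_unique by simp
  }
qed

lemma daniell_zero: "daniell (\<lambda>_. 0)"
  by (simp add: daniell_def)

lemma pairing_measure:
  assumes "finite_borel M" "f \<in> bounded_borel" shows "pairing (measure M) f = integral\<^sup>L M f"
  using pairing_eqI[OF signed_measure_measure daniell_integral daniell_zero, OF assms(1,1) _ assms(2)]
    finite_borelD[OF assms(1)] by simp

text \<open>The factor 2 comes from estimating the two Jordan parts separately.\<close>

lemma abs_pairing_le:
  assumes \<nu>: "\<nu> \<in> signed_measures" and e: "\<And>A. A \<in> sets borel \<Longrightarrow> \<bar>\<nu> A\<bar> \<le> e"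
    and f: "f \<in> bounded_borel" "\<And>x. \<bar>f x\<bar> \<le> C"
  shows "\<bar>pairing \<nu> f\<bar> \<le> 2 * (C * e)"
proof -
  have C: "C \<ge> 0" using f(2)[of undefined] by linarith
  have le: "\<bar>integral\<^sup>L (positive_part \<mu>) f\<bar> \<le> C * e"
    if \<mu>: "\<mu> \<in> signed_measures" "\<And>A. A \<in> sets borel \<Longrightarrow> \<bar>\<mu> A\<bar> \<le> e" for \<mu>
  proof -
    note fin = finite_borel_positive_part[OF \<mu>(1)]
    have "\<bar>integral\<^sup>L (positive_part \<mu>) f\<bar> \<le> (\<integral>x. \<bar>f x\<bar> \<partial>positive_part \<mu>)" by (rule integral_abs_bound)
    also have "\<dots> \<le> (\<integral>x. C \<partial>positive_part \<mu>)"
      by (intro integral_mono integrable_bounded_borel[OF fin] f bounded_borel_abs bounded_borel_const)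
    also have "\<dots> = C * upper_variation \<mu> UNIV"
      using finite_borelD[OF fin] measure_positive_part[OF \<mu>(1), of UNIV] by simp
    also have "\<dots> \<le> C * e"
      using \<mu>(2) C by (intro mult_left_mono upper_variation_least) (auto simp: abs_le_iff)
    finally show ?thesis .
  qed
  show ?thesis
    using le[OF \<nu> e] le[OF signed_measure_uminus[OF \<nu>]] e unfolding pairing_def by fastforce
qed

section \<open>The total variation norm\<close>

lemma abs_le_tv_norm:
  assumes "A \<in> sets borel" shows "ennreal \<bar>\<nu> A\<bar> \<le> tv_norm \<nu>"
proof -
  let ?P = "{A, UNIV - A}"
  have "ennreal \<bar>\<nu> A\<bar> \<le> (\<Sum>B\<in>?P. ennreal \<bar>\<nu> B\<bar>)" by (rule member_le_sum) auto
  also have "\<dots> \<le> tv_norm \<nu>"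
    unfolding tv_norm_def total_variation_def using assms
    by (intro SUP_upper) (auto simp: disjoint_def)
  finally show ?thesis .
qed

lemma signed_measure_Union:
  assumes \<nu>: "\<nu> \<in> signed_measures" and "finite P" "disjoint P" "P \<subseteq> sets borel"
  shows "\<nu> (\<Union>P) = (\<Sum>B\<in>P. \<nu> B)"
  using assms(2-4)
proof (induction P rule: finite_induct)
  case empty then show ?case using signed_measuresD(1)[OF \<nu>] by simp
next
  case (insert B P)
  have "B \<inter> \<Union>P = {}" using insert by (auto simp: disjoint_def)
  moreover have "\<Union>P \<in> sets borel" using insert by auto
  ultimately have "\<nu> (B \<union> \<Union>P) = \<nu> B + \<nu> (\<Union>P)" using insert by (intro signed_measure_Un[OF \<nu>]) auto
  then show ?case using insert by (simp add: disjoint_def)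
qed

text \<open>Grouping the cells of a partition by the sign of \<open>\<nu>\<close> leaves only two
  sets. Norm convergence is thereby reduced to convergence uniform over Borel sets.\<close>

lemma tv_norm_le:
  assumes \<nu>: "\<nu> \<in> signed_measures" and e: "\<And>A. A \<in> sets borel \<Longrightarrow> \<bar>\<nu> A\<bar> \<le> e"
  shows "tv_norm \<nu> \<le> ennreal (2 * e)"
  unfolding tv_norm_def total_variation_def
proof (rule SUP_least)
  fix P :: "'a set set" assume P: "P \<in> {P. finite P \<and> disjoint P \<and> P \<subseteq> sets borel \<and> \<Union>P = UNIV}"
  define P1 P2 where "P1 = {B \<in> P. \<nu> B \<ge> 0}" and "P2 = {B \<in> P. \<not> \<nu> B \<ge> 0}"
  have un: "\<nu> (\<Union>R) = (\<Sum>B\<in>R. \<nu> B)" and meas: "\<Union>R \<in> sets borel" if "R \<subseteq> P" for R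
  proof -
    have R: "finite R" "disjoint R" "R \<subseteq> sets borel"
      using P that by (auto intro: finite_subset pairwise_subset)
    show "\<nu> (\<Union>R) = (\<Sum>B\<in>R. \<nu> B)" by (rule signed_measure_Union[OF \<nu> R])
    show "\<Union>R \<in> sets borel" by (rule sets.finite_Union[OF R(1,3)])
  qed
  have "(\<Sum>B\<in>P. ennreal \<bar>\<nu> B\<bar>) = ennreal (\<Sum>B\<in>P. \<bar>\<nu> B\<bar>)" by (rule sum_ennreal) auto
  also have "(\<Sum>B\<in>P. \<bar>\<nu> B\<bar>) = (\<Sum>B\<in>P1. \<bar>\<nu> B\<bar>) + (\<Sum>B\<in>P2. \<bar>\<nu> B\<bar>)"
  proof -
    have "P = P1 \<union> P2" "P1 \<inter> P2 = {}" "finite P1" "finite P2" using P by (auto simp: P1_def P2_def)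
    then show ?thesis using sum.union_disjoint by metis
  qed
  also have "\<dots> = \<nu> (\<Union>P1) - \<nu> (\<Union>P2)"
    using un[of P1] un[of P2] by (simp add: P1_def P2_def sum_negf[symmetric])
  also have "\<dots> \<le> 2 * e"
    using e[OF meas[of P1]] e[OF meas[of P2]] by (auto simp: P1_def P2_def abs_le_iff)
  finally show "(\<Sum>B\<in>P. ennreal \<bar>\<nu> B\<bar>) \<le> ennreal (2 * e)" by (simp add: ennreal_leI)
qed

lemma tendsto_tv_norm_zeroI:
  assumes \<nu>: "\<forall>\<^sub>F t in F. \<nu> t \<in> signed_measures"
    and lim: "\<And>e. e > 0 \<Longrightarrow> \<forall>\<^sub>F t in F. \<forall>A\<in>sets borel. \<bar>\<nu> t A\<bar> \<le> e"
  shows "((\<lambda>t. tv_norm (\<nu> t)) \<longlongrightarrow> 0) F"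
proof (rule order_tendstoI)
  fix a :: ennreal assume "0 < a"
  \<comment> \<open>\<open>a\<close> may be infinite; a number strictly below it is real.\<close>
  then obtain b where b: "0 < b" "b < a" using dense by blast
  then have "b = ennreal (enn2real b)" by (metis ennreal_enn2real ennreal_less_top less_trans top.not_eq_extremum)
  then have pos: "enn2real b > 0" using b(1) by (metis enn2real_nonneg ennreal_0 less_irrefl order_le_less)
  then have "\<forall>\<^sub>F t in F. \<forall>A\<in>sets borel. \<bar>\<nu> t A\<bar> \<le> enn2real b / 2" by (intro lim) simp
  then show "\<forall>\<^sub>F t in F. tv_norm (\<nu> t) < a"
    using \<nu>
  proof eventually_elim
    case (elim t)
    have "tv_norm (\<nu> t) \<le> ennreal (2 * (enn2real b / 2))" using elim by (intro tv_norm_le) auto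
    also have "\<dots> = b" using \<open>b = ennreal (enn2real b)\<close> by simp
    finally show ?case using b(2) by simp
  qed
qed simp

section \<open>Transition semigroups\<close>

text \<open>The functional of the measure obtained from \<open>\<kappa>\<close> by the dual of
  \<open>R\<close>. Continuity follows by dominated convergence, since \<open>R (F n)\<close> stays
  between 0 and \<open>R (F 0)\<close>.\<close>

lemma daniell_comp:
  fixes R :: "('a::topological_space \<Rightarrow> real) \<Rightarrow> 'a \<Rightarrow> real"
  assumes \<kappa>: "finite_borel \<kappa>" and R: "\<And>x. daniell (\<lambda>f. R f x)" "\<And>f. f \<in> bounded_borel \<Longrightarrow> R f \<in> bounded_borel"
  shows "daniell (\<lambda>f. integral\<^sup>L \<kappa> (R f))"
  unfolding daniell_def
proof (intro conjI ballI allI impI)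
  note int = integrable_bounded_borel[OF \<kappa> R(2)]
  fix f g :: "'a \<Rightarrow> real"
  assume f: "f \<in> bounded_borel" and g: "g \<in> bounded_borel"
  have "R (\<lambda>x. f x + g x) = (\<lambda>x. R f x + R g x)" using daniellD(1)[OF R(1) f g] by auto
  then show "integral\<^sup>L \<kappa> (R (\<lambda>x. f x + g x)) = integral\<^sup>L \<kappa> (R f) + integral\<^sup>L \<kappa> (R g)"
    using int[OF f] int[OF g] by simp
next
  fix f :: "'a \<Rightarrow> real" and c assume f: "f \<in> bounded_borel"
  have "R (\<lambda>x. c * f x) = (\<lambda>x. c * R f x)" using daniellD(2)[OF R(1) f] by auto
  then show "integral\<^sup>L \<kappa> (R (\<lambda>x. c * f x)) = c * integral\<^sup>L \<kappa> (R f)" by simp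
next
  fix f :: "'a \<Rightarrow> real" assume "f \<in> bounded_borel" "\<forall>x. 0 \<le> f x"
  then show "0 \<le> integral\<^sup>L \<kappa> (R f)" using daniellD(3)[OF R(1)] by (intro integral_nonneg_AE) auto
next
  fix F :: "nat \<Rightarrow> 'a \<Rightarrow> real"
  assume F: "\<forall>n. F n \<in> bounded_borel" "\<forall>x. decseq (\<lambda>n. F n x)" "\<forall>x. (\<lambda>n. F n x) \<longlonglongrightarrow> 0"
  obtain C where C: "\<And>x. \<bar>R (F 0) x\<bar> \<le> C" using R(2) F(1) by (metis bounded_borelE)
  have bd: "\<bar>R (F n) x\<bar> \<le> C" for n x
  proof -
    have "0 \<le> F n x" for x by (rule decseq_ge[OF F(2)[rule_format] F(3)[rule_format]])
    then have "0 \<le> R (F n) x" using F(1) by (intro daniellD(3)[OF R(1)]) auto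
    moreover have "F n x \<le> F 0 x" for x using F(2) by (auto simp: decseq_def)
    then have "R (F n) x \<le> R (F 0) x" using F(1) by (intro daniell_mono[OF R(1)]) auto
    ultimately show ?thesis using C[of x] by simp
  qed
  have "(\<lambda>n. integral\<^sup>L \<kappa> (R (F n))) \<longlonglongrightarrow> integral\<^sup>L \<kappa> (\<lambda>_. 0)"
    by (rule bounded_borel_DCT[OF \<kappa> _ bd]) (use F R(2) daniellD(4)[OF R(1)] in auto)
  then show "(\<lambda>n. integral\<^sup>L \<kappa> (R (F n))) \<longlonglongrightarrow> 0" by simp
qed

lemma dirac_measure:
  obtains M :: "'a::topological_space measure" where "finite_borel M" "\<And>f. f \<in> bounded_borel \<Longrightarrow> integral\<^sup>L M f = f x"
proof -
  have "daniell (\<lambda>f :: 'a \<Rightarrow> real. f x)" by (simp add: daniell_def)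
  then show thesis by (rule daniell_representation) (use that in metis)
qed

lemma measure_eq_integral: "finite_borel M \<Longrightarrow> A \<in> sets borel \<Longrightarrow> measure M A = integral\<^sup>L M (indicator A)"
  using finite_borelD[of M] by simp

lemma measure_not_borel: "finite_borel M \<Longrightarrow> A \<notin> sets borel \<Longrightarrow> measure M A = 0"
  using finite_borelD(2)[of M] by (simp add: measure_notin_sets)

context kernel_semigroup
begin

text \<open>The mass \<open>\<integral> P t f d\<kappa>\<close> increases in \<open>t\<close> for \<open>f \<ge> 0\<close>; the limit functional is the invariant measure.\<close>

lemma invariant_majorant:
  assumes \<kappa>: "finite_borel \<kappa>" and sub: "\<And>A t. A \<in> sets borel \<Longrightarrow> t > 0 \<Longrightarrow> measure \<kappa> A \<le> integral\<^sup>L \<kappa> (P t (indicator A))"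
  obtains \<omega> where "invariant \<omega>" "\<And>f. f \<in> bounded_borel \<Longrightarrow> (\<And>x. 0 \<le> f x) \<Longrightarrow> integral\<^sup>L \<kappa> f \<le> integral\<^sup>L \<omega> f"
proof -
  have DP: "daniell (\<lambda>f. integral\<^sup>L \<kappa> (P t f))" if "t > 0" for t
    using that by (intro daniell_comp[OF \<kappa>] daniell_P) auto
  have le: "integral\<^sup>L \<kappa> f \<le> integral\<^sup>L \<kappa> (P t f)" if t: "t > 0" and f: "f \<in> bounded_borel" "\<And>x. 0 \<le> f x" for t f
  proof -
    obtain N where N: "finite_borel N" "\<And>f. f \<in> bounded_borel \<Longrightarrow> integral\<^sup>L \<kappa> (P t f) = integral\<^sup>L N f"
      using daniell_representation[OF DP[OF t]] by metis
    note s = finite_borelD[OF \<kappa>] finite_borelD[OF N(1)]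
    interpret \<kappa>: finite_measure \<kappa> by (rule s)
    interpret N: finite_measure N by (rule s)
    \<comment> \<open>The hypothesis on sets is an inequality between the measures
      \<open>\<kappa>\<close> and \<open>N\<close>, and so extends to integrals of nonnegative
      functions.\<close>
    have "emeasure \<kappa> A \<le> emeasure N A" if "A \<in> sets borel" for A
      using sub[OF that t] N(2)[of "indicator A"] measure_eq_integral[OF N(1) that] that
      by (simp add: \<kappa>.emeasure_eq_measure N.emeasure_eq_measure)
    then have "\<kappa> \<le> N" using s by (subst le_measure) auto
    then have "(\<integral>\<^sup>+x. ennreal (f x) \<partial>\<kappa>) \<le> (\<integral>\<^sup>+x. ennreal (f x) \<partial>N)" using s by (intro nn_integral_mono_measure) auto
    then have "ennreal (integral\<^sup>L \<kappa> f) \<le> ennreal (integral\<^sup>L N f)"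
      using f by (simp add: nn_integral_eq_integral integrable_bounded_borel[OF \<kappa>] integrable_bounded_borel[OF N(1)])
    then show ?thesis using N(2)[OF f(1)] daniellD(3)[OF daniell_integral[OF N(1)] f] by (simp add: ennreal_le_iff)
  qed
  have mono: "integral\<^sup>L \<kappa> (P s f) \<le> integral\<^sup>L \<kappa> (P t f)" if "0 < s" "s \<le> t" "f \<in> bounded_borel" "\<And>x. 0 \<le> f x" for s t f
  proof (cases "s = t")
    case False
    then have "P t f = P (t - s) (P s f)" using P_semigroup[of s "t - s" f] that by simp
    then show ?thesis using le[of "t - s" "P s f"] that False P_nonneg[of s f] by auto
  qed simp
  have conv_pos: "convergent (\<lambda>n. integral\<^sup>L \<kappa> (P (real (Suc n)) f))" if f: "f \<in> bounded_borel" "\<And>x. 0 \<le> f x" for f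
  proof -
    obtain C where C: "\<And>x. \<bar>f x\<bar> \<le> C" using f(1) by (metis bounded_borelE)
    have "\<bar>integral\<^sup>L \<kappa> (P (real (Suc n)) f)\<bar> \<le> M * C * measure \<kappa> UNIV" for n
    proof -
      have "\<bar>integral\<^sup>L \<kappa> (P (real (Suc n)) f)\<bar> \<le> (\<integral>x. \<bar>P (real (Suc n)) f x\<bar> \<partial>\<kappa>)" by (rule integral_abs_bound)
      also have "\<dots> \<le> (\<integral>x. M * C \<partial>\<kappa>)"
        by (intro integral_mono integrable_bounded_borel[OF \<kappa>] bounded_borel_abs bounded_borel_const P_bounded_borel P_bound f C) auto
      also have "\<dots> = M * C * measure \<kappa> UNIV" using finite_borelD[OF \<kappa>] by simp
      finally show ?thesis .
    qed
    then show ?thesis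
      by (intro Bseq_mono_convergent) (use mono[OF _ _ f] in \<open>auto intro!: BseqI'\<close>)
  qed
  have conv: "convergent (\<lambda>n. integral\<^sup>L \<kappa> (P (real (Suc n)) f))" if f: "f \<in> bounded_borel" for f
  proof -
    obtain C where C: "C > 0" "\<And>x. \<bar>f x\<bar> \<le> C" using f by (metis bounded_borelE)
    \<comment> \<open>Monotonicity in time needs a nonnegative function; adding a constant reduces a
      bounded function to this case. The same device is used below for invariance.\<close>
    have "0 \<le> f x + C" for x using C(2)[of x] by linarith
    then have "convergent (\<lambda>n. integral\<^sup>L \<kappa> (P (real (Suc n)) (\<lambda>x. f x + C)) - integral\<^sup>L \<kappa> (P (real (Suc n)) (\<lambda>_. C)))"
      using f C(1) by (intro convergent_diff conv_pos) auto
    moreover have "integral\<^sup>L \<kappa> (P (real (Suc n)) (\<lambda>x. f x + C)) - integral\<^sup>L \<kappa> (P (real (Suc n)) (\<lambda>_. C)) = integral\<^sup>L \<kappa> (P (real (Suc n)) f)" for n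
      using daniellD(1)[OF DP f bounded_borel_const[of C], of "real (Suc n)"] by simp
    ultimately show ?thesis by simp
  qed
  define \<Psi> where "\<Psi> f = lim (\<lambda>n. integral\<^sup>L \<kappa> (P (real (Suc n)) f))" for f
  have lim: "(\<lambda>n. integral\<^sup>L \<kappa> (P (real (Suc n)) f)) \<longlonglongrightarrow> \<Psi> f" if "f \<in> bounded_borel" for f
    using conv[OF that] unfolding \<Psi>_def by (simp add: convergent_LIMSEQ_iff)
  have "daniell \<Psi>" by (rule daniell_limit[OF DP lim]) auto
  then obtain \<omega> where \<omega>: "finite_borel \<omega>" "\<And>f. f \<in> bounded_borel \<Longrightarrow> \<Psi> f = integral\<^sup>L \<omega> f"
    by (elim daniell_representation) blast
  have upper: "integral\<^sup>L \<kappa> (P t f) \<le> \<Psi> f" if t: "t > 0" and f: "f \<in> bounded_borel" "\<And>x. 0 \<le> f x" for t f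
  proof (rule LIMSEQ_le_const[OF lim[OF f(1)]])
    show "\<exists>N. \<forall>n\<ge>N. integral\<^sup>L \<kappa> (P t f) \<le> integral\<^sup>L \<kappa> (P (real (Suc n)) f)"
      by (rule exI[of _ "nat \<lceil>t\<rceil>"]) (use t in \<open>auto intro!: mono f\<close>)
  qed
  have inv_pos: "\<Psi> (P s f) = \<Psi> f" if s: "s > 0" and f: "f \<in> bounded_borel" "\<And>x. 0 \<le> f x" for s f
  proof (rule LIMSEQ_unique[OF lim])
    show "P s f \<in> bounded_borel" using s f by auto
    have eq: "P (real (Suc n)) (P s f) = P (real (Suc n) + s) f" for n using P_semigroup[OF s _ f(1)] by simp
    show "(\<lambda>n. integral\<^sup>L \<kappa> (P (real (Suc n)) (P s f))) \<longlonglongrightarrow> \<Psi> f"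
    proof (rule tendsto_sandwich[OF _ _ lim[OF f(1)] tendsto_const])
      show "\<forall>\<^sub>F n in sequentially. integral\<^sup>L \<kappa> (P (real (Suc n)) f) \<le> integral\<^sup>L \<kappa> (P (real (Suc n)) (P s f))"
        unfolding eq using s by (intro always_eventually allI mono f) auto
      show "\<forall>\<^sub>F n in sequentially. integral\<^sup>L \<kappa> (P (real (Suc n)) (P s f)) \<le> \<Psi> f"
        unfolding eq using s by (intro always_eventually allI upper f) auto
    qed
  qed
  show thesis
  proof (rule that)
    show "invariant \<omega>"
      unfolding invariant_def
    proof (intro conjI allI impI ballI \<omega>)
      fix s :: real and f :: "'a \<Rightarrow> real" assume s: "s > 0" and f: "f \<in> bounded_borel"
      obtain C where C: "C > 0" "\<And>x. \<bar>f x\<bar> \<le> C" using f by (metis bounded_borelE)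
      have pos: "0 \<le> f x + C" for x using C(2)[of x] by linarith
      note D = daniellD(1)[OF \<open>daniell \<Psi>\<close>]
      have "P s (\<lambda>x. f x + C) = (\<lambda>x. P s f x + P s (\<lambda>_. C) x)" using P_add[OF s f] by auto
      then have "\<Psi> (P s f) + \<Psi> (P s (\<lambda>_. C)) = \<Psi> (P s (\<lambda>x. f x + C))" 
        using D[OF P_bounded_borel[OF s f] P_bounded_borel[OF s bounded_borel_const]] by simp
      also have "\<dots> = \<Psi> f + \<Psi> (\<lambda>_. C)" 
        using inv_pos[OF s bounded_borel_add[OF f bounded_borel_const] pos] D[OF f bounded_borel_const] by simp
      also have "\<Psi> (\<lambda>_. C) = \<Psi> (P s (\<lambda>_. C))" using inv_pos[OF s, of "\<lambda>_. C"] C(1) by simp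
      finally show "integral\<^sup>L \<omega> (P s f) = integral\<^sup>L \<omega> f" 
        using \<omega>(2)[OF f] \<omega>(2)[OF P_bounded_borel[OF s f]] by simp
    qed
    show "integral\<^sup>L \<kappa> f \<le> integral\<^sup>L \<omega> f" if "f \<in> bounded_borel" "\<And>x. 0 \<le> f x" for f
      using le[OF zero_less_one that] upper[OF zero_less_one that] \<omega>(2)[OF that(1)] by simp
  qed
qed

end

text \<open>A nonnegative signed measure is monotone, so it coincides with its upper variation and
  its negative part contributes nothing; the pairing becomes an ordinary integral.\<close>

lemma has_kernel_positive:
  assumes "has_kernel T k" "positive_kernel k"
  shows kernel_finite_borel: "finite_borel (positive_part (k x))"
    and kernel_measure: "measure (positive_part (k x)) A = k x A"
    and kernel_integral: "f \<in> bounded_borel \<Longrightarrow> T f x = integral\<^sup>L (positive_part (k x)) f"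
    and kernel_measurable: "f \<in> bounded_borel \<Longrightarrow> (\<lambda>x. integral\<^sup>L (positive_part (k x)) f) \<in> borel_measurable borel"
proof -
  have sm: "k x \<in> signed_measures" for x using assms(1) by (auto simp: has_kernel_def bounded_kernel_def)
  have pos: "0 \<le> k x A" for x A using assms(2) by (auto simp: positive_kernel_def)
  show fin: "finite_borel (positive_part (k x))" for x by (rule finite_borel_positive_part[OF sm])
  show m: "measure (positive_part (k x)) A = k x A" for x A
  proof (cases "A \<in> sets borel")
    case True
    have "upper_variation (k x) A = k x A"
    proof (rule antisym)
      show "k x A \<le> upper_variation (k x) A" by (rule upper_variation_upper[OF sm True]) simp
      show "upper_variation (k x) A \<le> k x A"
      proof (rule upper_variation_least)
        fix B assume "B \<in> sets borel" "B \<subseteq> A"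
        then show "k x B \<le> k x A" using signed_measure_Diff[OF sm True, of B x] pos[of x "A - B"] by simp
      qed
    qed
    then show ?thesis using measure_positive_part[OF sm True] by simp
  qed (use signed_measuresD(2)[OF sm] measure_not_borel[OF fin] in simp)
  show "T f x = integral\<^sup>L (positive_part (k x)) f" if "f \<in> bounded_borel"
    using pairing_eqI[OF sm daniell_integral[OF fin] daniell_zero _ that, of x x] m measure_eq_integral[OF fin] assms(1) that
    by (simp add: has_kernel_def)
  show "(\<lambda>x. integral\<^sup>L (positive_part (k x)) f) \<in> borel_measurable borel" if "f \<in> bounded_borel"
    using that
  proof (induction rule: bounded_borel_induct)
    case (indicator A)
    then have "(\<lambda>x. integral\<^sup>L (positive_part (k x)) (indicator A)) = (\<lambda>x. k x A)"
      using measure_eq_integral[OF fin] m by metis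
    then show ?case using assms(1) indicator by (simp add: has_kernel_def bounded_kernel_def)
  next
    case (add f g)
    then show ?case by (simp add: integrable_bounded_borel[OF fin])
  next
    case (cmult f c)
    then show ?case by simp
  next
    case (lim F f)
    show ?case
      by (rule borel_measurable_LIMSEQ_real[OF daniell_incseq[OF daniell_integral[OF fin] lim(1-4)] lim(5)])
  qed
qed

section \<open>The given operators in terms of measures\<close>

locale transition_semigroup =
  fixes T :: "real \<Rightarrow> ('a::polish_space \<Rightarrow> real) \<Rightarrow> ('a \<Rightarrow> real)"
    and k :: "real \<Rightarrow> 'a \<Rightarrow> 'a set \<Rightarrow> real"
    and S :: "real \<Rightarrow> ('a set \<Rightarrow> real) \<Rightarrow> ('a set \<Rightarrow> real)"
    and t0 :: real
  assumes kernel: "\<And>t. t > 0 \<Longrightarrow> has_kernel (T t) (k t)"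
    and positive: "\<And>t. t > 0 \<Longrightarrow> positive_kernel (k t)"
    and semigroup: "bounded_semigroup T"
    and dual: "\<And>t. t > 0 \<Longrightarrow> S t = dual_operator (k t)"
    and t0_pos: "t0 > 0" and feller: "strongly_feller (T t0)"
begin

definition K :: "real \<Rightarrow> 'a \<Rightarrow> 'a measure" where
  "K t x = positive_part (k t x)"

definition bnd :: real where
  "bnd = enn2real (SUP t\<in>{0<..}. op_norm (T t))"

lemma measure_K: "t > 0 \<Longrightarrow> measure (K t x) A = k t x A"
  unfolding K_def by (rule kernel_measure[OF kernel positive])

lemma T_eq: "t > 0 \<Longrightarrow> f \<in> bounded_borel \<Longrightarrow> T t f = (\<lambda>x. integral\<^sup>L (K t x) f)"
  unfolding K_def using kernel_integral[OF kernel positive] by auto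

lemma k_bound: assumes t: "t > 0" shows "k t x UNIV \<le> bnd"
proof -
  \<comment> \<open>The constant function 1 is an admissible test function, and its image is the
    total mass of the kernel.\<close>
  have one: "(\<lambda>_. 1) \<in> {f \<in> bounded_borel. sup_norm f \<le> 1}" by (auto simp: sup_norm_def)
  have "T t (\<lambda>_. 1) x = k t x UNIV"
    using T_eq[OF t, of "\<lambda>_. 1"] measure_K[OF t, of x UNIV] finite_borelD(3)[OF kernel_finite_borel[OF kernel positive], OF t t, of x]
    by (simp add: K_def)
  then have "ennreal (k t x UNIV) \<le> sup_norm (T t (\<lambda>_. 1))"
    unfolding sup_norm_def using SUP_upper[of x UNIV "\<lambda>x. ennreal \<bar>T t (\<lambda>_. 1) x\<bar>"] positive[OF t]
    by (simp add: positive_kernel_def)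
  also have "\<dots> \<le> op_norm (T t)" unfolding op_norm_def by (rule SUP_upper[OF one])
  also have "\<dots> \<le> (SUP t\<in>{0<..}. op_norm (T t))" using t by (intro SUP_upper) auto
  also have "\<dots> = ennreal bnd"
    using semigroup unfolding bounded_semigroup_def bnd_def by (simp add: ennreal_enn2real)
  finally show ?thesis by (simp add: ennreal_le_iff bnd_def)
qed

sublocale kernel_semigroup K bnd
proof
  show fin: "finite_borel (K t x)" if "t > 0" for t x
    unfolding K_def by (rule kernel_finite_borel[OF kernel[OF that] positive[OF that]])
  show meas: "(\<lambda>x. integral\<^sup>L (K t x) f) \<in> borel_measurable borel" if "t > 0" "f \<in> bounded_borel" for t f
    unfolding K_def by (rule kernel_measurable[OF kernel positive]) fact+
  show "measure (K t x) UNIV \<le> bnd" if "t > 0" for t x using measure_K[OF that] k_bound[OF that] by simp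
  show "(\<integral>y. integral\<^sup>L (K s y) f \<partial>K t x) = integral\<^sup>L (K (t + s) x) f" if s: "s > 0" and t: "t > 0" and f: "f \<in> bounded_borel" for s t f x
  proof -
    obtain C where C: "C > 0" "\<And>x. \<bar>f x\<bar> \<le> C" using f by (metis bounded_borelE)
    have "(\<lambda>y. integral\<^sup>L (K s y) f) \<in> bounded_borel"
    proof (rule bounded_borelI[OF meas[OF s f]])
      fix y
      have "\<bar>integral\<^sup>L (K s y) f\<bar> \<le> (\<integral>x. \<bar>f x\<bar> \<partial>K s y)" by (rule integral_abs_bound)
      also have "\<dots> \<le> (\<integral>x. C \<partial>K s y)"
        by (intro integral_mono integrable_bounded_borel[OF fin[OF s]] bounded_borel_abs bounded_borel_const f C)
      also have "\<dots> = k s y UNIV * C" using finite_borelD[OF fin[OF s, of y]] measure_K[OF s] by simp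
      also have "\<dots> \<le> bnd * C" using k_bound[OF s] C by (intro mult_right_mono) auto
      finally show "\<bar>integral\<^sup>L (K s y) f\<bar> \<le> bnd * C" .
    qed
    then have "(\<integral>y. integral\<^sup>L (K s y) f \<partial>K t x) = T t (T s f) x" unfolding T_eq[OF s f] using T_eq[OF t] by simp
    also have "\<dots> = T (t + s) f x"
      using semigroup s t f by (simp add: bounded_semigroup_def semigroup_on_def)
    finally show ?thesis using T_eq[of "t + s" f] s t f by simp
  qed
qed

lemma T_P: "t > 0 \<Longrightarrow> f \<in> bounded_borel \<Longrightarrow> T t f = P t f"
  unfolding P_def by (rule T_eq)

sublocale strong_feller_semigroup K bnd t0
proof
  show "continuous_on UNIV (P t0 f)" if "f \<in> bounded_borel" for f
    using feller that T_P[OF t0_pos that] by (auto simp: strongly_feller_def bcontfun_def)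
qed (rule t0_pos)

lemma k_P: "t > 0 \<Longrightarrow> A \<in> sets borel \<Longrightarrow> (\<lambda>x. k t x A) = P t (indicator A)"
  using measure_K P_indicator by auto

lemma k_not_borel: "t > 0 \<Longrightarrow> A \<notin> sets borel \<Longrightarrow> k t x A = 0"
  using measure_not_borel[OF finite_K] measure_K by metis

lemma S_eq:
  assumes "t > 0" shows "S t \<nu> A = (if A \<in> sets borel then pairing \<nu> (P t (indicator A)) else 0)"
  using assms k_P[of t A] k_not_borel[of t A] by (simp add: dual dual_operator_def pairing_def)

lemma S_Jordan:
  assumes t: "t > 0" and \<nu>: "\<nu> \<in> signed_measures" and A: "A \<in> sets borel"
  shows "S t \<nu> A = integral\<^sup>L (positive_part \<nu>) (P t (indicator A)) - integral\<^sup>L (positive_part (\<lambda>A. - \<nu> A)) (P t (indicator A))"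
  using S_eq[OF t] A by (simp add: pairing_def)

section \<open>Implications between the convergence statements\<close>

lemma convergent_semigroupI: "converges_pointwise T Q \<Longrightarrow> convergent_semigroup K bnd t0 Q"
proof
  fix f :: "'a \<Rightarrow> real" and x
  assume Q: "converges_pointwise T Q" and f: "f \<in> bounded_borel"
  then show "Q f \<in> bounded_borel" by (simp add: converges_pointwise_def)
  have "((\<lambda>t. T t f x) \<longlongrightarrow> Q f x) at_top" using Q f by (simp add: converges_pointwise_def)
  moreover have "\<forall>\<^sub>F t in at_top. T t f x = P t f x"
    using eventually_gt_at_top[of 0] by eventually_elim (use T_P f in auto)
  ultimately show "((\<lambda>t. P t f x) \<longlongrightarrow> Q f x) at_top" by (rule Lim_transform_eventually)
qed

lemma pointwise_if_on_compacts: "converges_on_compacts T Q \<Longrightarrow> converges_pointwise T Q"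
  unfolding converges_pointwise_def
proof (intro ballI conjI allI)
  fix f :: "'a \<Rightarrow> real" and x assume Q: "converges_on_compacts T Q" and f: "f \<in> bounded_borel"
  then have "Q f \<in> bcontfun" by (simp add: converges_on_compacts_def)
  then show "Q f \<in> bounded_borel"
    by (auto simp: bcontfun_def bounded_borel_def intro: borel_measurable_continuous_onI)
  have "uniform_limit X (\<lambda>t. T t f) (Q f) at_top" if "compact X" for X
    using Q f that by (simp add: converges_on_compacts_def)
  from this[of "{x}"] show "((\<lambda>t. T t f x) \<longlongrightarrow> Q f x) at_top" by simp
qed

lemma on_compacts_if_pointwise: assumes "converges_pointwise T Q" shows "converges_on_compacts T Q"
proof -
  interpret convergent_semigroup K bnd t0 Q by (rule convergent_semigroupI[OF assms])
  show ?thesis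
    unfolding converges_on_compacts_def
  proof (intro ballI conjI allI impI)
    fix f :: "'a \<Rightarrow> real" assume f: "f \<in> bounded_borel"
    show "Q f \<in> bcontfun"
      using continuous_Q[OF f] Q_bounded_borel[OF f] by (auto simp: bcontfun_def bounded_borel_def)
    fix X :: "'a set" assume "compact X"
    then have "uniform_limit X (\<lambda>t. P t f) (Q f) at_top" by (rule uniform_limit_Q[OF f])
    moreover have "\<forall>\<^sub>F t in at_top. \<forall>x\<in>X. P t f x = T t f x"
      using eventually_gt_at_top[of 0] by eventually_elim (use T_P f in auto)
    ultimately show "uniform_limit X (\<lambda>t. T t f) (Q f) at_top"
      by (subst (asm) uniform_limit_cong[where g="\<lambda>t. T t f" and i="Q f"]) auto
  qed
qed

text \<open>The limit is the image of \<open>\<nu>\<close> under the dual of \<open>Q\<close>. The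
  uniform setwise convergence is applied to both Jordan parts with \<open>e / 2\<close>.\<close>

lemma variation_if_pointwise: assumes "converges_pointwise T Q" shows "converges_in_variation S"
  unfolding converges_in_variation_def
proof
  interpret convergent_semigroup K bnd t0 Q by (rule convergent_semigroupI[OF assms])
  fix \<nu> :: "'a set \<Rightarrow> real" assume \<nu>: "\<nu> \<in> signed_measures"
  define \<nu>1 \<nu>2 where "\<nu>1 = positive_part \<nu>" and "\<nu>2 = positive_part (\<lambda>A. - \<nu> A)"
  have fin: "finite_borel \<nu>1" "finite_borel \<nu>2"
    unfolding \<nu>1_def \<nu>2_def using finite_borel_positive_part signed_measure_uminus[OF \<nu>] \<nu> by auto
  have signed: "(\<lambda>A. if A \<in> sets borel then integral\<^sup>L \<nu>1 (R (indicator A)) - integral\<^sup>L \<nu>2 (R (indicator A)) else 0) \<in> signed_measures"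
    if R: "\<And>x. daniell (\<lambda>f. R f x)" "\<And>f. f \<in> bounded_borel \<Longrightarrow> R f \<in> bounded_borel" for R :: "('a \<Rightarrow> real) \<Rightarrow> 'a \<Rightarrow> real"
  proof -
    obtain N1 where N1: "finite_borel N1" "\<And>f. f \<in> bounded_borel \<Longrightarrow> integral\<^sup>L \<nu>1 (R f) = integral\<^sup>L N1 f"
      using daniell_representation[OF daniell_comp[OF fin(1) R]] by metis
    obtain N2 where N2: "finite_borel N2" "\<And>f. f \<in> bounded_borel \<Longrightarrow> integral\<^sup>L \<nu>2 (R f) = integral\<^sup>L N2 f"
      using daniell_representation[OF daniell_comp[OF fin(2) R]] by metis
    have "(\<lambda>A. if A \<in> sets borel then integral\<^sup>L \<nu>1 (R (indicator A)) - integral\<^sup>L \<nu>2 (R (indicator A)) else 0) = (\<lambda>A. measure N1 A - measure N2 A)"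
      by (rule ext) (simp add: N1 N2 measure_eq_integral measure_not_borel)
    then show ?thesis using signed_measure_diff[OF signed_measure_measure[OF N1(1)] signed_measure_measure[OF N2(1)]] by simp
  qed
  define \<mu> where "\<mu> A = (if A \<in> sets borel then integral\<^sup>L \<nu>1 (Q (indicator A)) - integral\<^sup>L \<nu>2 (Q (indicator A)) else 0)" for A
  have \<mu>: "\<mu> \<in> signed_measures" unfolding \<mu>_def using daniell_Q Q_bounded_borel by (rule signed)
  have S: "S t \<nu> = (\<lambda>A. if A \<in> sets borel then integral\<^sup>L \<nu>1 (P t (indicator A)) - integral\<^sup>L \<nu>2 (P t (indicator A)) else 0)" if "t > 0" for t
    using S_eq[OF that] by (auto simp: pairing_def \<nu>1_def \<nu>2_def)
  have S_signed: "S t \<nu> \<in> signed_measures" if "t > 0" for t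
    unfolding S[OF that] using that by (intro signed daniell_P) auto
  have "((\<lambda>t. tv_norm (\<lambda>A. S t \<nu> A - \<mu> A)) \<longlongrightarrow> 0) at_top"
  proof (rule tendsto_tv_norm_zeroI)
    show "\<forall>\<^sub>F t in at_top. (\<lambda>A. S t \<nu> A - \<mu> A) \<in> signed_measures"
      using eventually_gt_at_top[of 0] by eventually_elim (intro signed_measure_diff S_signed \<mu>)
    fix e :: real assume "e > 0"
    then have e: "e / 2 > 0" by simp
    show "\<forall>\<^sub>F t in at_top. \<forall>A\<in>sets borel. \<bar>S t \<nu> A - \<mu> A\<bar> \<le> e"
      using uniform_setwise_convergence[OF fin(1) e] uniform_setwise_convergence[OF fin(2) e] eventually_gt_at_top[of 0]
    proof eventually_elim
      case (elim t)
      show ?case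
      proof
        fix A :: "'a set" assume A: "A \<in> sets borel"
        then show "\<bar>S t \<nu> A - \<mu> A\<bar> \<le> e"
          using elim(1)[rule_format, OF A] elim(2)[rule_format, OF A] unfolding \<mu>_def S[OF elim(3)]
          by (simp only: if_True)
      qed
    qed
  qed
  then show "\<exists>\<mu>\<in>signed_measures. ((\<lambda>t. tv_norm (\<lambda>A. S t \<nu> A - \<mu> A)) \<longlongrightarrow> 0) at_top" using \<mu> by blast
qed

lemma converges_pointwiseI:
  assumes "\<And>f x. f \<in> bounded_borel \<Longrightarrow> \<exists>l. ((\<lambda>t. P t f x) \<longlongrightarrow> l) at_top"
  shows "\<exists>Q. converges_pointwise T Q"
proof -
  obtain Q where Q: "\<And>f x. f \<in> bounded_borel \<Longrightarrow> ((\<lambda>t. P t f x) \<longlongrightarrow> Q f x) at_top" using assms by metis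
  have "converges_pointwise T Q"
    unfolding converges_pointwise_def
  proof (intro ballI conjI allI)
    fix f :: "'a \<Rightarrow> real" and x assume f: "f \<in> bounded_borel"
    obtain C where C: "\<And>x. \<bar>f x\<bar> \<le> C" using f by (metis bounded_borelE)
    from filterlim_compose[OF Q[OF f] real_Suc_at_top] have lim: "(\<lambda>n. P (real (Suc n)) f x) \<longlonglongrightarrow> Q f x" for x .
    show "Q f \<in> bounded_borel"
    proof (rule bounded_borel_LIMSEQ(1)[OF _ _ lim])
      show "\<bar>P (real (Suc n)) f x\<bar> \<le> bnd * C" for n x by (rule P_bound[OF _ f C]) simp
    qed (use f in auto)
    have "\<forall>\<^sub>F t in at_top. P t f x = T t f x"
      using eventually_gt_at_top[of 0] by eventually_elim (use T_P f in auto)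
    then show "((\<lambda>t. T t f x) \<longlongrightarrow> Q f x) at_top" by (rule Lim_transform_eventually[OF Q[OF f]])
  qed
  then show ?thesis by blast
qed

text \<open>Starting from the point mass at \<open>x\<close>, the dual semigroup reproduces the
  kernels \<open>k t x\<close>. Their convergence uniformly over sets carries over to integrals of
  bounded functions.\<close>

lemma pointwise_if_variation: assumes "converges_in_variation S" shows "\<exists>Q. converges_pointwise T Q"
proof (rule converges_pointwiseI)
  fix f :: "'a \<Rightarrow> real" and x assume f: "f \<in> bounded_borel"
  obtain C where C: "C > 0" "\<And>x. \<bar>f x\<bar> \<le> C" using f by (metis bounded_borelE)
  obtain \<delta> :: "'a measure" where \<delta>: "finite_borel \<delta>" "\<And>f. f \<in> bounded_borel \<Longrightarrow> integral\<^sup>L \<delta> f = f x"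
    using dirac_measure by blast
  have S\<delta>: "S t (measure \<delta>) A = k t x A" if t: "t > 0" for t A
    using S_eq[OF t] pairing_measure[OF \<delta>(1)] \<delta>(2) t P_bounded_borel[OF t bounded_borel_indicator[of A]]
      k_not_borel[OF t, of A] P_indicator[OF t] measure_K[OF t] by auto
  obtain \<mu> where \<mu>: "\<mu> \<in> signed_measures" and tv: "((\<lambda>t. tv_norm (\<lambda>A. S t (measure \<delta>) A - \<mu> A)) \<longlongrightarrow> 0) at_top"
    using assms signed_measure_measure[OF \<delta>(1)] unfolding converges_in_variation_def by blast
  have close: "\<forall>\<^sub>F t in at_top. \<forall>A. \<bar>k t x A - \<mu> A\<bar> \<le> e" if e: "e > 0" for e
  proof -
    have "\<forall>\<^sub>F t in at_top. tv_norm (\<lambda>A. S t (measure \<delta>) A - \<mu> A) < ennreal e"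
      by (rule order_tendstoD(2)[OF tv]) (use e in simp)
    then show ?thesis
      using eventually_gt_at_top[of 0]
    proof eventually_elim
      case (elim t)
      show ?case
      proof
        fix A
        show "\<bar>k t x A - \<mu> A\<bar> \<le> e"
        proof (cases "A \<in> sets borel")
          case True
          have "ennreal \<bar>S t (measure \<delta>) A - \<mu> A\<bar> \<le> tv_norm (\<lambda>A. S t (measure \<delta>) A - \<mu> A)"
            using abs_le_tv_norm[OF True, of "\<lambda>A. S t (measure \<delta>) A - \<mu> A"] .
          also have "\<dots> < ennreal e" by (rule elim(1))
          finally have "\<bar>S t (measure \<delta>) A - \<mu> A\<bar> < e" by (simp add: ennreal_less_iff)
          then show ?thesis using S\<delta>[OF elim(2)] by simp
        qed (use e k_not_borel[OF elim(2)] signed_measuresD(2)[OF \<mu>] in simp)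
      qed
    qed
  qed
  \<comment> \<open>The limit of positive kernels is nonnegative, so it equals its positive part and
    defines a measure.\<close>
  have \<mu>_nonneg: "0 \<le> \<mu> A" for A
  proof (rule field_le_epsilon)
    fix e :: real assume "e > 0"
    then have "\<forall>\<^sub>F t in at_top. (\<forall>A. \<bar>k t x A - \<mu> A\<bar> \<le> e) \<and> t > 0"
      by (intro eventually_conj close eventually_gt_at_top)
    then obtain t where t: "\<And>A. \<bar>k t x A - \<mu> A\<bar> \<le> e" "t > 0"
      using eventually_happens'[OF trivial_limit_at_top_linorder] by blast
    have "0 \<le> k t x A" using positive[OF t(2)] by (simp add: positive_kernel_def)
    then show "0 \<le> \<mu> A + e" using t(1)[of A] by linarith
  qed
  define N where "N = positive_part \<mu>"
  have N: "finite_borel N" unfolding N_def by (rule finite_borel_positive_part[OF \<mu>])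
  have mN: "measure N A = \<mu> A" if A: "A \<in> sets borel" for A
  proof -
    have "upper_variation (\<lambda>A. - \<mu> A) A \<le> 0" by (rule upper_variation_least) (use \<mu>_nonneg in auto)
    then have "measure (positive_part (\<lambda>A. - \<mu> A)) A = 0"
      using measure_positive_part[OF signed_measure_uminus[OF \<mu>] A] upper_variation_nonneg[OF signed_measure_uminus[OF \<mu>], of A] by simp
    then show ?thesis using Jordan_decomposition[OF \<mu> A] by (simp add: N_def)
  qed
  have "((\<lambda>t. P t f x) \<longlongrightarrow> integral\<^sup>L N f) at_top"
    unfolding tendsto_iff dist_real_def
  proof (intro allI impI)
    fix e :: real assume e: "e > 0"
    \<comment> \<open>The factor 2 of \<open>abs_pairing_le\<close> then leaves the bound
      \<open>e / 2\<close>, strictly below \<open>e\<close>.\<close>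
    then have "e / (4 * C) > 0" using C by simp
    from close[OF this] show "\<forall>\<^sub>F t in at_top. \<bar>P t f x - integral\<^sup>L N f\<bar> < e"
      using eventually_gt_at_top[of 0]
    proof eventually_elim
      case (elim t)
      let ?d = "\<lambda>A. measure (K t x) A - measure N A"
      have d: "?d \<in> signed_measures" by (intro signed_measure_diff signed_measure_measure finite_K elim N)
      have "pairing ?d f = integral\<^sup>L (K t x) f - integral\<^sup>L N f"
        using finite_K[OF elim(2)] N by (intro pairing_eqI[OF d daniell_integral daniell_integral _ f]) (auto simp: measure_eq_integral)
      moreover have "\<bar>pairing ?d f\<bar> \<le> 2 * (C * (e / (4 * C)))"
        by (rule abs_pairing_le[OF d _ f C(2)]) (use elim measure_K[OF elim(2)] mN in auto)
      ultimately show ?case using e C by (simp add: P_def)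
    qed
  qed
  then show "\<exists>l. ((\<lambda>t. P t f x) \<longlongrightarrow> l) at_top" ..
qed

text \<open>If \<open>f x \<noteq> 0\<close>, the measure representing
  \<open>f \<mapsto> Q f x\<close> is fixed because \<open>Q (P t f) = Q f\<close>, and its pairing
  with the fixed function \<open>f\<close> is \<open>f x\<close>.\<close>

lemma separates_if_pointwise:
  assumes "converges_pointwise T Q"
  shows "separates (common_fix signed_measures S) (common_fix bounded_borel T)"
  unfolding separates_def
proof (intro ballI impI)
  interpret convergent_semigroup K bnd t0 Q by (rule convergent_semigroupI[OF assms])
  fix f assume fix_f: "f \<in> common_fix bounded_borel T" and "f \<noteq> (\<lambda>_. 0)"
  then obtain x where x: "f x \<noteq> 0" by auto
  have f: "f \<in> bounded_borel" and Tf: "\<And>t. t > 0 \<Longrightarrow> T t f = f" using fix_f by (auto simp: common_fix_def)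
  obtain N where N: "finite_borel N" "\<And>f. f \<in> bounded_borel \<Longrightarrow> Q f x = integral\<^sup>L N f"
    using daniell_representation[OF daniell_Q] by metis
  have "S t (measure N) A = measure N A" if t: "t > 0" for t A
  proof (cases "A \<in> sets borel")
    case True
    then have ind: "indicator A \<in> bounded_borel" by auto
    have "S t (measure N) A = integral\<^sup>L N (P t (indicator A))"
      using S_eq[OF t] True pairing_measure[OF N(1) P_bounded_borel[OF t ind]] by simp
    also have "\<dots> = Q (P t (indicator A)) x" using N(2) P_bounded_borel[OF t ind] by simp
    also have "\<dots> = measure N A" using Q_P[OF ind t] N(2)[OF ind] measure_eq_integral[OF N(1) True] by simp
    finally show ?thesis .
  qed (use S_eq[OF t] measure_not_borel[OF N(1)] in simp)
  then have "measure N \<in> common_fix signed_measures S"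
    using signed_measure_measure[OF N(1)] by (auto simp: common_fix_def)
  moreover have "pairing (measure N) f \<noteq> 0"
  proof -
    have "((\<lambda>t. P t f x) \<longlongrightarrow> f x) at_top"
      by (rule tendsto_eventually) (use eventually_gt_at_top[of 0] in \<open>eventually_elim, use T_P f Tf in metis\<close>)
    then have "Q f x = f x" using Q_tendsto[OF f] tendsto_unique[OF trivial_limit_at_top_linorder] by blast
    then show ?thesis using pairing_measure[OF N(1) f] N(2)[OF f] x by simp
  qed
  ultimately show "\<exists>\<nu>\<in>common_fix signed_measures S. pairing \<nu> f \<noteq> 0" by blast
qed

text \<open>The positive part of a fixed signed measure need not be fixed, but the dual semigroup
  can only enlarge it: dropping the negative part gives \<open>\<nu> B \<le> \<integral> P t
  1\<^sub>B d\<nu>+ \<le> \<integral> P t 1\<^sub>A d\<nu>+\<close> in the case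
  \<open>B \<subseteq> A\<close>. Hence \<open>invariant_majorant\<close> places it below an
  invariant measure, which annihilates \<open>g\<close>.\<close>

lemma fixed_measure_positive_part_null:
  assumes \<nu>: "\<nu> \<in> signed_measures" and fix_\<nu>: "\<And>t A. t > 0 \<Longrightarrow> A \<in> sets borel \<Longrightarrow>
      \<nu> A = integral\<^sup>L (positive_part \<nu>) (P t (indicator A)) - integral\<^sup>L (positive_part (\<lambda>A. - \<nu> A)) (P t (indicator A))"
    and g: "g \<in> bounded_borel" "\<And>x. 0 \<le> g x" and null: "\<And>\<omega>. invariant \<omega> \<Longrightarrow> integral\<^sup>L \<omega> g = 0"
  shows "integral\<^sup>L (positive_part \<nu>) g = 0"
proof -
  note fin = finite_borel_positive_part[OF \<nu>]
  note fin2 = finite_borel_positive_part[OF signed_measure_uminus[OF \<nu>]]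
  have "measure (positive_part \<nu>) A \<le> integral\<^sup>L (positive_part \<nu>) (P t (indicator A))" if A: "A \<in> sets borel" and t: "t > 0" for A t
    unfolding measure_positive_part[OF \<nu> A]
  proof (rule upper_variation_least)
    fix B assume B: "B \<in> sets borel" "B \<subseteq> A"
    have ind: "indicator A \<in> bounded_borel" "indicator B \<in> bounded_borel" using A B by auto
    have "0 \<le> integral\<^sup>L (positive_part (\<lambda>A. - \<nu> A)) (P t (indicator B))"
      using ind t by (intro integral_nonneg_AE AE_I2 P_nonneg) auto
    then have "\<nu> B \<le> integral\<^sup>L (positive_part \<nu>) (P t (indicator B))" using fix_\<nu>[OF t B(1)] by simp
    also have "\<dots> \<le> integral\<^sup>L (positive_part \<nu>) (P t (indicator A))"
      by (intro integral_mono integrable_bounded_borel[OF fin] P_bounded_borel P_mono t ind)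
        (use B in \<open>auto simp: indicator_def\<close>)
    finally show "\<nu> B \<le> integral\<^sup>L (positive_part \<nu>) (P t (indicator A))" .
  qed
  then obtain \<omega> where "invariant \<omega>" "integral\<^sup>L (positive_part \<nu>) g \<le> integral\<^sup>L \<omega> g"
    using invariant_majorant[OF fin] g by metis
  moreover have "0 \<le> integral\<^sup>L (positive_part \<nu>) g" using g by (intro integral_nonneg_AE) auto
  ultimately show ?thesis using null by fastforce
qed

text \<open>Separation is used in contrapositive form: a nonnegative fixed function annihilated by
  all invariant measures is annihilated by both Jordan parts of every fixed signed measure.\<close>

lemma pointwise_if_separates:
  assumes "separates (common_fix signed_measures S) (common_fix bounded_borel T)"
  shows "\<exists>Q. converges_pointwise T Q"
proof (rule converges_pointwiseI, rule pointwise_convergence)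
  fix g :: "'a \<Rightarrow> real"
  assume g: "g \<in> bounded_borel" "\<And>x. 0 \<le> g x" and g_fix: "\<And>t. t > 0 \<Longrightarrow> P t g = g"
    and null: "\<And>\<omega>. invariant \<omega> \<Longrightarrow> integral\<^sup>L \<omega> g = 0"
  show "g = (\<lambda>_. 0)"
  proof (rule ccontr)
    assume "g \<noteq> (\<lambda>_. 0)"
    moreover have "g \<in> common_fix bounded_borel T" using g g_fix T_P by (auto simp: common_fix_def)
    ultimately obtain \<nu> where \<nu>: "\<nu> \<in> common_fix signed_measures S" "pairing \<nu> g \<noteq> 0"
      using assms unfolding separates_def by blast
    have sm: "\<nu> \<in> signed_measures" "(\<lambda>A. - \<nu> A) \<in> signed_measures"
      using \<nu> signed_measure_uminus by (auto simp: common_fix_def)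
    have fix_\<nu>: "\<nu> A = integral\<^sup>L (positive_part \<nu>) (P t (indicator A)) - integral\<^sup>L (positive_part (\<lambda>A. - \<nu> A)) (P t (indicator A))"
      if "t > 0" "A \<in> sets borel" for t A
      using S_Jordan[OF that(1) sm(1) that(2)] \<nu>(1) that(1) by (simp add: common_fix_def)
    have "integral\<^sup>L (positive_part \<nu>) g = 0"
      by (rule fixed_measure_positive_part_null[OF sm(1) fix_\<nu> g null])
    moreover have "integral\<^sup>L (positive_part (\<lambda>A. - \<nu> A)) g = 0"
      by (rule fixed_measure_positive_part_null[OF sm(2) _ g null]) (use fix_\<nu> in simp_all)
    ultimately show False using \<nu>(2) by (simp add: pairing_def)
  qed
qed

lemma limit_kernel_operator: assumes "converges_pointwise T Q" shows "kernel_operator Q"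
proof -
  interpret convergent_semigroup K bnd t0 Q by (rule convergent_semigroupI[OF assms])
  have "\<exists>N. finite_borel N \<and> (\<forall>f\<in>bounded_borel. Q f x = integral\<^sup>L N f)" for x
    using daniell_representation[OF daniell_Q[of x]] by metis
  then obtain N where N: "\<And>x. finite_borel (N x)" "\<And>x f. f \<in> bounded_borel \<Longrightarrow> Q f x = integral\<^sup>L (N x) f"
    by metis
  have mN: "measure (N x) A = Q (indicator A) x" if "A \<in> sets borel" for x A
    using N(2)[of "indicator A"] measure_eq_integral[OF N(1) that] that by auto
  have "has_kernel Q (\<lambda>x. measure (N x))"
    unfolding has_kernel_def bounded_kernel_def
  proof (intro conjI ballI allI)
    fix A :: "'a set" assume A: "A \<in> sets borel"
    then have "Q (indicator A) \<in> bounded_borel" using Q_bounded_borel by auto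
    then show "(\<lambda>x. measure (N x) A) \<in> borel_measurable borel" using mN[OF A] by auto
  next
    show "measure (N x) \<in> signed_measures" for x by (rule signed_measure_measure[OF N(1)])
  next
    have "tv_norm (measure (N x)) \<le> ennreal (2 * bnd)" for x
    proof (rule tv_norm_le[OF signed_measure_measure[OF N(1)]])
      fix A :: "'a set" assume A: "A \<in> sets borel"
      show "\<bar>measure (N x) A\<bar> \<le> bnd"
        using Q_bound[of "indicator A" 1 x] mN[OF A] A by (auto simp: indicator_def)
    qed
    then have "(SUP x. total_variation (measure (N x)) UNIV) \<le> ennreal (2 * bnd)"
      unfolding tv_norm_def by (intro SUP_least)
    then show "(SUP x. total_variation (measure (N x)) UNIV) < \<infinity>" by (rule le_less_trans) simp
  next
    fix f :: "'a \<Rightarrow> real" and x assume "f \<in> bounded_borel"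
    then show "Q f x = pairing (measure (N x)) f" using pairing_measure[OF N(1)] N(2) by simp
  qed
  then show ?thesis unfolding kernel_operator_def by blast
qed

text \<open>Since \<open>Q f = P t0 (P t0 (Q f))\<close>, the image of a bounded set consists of
  images of a bounded set under two applications of \<open>P t0\<close>, which are
  equicontinuous.\<close>

lemma limit_ultra_feller: assumes "converges_pointwise T Q" shows "ultra_feller Q"
  unfolding ultra_feller_def
proof (intro conjI allI impI limit_kernel_operator[OF assms])
  interpret convergent_semigroup K bnd t0 Q by (rule convergent_semigroupI[OF assms])
  fix B :: "('a \<Rightarrow> real) set" assume B: "B \<subseteq> bounded_borel" and fin: "(SUP f\<in>B. sup_norm f) < \<infinity>"
  define C where "C = enn2real (SUP f\<in>B. sup_norm f)"
  have C: "\<bar>f x\<bar> \<le> C" if "f \<in> B" for f x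
  proof -
    have "ennreal \<bar>f x\<bar> \<le> sup_norm f" unfolding sup_norm_def by (rule SUP_upper) simp
    also have "\<dots> \<le> (SUP f\<in>B. sup_norm f)" using that by (rule SUP_upper)
    also have "\<dots> = ennreal C" using fin by (simp add: C_def ennreal_enn2real)
    finally show ?thesis by (simp add: ennreal_le_iff C_def)
  qed
  have QB: "Q f \<in> bounded_borel" "\<bar>Q f x\<bar> \<le> bnd * C" "Q f = P t0 (P t0 (Q f))" if "f \<in> B" for f x
    using that B C Q_bounded_borel Q_bound[of f C] P_Q[OF _ t0_pos] by auto
  show "relatively_compactin strict_topology (Q ` B)"
  proof (rule strict_relatively_compact)
    show "\<bar>f x\<bar> \<le> bnd * C" if "f \<in> Q ` B" for f x using that QB by auto
    fix x :: 'a and e :: real assume "e > 0"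
    then obtain d where "d > 0" and d: "\<And>y f. dist y x < d \<Longrightarrow> f \<in> bounded_borel \<Longrightarrow> (\<And>z. \<bar>f z\<bar> \<le> bnd * C) \<Longrightarrow>
        \<bar>P t0 (P t0 f) y - P t0 (P t0 f) x\<bar> \<le> e"
      using equicontinuous_P_P[of e x "bnd * C"] by blast
    then show "\<exists>d>0. \<forall>y. dist y x < d \<longrightarrow> (\<forall>f\<in>Q ` B. \<bar>f y - f x\<bar> \<le> e)"
      using QB d by (intro exI[of _ d]) (metis imageE)
  qed
qed

end

theorem theorem5p4:
  fixes T :: "real \<Rightarrow> ('a::polish_space \<Rightarrow> real) \<Rightarrow> ('a \<Rightarrow> real)"
    and k :: "real \<Rightarrow> 'a \<Rightarrow> 'a set \<Rightarrow> real"
    and S :: "real \<Rightarrow> ('a set \<Rightarrow> real) \<Rightarrow> ('a set \<Rightarrow> real)"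
  assumes kernel: "\<And>t. t > 0 \<Longrightarrow> has_kernel (T t) (k t)"
    and positive: "\<And>t. t > 0 \<Longrightarrow> positive_kernel (k t)"
    and semigroup: "bounded_semigroup T"
    and dual: "\<And>t. t > 0 \<Longrightarrow> S t = dual_operator (k t)"
    and feller: "\<exists>t\<^sub>0>0. strongly_feller (T t\<^sub>0)"
  shows "((\<exists>Q. converges_pointwise T Q) \<longleftrightarrow> (\<exists>Q. converges_on_compacts T Q)) \<and>
    ((\<exists>Q. converges_on_compacts T Q) \<longleftrightarrow> converges_in_variation S) \<and>
    (converges_in_variation S \<longleftrightarrow>
       separates (common_fix signed_measures S) (common_fix bounded_borel T)) \<and>
    (\<forall>Q. converges_pointwise T Q \<or> converges_on_compacts T Q \<longrightarrow>
       kernel_operator Q \<and> ultra_feller Q)"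
proof -
  obtain t0 where "t0 > 0" "strongly_feller (T t0)" using feller by blast
  then interpret transition_semigroup T k S t0
    using kernel positive semigroup dual by unfold_locales
  show ?thesis
    using pointwise_if_on_compacts on_compacts_if_pointwise variation_if_pointwise pointwise_if_variation
      separates_if_pointwise pointwise_if_separates limit_kernel_operator limit_ultra_feller
    by blast
qed

end
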